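(* Let $G=(V,E)$ be an undirected graph on the vertex set $V=\{1,\dots,5\}$, and let $I_G\subseteq\mathbb{C}[\sigma_{ij}:1\le i\le j\le 5]$ be the vanishing ideal of the Zariski closure of the Gaussian graphical model $\mathcal{M}(G)$. If $I_G$ is not toric (in the coordinates $\sigma_{ij}$), then there is no linear change of coordinates $S\in\mathrm{GL}_{15}(\mathbb{C})$ such that $S.I_G$ is toric.
   Context: For an undirected graph $G=(V,E)$ with $V=\{1,\dots,p\}$, the Gaussian graphical model is $\mathcal{M}(G)=\{\Sigma\in\mathrm{Sym}_p^+ : (\Sigma^{-1})_{ij}=0\text{ for all } i\neq j \text{ with } ij\notin E\}$, where $\mathrm{Sym}_p^+$ denotes the set of real symmetric positive definite $p\times p$ matrices. The coordinates of $\Sigma$ are the entries $\sigma_{ij}$ with $1\le i\le j\le p$ (so there are $15$ variables for $p=5$). The vanishing ideal is the ideal of all complex polynomials in the $\sigma_{ij}$ vanishing on $\mathcal{M}(G)$. A binomial is a polynomial of the form $x^a-\lambda x^b$ with $\lambda\in\mathbb{C}$ and $a,b$ exponent vectors with nonnegative integer entries; it is unital if $\lambda\in\{0,1\}$ (so monomials are unital binomials). An ideal of a polynomial ring is toric if it is prime and can be generated by unital binomials. The group $\mathrm{GL}_N(\mathbb{C})$ acts on a polynomial ring in $N$ variables via $(S.f)(x)=f(S^{-1}x)$, and $S.I=\{S.f:f\in I\}$. *)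

theory Defs
  imports
    "HOL-Analysis.Analysis"
    "HOL-Library.Poly_Mapping"
    "HOL-Algebra.Ideal"
begin

section \<open>Complex polynomials in finitely many variables\<close>

text \<open>A polynomial with variables indexed by \<open>'v\<close> maps exponent vectors, with finite
  support, to coefficients; multiplication of \<^typ>\<open>('v \<Rightarrow>\<^sub>0 nat) \<Rightarrow>\<^sub>0 complex\<close> is convolution.\<close>

type_synonym 'v cpoly = "('v \<Rightarrow>\<^sub>0 nat) \<Rightarrow>\<^sub>0 complex"

definition Const :: "complex \<Rightarrow> 'v cpoly" where
  "Const c = Poly_Mapping.single 0 c"

definition Var :: "'v \<Rightarrow> 'v cpoly" where
  "Var v = Poly_Mapping.single (Poly_Mapping.single v 1) 1"

definition poly_eval :: "'v::finite cpoly \<Rightarrow> complex ^ 'v \<Rightarrow> complex" where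
  "poly_eval f x =
     (\<Sum>m\<in>Poly_Mapping.keys f.
        Poly_Mapping.lookup f m * (\<Prod>v\<in>UNIV. x $ v ^ Poly_Mapping.lookup m v))"

definition poly_subst :: "('v::finite \<Rightarrow> 'w cpoly) \<Rightarrow> 'v cpoly \<Rightarrow> 'w cpoly" where
  "poly_subst g f =
     (\<Sum>m\<in>Poly_Mapping.keys f.
        Const (Poly_Mapping.lookup f m) * (\<Prod>v\<in>UNIV. g v ^ Poly_Mapping.lookup m v))"

definition cpoly_ring :: "'v cpoly ring" where
  "cpoly_ring = \<lparr>carrier = UNIV, monoid.mult = (*), one = 1, ring.zero = 0, add = (+)\<rparr>"


section \<open>Linear changes of coordinates\<close>

text \<open>\<open>(S.f)(x) = f(S\<^sup>-\<^sup>1 x)\<close>: the variable \<open>v\<close> is replaced by the \<open>v\<close>-th coordinate of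
  \<open>S\<^sup>-\<^sup>1 x\<close>. Meaningful only for invertible \<open>S\<close>; see \<open>poly_eval_lin_act\<close> below.\<close>

definition lin_act :: "complex ^ 'v ^ 'v \<Rightarrow> 'v::finite cpoly \<Rightarrow> 'v cpoly" where
  "lin_act S = poly_subst (\<lambda>v. \<Sum>w\<in>UNIV. Const (matrix_inv S $ v $ w) * Var w)"


section \<open>Toric ideals\<close>

definition unital_binomial :: "'v cpoly \<Rightarrow> bool" where
  "unital_binomial f \<longleftrightarrow>
     (\<exists>a b. \<exists>c\<in>{0, 1}. f = Poly_Mapping.single a 1 - Poly_Mapping.single b c)"

definition toric_ideal :: "'v cpoly set \<Rightarrow> bool" where
  "toric_ideal I \<longleftrightarrow>
     primeideal I cpoly_ring \<and>
     (\<exists>B. (\<forall>f\<in>B. unital_binomial f) \<and> I = genideal cpoly_ring B)"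


section \<open>Zariski closure and vanishing ideal\<close>

definition zero_locus :: "'v::finite cpoly set \<Rightarrow> (complex ^ 'v) set" where
  "zero_locus F = {x. \<forall>f\<in>F. poly_eval f x = 0}"

definition zariski_closure :: "(complex ^ 'v::finite) set \<Rightarrow> (complex ^ 'v) set" where
  "zariski_closure X = \<Inter> {Z. X \<subseteq> Z \<and> (\<exists>F. Z = zero_locus F)}"

definition vanishing_ideal :: "(complex ^ 'v::finite) set \<Rightarrow> 'v cpoly set" where
  "vanishing_ideal X = {f. \<forall>x\<in>X. poly_eval f x = 0}"


section \<open>Gaussian graphical models\<close>

definition sym_pos_def :: "real ^ 'n ^ 'n \<Rightarrow> bool" where
  "sym_pos_def A \<longleftrightarrow> transpose A = A \<and> (\<forall>x. x \<noteq> 0 \<longrightarrow> x \<bullet> (A *v x) > 0)"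

text \<open>A graph on the vertex set \<open>'n\<close> is given by its set of edges, which are two-element sets.\<close>

definition gaussian_model :: "'n set set \<Rightarrow> (real ^ 'n ^ 'n) set" where
  "gaussian_model E =
     {A. sym_pos_def A \<and> (\<forall>i j. i \<noteq> j \<and> {i, j} \<notin> E \<longrightarrow> matrix_inv A $ i $ j = 0)}"

text \<open>The vertices \<open>1, \<dots>, 5\<close> are the elements of the numeral type \<^typ>\<open>5\<close>, in which \<open>5 = 0\<close>
  and whose order is \<open>0 < 1 < 2 < 3 < 4\<close>. The order only selects one of the two names
  \<open>\<sigma>\<^sub>i\<^sub>j = \<sigma>\<^sub>j\<^sub>i\<close> of an entry of a symmetric matrix.\<close>

typedef sigma_var = "{(i :: 5, j :: 5). i \<le> j}"
  by auto

instance sigma_var :: finite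
proof
  have "finite (range Rep_sigma_var)"
    by (rule finite_subset[OF subset_UNIV]) simp
  then show "finite (UNIV :: sigma_var set)"
    by (rule finite_imageD) (simp add: inj_def Rep_sigma_var_inject)
qed

definition sigma_coords :: "real ^ 5 ^ 5 \<Rightarrow> complex ^ sigma_var" where
  "sigma_coords A =
     (\<chi> v. case Rep_sigma_var v of (i, j) \<Rightarrow> complex_of_real (A $ i $ j))"

definition graph_ideal :: "5 set set \<Rightarrow> sigma_var cpoly set" where
  "graph_ideal E = vanishing_ideal (zariski_closure (sigma_coords ` gaussian_model E))"


section \<open>Consistency of the definitions\<close>

lemma card_sigma_var: "CARD(sigma_var) = 15"
proof -
  let ?A = "{(i :: 5, j :: 5). i \<le> j}"
  have un: "?A \<union> ?A\<inverse> = UNIV"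
    by auto
  have int: "?A \<inter> ?A\<inverse> = Id"
    by auto
  have "card ?A + card (?A\<inverse>) = card (?A \<union> ?A\<inverse>) + card (?A \<inter> ?A\<inverse>)"
    by (rule card_Un_Int) simp_all
  also have "\<dots> = CARD(5 \<times> 5) + card (Id :: (5 \<times> 5) set)"
    unfolding un int ..
  also have "(Id :: (5 \<times> 5) set) = (\<lambda>i. (i, i)) ` UNIV"
    by auto
  also have "CARD(5 \<times> 5) + card ((\<lambda>i :: 5. (i, i)) ` UNIV) = 30"
    by (simp add: card_image inj_def)
  finally have "card ?A = 15"
    by simp
  then show ?thesis
    by (simp add: type_definition.card[OF type_definition_sigma_var])
qed

lemma cring_cpoly_ring: "cring cpoly_ring"
proof (rule cringI)
  show "abelian_group (cpoly_ring :: 'v cpoly ring)"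
  proof (rule abelian_groupI)
    fix f :: "'v cpoly"
    assume "f \<in> carrier cpoly_ring"
    show "\<exists>g\<in>carrier cpoly_ring. g \<oplus>\<^bsub>cpoly_ring\<^esub> f = \<zero>\<^bsub>cpoly_ring\<^esub>"
      by (rule bexI[of _ "- f"]) (simp_all add: cpoly_ring_def)
  qed (simp_all add: cpoly_ring_def ac_simps)
  show "comm_monoid (cpoly_ring :: 'v cpoly ring)"
    by (rule comm_monoidI) (simp_all add: cpoly_ring_def ac_simps)
qed (simp_all add: cpoly_ring_def distrib_right)

lemma cpoly_sum_single:
  fixes f :: "'v cpoly"
  shows "f = (\<Sum>m\<in>Poly_Mapping.keys f. Poly_Mapping.single m (Poly_Mapping.lookup f m))"
  by (rule poly_mapping_eqI)
     (auto simp: lookup_sum lookup_single when_def in_keys_iff)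

lemma poly_eval_superset:
  assumes "finite A" "Poly_Mapping.keys f \<subseteq> A"
  shows "poly_eval f x =
    (\<Sum>m\<in>A. Poly_Mapping.lookup f m * (\<Prod>v\<in>UNIV. x $ v ^ Poly_Mapping.lookup m v))"
  unfolding poly_eval_def using assms
  by (intro sum.mono_neutral_left) (auto simp: in_keys_iff)

lemma poly_eval_add: "poly_eval (f + g) x = poly_eval f x + poly_eval g x"
proof -
  let ?A = "Poly_Mapping.keys f \<union> Poly_Mapping.keys g"
  have "Poly_Mapping.keys (f + g) \<subseteq> ?A"
    by (rule keys_add)
  then show ?thesis
    by (simp add: poly_eval_superset[of ?A] lookup_add distrib_right sum.distrib)
qed

lemma poly_eval_sum: "poly_eval (\<Sum>i\<in>A. f i) x = (\<Sum>i\<in>A. poly_eval (f i) x)"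
  by (induction A rule: infinite_finite_induct) (auto simp: poly_eval_add poly_eval_def[of 0])

lemma poly_eval_single:
  "poly_eval (Poly_Mapping.single m c) x = c * (\<Prod>v\<in>UNIV. x $ v ^ Poly_Mapping.lookup m v)"
  by (simp add: poly_eval_superset[of "{m}"])

lemma poly_eval_mult: "poly_eval (f * g) x = poly_eval f x * poly_eval g x"
proof -
  have "f * g = (\<Sum>m\<in>Poly_Mapping.keys f. \<Sum>n\<in>Poly_Mapping.keys g.
      Poly_Mapping.single (m + n) (Poly_Mapping.lookup f m * Poly_Mapping.lookup g n))"
    by (subst (1) cpoly_sum_single[of f], subst (1) cpoly_sum_single[of g])
       (simp add: sum_product mult_single)
  moreover have "poly_eval f x * poly_eval g x =
      (\<Sum>m\<in>Poly_Mapping.keys f. \<Sum>n\<in>Poly_Mapping.keys g.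
        (Poly_Mapping.lookup f m * Poly_Mapping.lookup g n) *
        (\<Prod>v\<in>UNIV. x $ v ^ Poly_Mapping.lookup (m + n) v))"
    unfolding poly_eval_def sum_product
    by (intro sum.cong refl) (simp add: lookup_add power_add prod.distrib mult_ac)
  ultimately show ?thesis
    by (simp add: poly_eval_sum poly_eval_single)
qed

lemma poly_eval_Const [simp]: "poly_eval (Const c) x = c"
  by (simp add: Const_def poly_eval_single)

lemma poly_eval_one [simp]: "poly_eval 1 x = 1"
  using poly_eval_single[of 0 1 x] by simp

lemma poly_eval_Var [simp]: "poly_eval (Var w) x = x $ w"
proof -
  have "(\<Prod>v\<in>UNIV. x $ v ^ Poly_Mapping.lookup (Poly_Mapping.single w (1::nat)) v)
      = (\<Prod>v\<in>UNIV. if v = w then x $ v else 1)"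
    by (intro prod.cong) (auto simp: lookup_single)
  then show ?thesis
    by (simp add: Var_def poly_eval_single)
qed

lemma poly_eval_power: "poly_eval (f ^ k) x = poly_eval f x ^ k"
  by (induction k) (simp_all add: poly_eval_mult)

lemma poly_eval_prod: "poly_eval (\<Prod>i\<in>A. f i) x = (\<Prod>i\<in>A. poly_eval (f i) x)"
  by (induction A rule: infinite_finite_induct) (auto simp: poly_eval_mult)

lemma poly_eval_subst: "poly_eval (poly_subst g f) x = poly_eval f (\<chi> v. poly_eval (g v) x)"
  unfolding poly_subst_def
  by (simp add: poly_eval_sum poly_eval_mult poly_eval_prod poly_eval_power poly_eval_def[of f])

lemma poly_eval_lin_act: "poly_eval (lin_act S f) x = poly_eval f (matrix_inv S *v x)"
  by (simp add: lin_act_def poly_eval_subst poly_eval_sum poly_eval_mult matrix_vector_mult_def)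

lemma vanishing_ideal_zariski_closure: "vanishing_ideal (zariski_closure X) = vanishing_ideal X"
proof
  have "X \<subseteq> zariski_closure X"
    by (auto simp: zariski_closure_def)
  then show "vanishing_ideal (zariski_closure X) \<subseteq> vanishing_ideal X"
    by (auto simp: vanishing_ideal_def)
  have "zariski_closure X \<subseteq> zero_locus (vanishing_ideal X)"
    unfolding zariski_closure_def
    by (rule Inter_lower) (use zero_locus_def vanishing_ideal_def in blast)
  then show "vanishing_ideal X \<subseteq> vanishing_ideal (zariski_closure X)"
    by (auto simp: zero_locus_def vanishing_ideal_def)
qed

end

theory Submission
  imports Defs "HOL-Computational_Algebra.Polynomial"
begin

text \<open>If every two nonadjacent vertices are separated by at most one vertex, then the model is
  Zariski dense in the set of symmetric matrices with positive diagonal satisfying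
  \<open>\<sigma>\<^sub>v\<^sub>w \<sigma>\<^sub>k\<^sub>k = \<sigma>\<^sub>v\<^sub>k \<sigma>\<^sub>k\<^sub>w\<close> and \<open>\<sigma>\<^sub>v\<^sub>w = 0\<close> for separated pairs. This set is closed under the
  entrywise product, so independence of characters shows that its ideal is spanned by binomials,
  and the ideal is toric.

  Otherwise the graph has a 4-cycle \<open>i, a, j, b\<close> with \<open>i\<close>, \<open>j\<close> nonadjacent, or it is a 5-cycle. If \<open>S.I\<close>
  is toric, then each homogeneous element of degree \<open>k\<close> of the ideal is a sum of elements of the
  ideal that are differences of two products of \<open>k\<close> linear forms; such an element depends on at most
  \<open>2k\<close> linear forms. But the ideal contains a minor of degree 4 (respectively 3) with the
  monomial \<open>\<sigma>\<^sub>i\<^sub>j \<sigma>\<^sub>a\<^sub>a \<sigma>\<^sub>b\<^sub>b \<sigma>\<^sub>c\<^sub>c\<close> (respectively \<open>\<sigma>\<^sub>i\<^sub>j \<sigma>\<^sub>a\<^sub>a \<sigma>\<^sub>b\<^sub>b\<close>), and vanishing on the Markov chains along the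
  paths inside the cycle forces any form of that degree in the ideal containing this monomial to depend on
  9 (respectively 8) independent coordinates.\<close>

section \<open>Symmetric trilinear forms vanishing on Markov chains\<close>

text \<open>About a single summand of the minor nothing is known except that it vanishes on the
  model and is a difference of two products. Some summand has a nonzero coefficient at the
  distinguished monomial, and the work lies in computing enough further coefficients of this unknown
  form from its zeros alone. The zeros are explicit chain covariances, so vanishing becomes
  vanishing of coefficients of polynomials in the chain parameters. The counts that clash are 6 < 8
  and 8 < 9. The ninth coordinate is \<open>\<sigma>_cc\<close>: in a 4-cycle the fifth vertex
  \<open>c\<close> may have any neighbours, so its row and column cannot be removed from the minor,
  and \<open>c\<close> is made independent of the chain instead. In a 5-cycle \<open>c\<close>
  subdivides an edge and has to take part in the chains, but it is not adjacent to \<open>j\<close>,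
  which permits a cubic minor. That there are five vertices enters through Menger's theorem: two
  internally disjoint paths between nonadjacent vertices have at most three interior vertices in
  total, so they form a cycle of length 4 or 5.\<close>

lemma poly_eq_0_if_zero_on_interval:
  assumes "\<And>d::real. 0 < d \<Longrightarrow> d < 1 \<Longrightarrow> poly p (complex_of_real d) = 0"
  shows "p = 0"
proof (rule ccontr)
  assume "p \<noteq> 0"
  then have "finite {z. poly p z = 0}"
    by (rule poly_roots_finite)
  then have "finite (complex_of_real ` {0<..<1})"
    by (rule finite_subset[rotated]) (auto simp: assms)
  then have "finite {0<..<1::real}"
    by (rule finite_imageD) (simp add: inj_on_def)
  then show False
    using infinite_Ioo[of "0::real" 1] by simp
qed

text \<open>Covariance matrices of Markov chains \<open>i - a - j - b\<close>, with the rows and columns of \<open>i\<close> and \<open>j\<close>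
  scaled by \<open>d\<close> and \<open>e\<close>: the vectors \<open>A\<close>, \<open>B\<close>, \<open>C\<close>, \<open>ai\<close>, \<open>\<dots>\<close> stand for the coordinates
  \<open>\<sigma>\<^sub>a\<^sub>a\<close>, \<open>\<sigma>\<^sub>b\<^sub>b\<close>, \<open>\<sigma>\<^sub>a\<^sub>b\<close>, \<open>\<sigma>\<^sub>a\<^sub>i\<close>, \<open>\<dots>\<close>. The entries are normalised to \<open>\<sigma>\<^sub>a\<^sub>b = 1\<close> and, for \<open>e = 1\<close>, \<open>\<sigma>\<^sub>j\<^sub>j = 1\<close>,
  and \<open>u, w \<ge> 5\<close>, \<open>t \<le> 2\<close>, \<open>S \<ge> u + w\<close> ensure positive definiteness.\<close>

definition chain_points ::
  "complex ^ 'n \<Rightarrow> complex ^ 'n \<Rightarrow> complex ^ 'n \<Rightarrow> complex ^ 'n \<Rightarrow> complex ^ 'n \<Rightarrow>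
   complex ^ 'n \<Rightarrow> complex ^ 'n \<Rightarrow> complex ^ 'n \<Rightarrow> complex ^ 'n \<Rightarrow> complex ^ 'n \<Rightarrow> (complex ^ 'n) set" where
  "chain_points A B C ai bi aj bj ij ii jj =
    {of_real u *s A + of_real w *s B + C
       + of_real d *s (of_real u *s ai + bi) + of_real e *s (of_real t *s aj + of_real (1 / t) *s bj)
       + of_real (d * e * t) *s ij + of_real (d\<^sup>2 * S) *s ii + of_real (e\<^sup>2) *s jj | u w t S d e :: real.
     5 \<le> u \<and> 5 \<le> w \<and> t \<in> {1, 2, 1/2} \<and> u + w \<le> S \<and> 0 < d \<and> d < 1 \<and> 0 < e \<and> e < 1}"

text \<open>Abstracting from the origin of \<open>F\<close> lets one elimination serve three forms:
  the polarised cubic, the polarised quartic with one argument fixed, and an auxiliary product of a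
  coordinate with a bilinear form.\<close>

locale sym_trilinear =
  fixes F :: "complex ^ 'n \<Rightarrow> complex ^ 'n \<Rightarrow> complex ^ 'n \<Rightarrow> complex"
  assumes add_left: "F (x + x') y z = F x y z + F x' y z"
    and scale_left: "F (c *s x) y z = c * F x y z"
    and swap12: "F x y z = F y x z"
    and swap23: "F x y z = F x z y"
begin

lemma add_mid: "F x (y + y') z = F x y z + F x y' z"
  using add_left swap12 by metis

lemma add_right: "F x y (z + z') = F x y z + F x y z'"
  using add_mid swap23 by metis

lemma scale_mid: "F x (c *s y) z = c * F x y z"
  using scale_left swap12 by metis

lemma scale_right: "F x y (c *s z) = c * F x y z"
  using scale_mid swap23 by metis

lemmas expand = add_left add_mid add_right scale_left scale_mid scale_right

lemma zero_left: "F 0 y z = 0"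
  using scale_left[of 0 0 y z] by simp

text \<open>The cube of \<open>F\<close> along the curve is a polynomial of degree 6 in
  \<open>d\<close> with infinitely many zeros; the claims are its three lowest coefficients, divided
  by 1, 3 and 3.\<close>

lemma quadratic_curve:
  assumes "\<And>d::real. 0 < d \<Longrightarrow> d < 1 \<Longrightarrow>
    (let y = x + of_real d *s p + (of_real d)\<^sup>2 *s r in F y y y) = 0"
  shows "F x x x = 0" "F x x p = 0" "F x p p + F x x r = 0"
proof -
  let ?q = "[:F x x x, 3 * F x x p, 3 * (F x p p + F x x r), F p p p + 6 * F x p r,
    3 * (F x r r + F p p r), 3 * F p r r, F r r r:]"
  have "?q = 0"
  proof (rule poly_eq_0_if_zero_on_interval)
    fix d :: real assume d: "0 < d" "d < 1"
    have s: "F p x x = F x x p" "F x p x = F x x p" "F r x x = F x x r" "F x r x = F x x r"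
      "F p x p = F x p p" "F p p x = F x p p" "F r x r = F x r r" "F r r x = F x r r"
      "F r p p = F p p r" "F p r p = F p p r" "F r p r = F p r r" "F r r p = F p r r"
      "F x r p = F x p r" "F p x r = F x p r" "F p r x = F x p r" "F r x p = F x p r" "F r p x = F x p r"
      by (metis swap12 swap23)+
    show "poly ?q (of_real d) = 0"
      using assms[OF d]
      by (simp add: Let_def expand s algebra_simps power2_eq_square)
  qed
  then show "F x x x = 0" "F x x p = 0" "F x p p + F x x r = 0"
    by (simp_all del: distrib_left_numeral)
qed

text \<open>Handles an expression already linearised in one parameter when the other parameter
  varies; with \<open>r = 0\<close> it also serves to differentiate along \<open>A\<close> and
  \<open>B\<close>.\<close>

lemma linear_quadratic_curve:
  assumes "\<And>d::real. 0 < d \<Longrightarrow> d < 1 \<Longrightarrow>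
    (let y = x + of_real d *s q + (of_real d)\<^sup>2 *s r in F y y (p + of_real d *s s)) = 0"
  shows "F x x p = 0" "2 * F x q p + F x x s = 0"
proof -
  let ?q = "[:F x x p, 2 * F x q p + F x x s, F q q p + 2 * F x r p + 2 * F x q s,
    F q q s + 2 * F x r s + 2 * F q r p, F r r p + 2 * F q r s, F r r s:]"
  have "?q = 0"
  proof (rule poly_eq_0_if_zero_on_interval)
    fix d :: real assume d: "0 < d" "d < 1"
    have s: "F q x z = F x q z" "F r x z = F x r z" "F r q z = F q r z" for z
      by (metis swap12)+
    show "poly ?q (of_real d) = 0"
      using assms[OF d]
      by (simp add: Let_def expand s algebra_simps power2_eq_square)
  qed
  then show "F x x p = 0" "2 * F x q p + F x x s = 0"
    by simp_all
qed

definition chain_zero where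
  "chain_zero A B C ai bi aj bj ij ii jj \<longleftrightarrow>
    (\<forall>y\<in>chain_points A B C ai bi aj bj ij ii jj. F y y y = 0)"

text \<open>A chain point is polynomial in the scalings \<open>d\<close> and \<open>e\<close>.
  Coefficients are extracted in \<open>d\<close> for fixed \<open>e\<close> and then in
  \<open>e\<close>, which yields those of bidegree (0,0), (1,0), the \<open>ii\<close> part of
  (2,0), (0,2) and (1,1).\<close>

lemma chain_zero_coeffs:
  fixes u w t :: real
  assumes "chain_zero A B C ai bi aj bj ij ii jj" and "5 \<le> u" "5 \<le> w" "t \<in> {1, 2, 1/2}"
  defines "x \<equiv> of_real u *s A + of_real w *s B + C"
    and "p \<equiv> of_real u *s ai + bi"
    and "q \<equiv> of_real t *s aj + of_real (1 / t) *s bj"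
  shows "F x x x = 0" "F x x p = 0" "F x x ii = 0" "F x q q + F x x jj = 0"
    "2 * F x q p + of_real t * F x x ij = 0"
proof -
  define x' where "x' e = x + of_real e *s q + (of_real e)\<^sup>2 *s jj" for e :: real
  define p' where "p' e = p + of_real e *s (of_real t *s ij)" for e :: real
  have *: "F (x' e) (x' e) (x' e) = 0" "F (x' e) (x' e) (p' e) = 0"
     "F (x' e) (p' e) (p' e) + F (x' e) (x' e) (of_real S *s ii) = 0"
    if "0 < e" "e < 1" "u + w \<le> S" for e S
  proof -
    have "(let y = x' e + of_real d *s p' e + (of_real d)\<^sup>2 *s (of_real S *s ii) in F y y y) = 0"
      if "0 < d" "d < 1" for d :: real
    proof -
      have "x' e + of_real d *s p' e + (of_real d)\<^sup>2 *s (of_real S *s ii) = 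
         of_real u *s A + of_real w *s B + C
         + of_real d *s (of_real u *s ai + bi) + of_real e *s (of_real t *s aj + of_real (1 / t) *s bj)
         + of_real (d * e * t) *s ij + of_real (d\<^sup>2 * S) *s ii + of_real (e\<^sup>2) *s jj"
        by (simp add: x'_def p'_def x_def p_def q_def vec_eq_iff algebra_simps)
      moreover have "\<dots> \<in> chain_points A B C ai bi aj bj ij ii jj"
        unfolding chain_points_def using assms(2-4) that \<open>0 < e\<close> \<open>e < 1\<close> \<open>u + w \<le> S\<close> by blast
      ultimately show ?thesis
        using assms(1) unfolding Let_def chain_zero_def by metis
    qed
    from quadratic_curve[OF this]
    show "F (x' e) (x' e) (x' e) = 0" "F (x' e) (x' e) (p' e) = 0"
     "F (x' e) (p' e) (p' e) + F (x' e) (x' e) (of_real S *s ii) = 0" by simp_all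
  qed
  \<comment> \<open>Two admissible values of \<open>S\<close> differ by 1, so subtracting the two
    identities isolates the coefficient of \<open>ii\<close>.\<close>
  have ii: "F (x' e) (x' e) ii = 0" if "0 < e" "e < 1" for e
    using *(3)[OF that, of "u + w"] *(3)[OF that, of "u + w + 1"]
    unfolding scale_right by (simp add: algebra_simps)
  show "F x x x = 0" "F x q q + F x x jj = 0"
    using quadratic_curve[of x q jj] *(1)[OF _ _ order_refl] by (simp_all add: x'_def Let_def)
  show "F x x p = 0" "2 * F x q p + of_real t * F x x ij = 0"
    using linear_quadratic_curve[of x q jj p "of_real t *s ij"] *(2)[OF _ _ order_refl]
    by (simp_all add: x'_def p'_def Let_def scale_right)
  show "F x x ii = 0"
    using linear_quadratic_curve(1)[of x q jj ii 0] ii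
    by (simp add: x'_def Let_def)
qed

end

text \<open>The four families belong to the four Hamiltonian paths of the cycle
  \<open>i - a - j - b - i\<close>, each obtained by deleting one edge.\<close>

locale four_chains = sym_trilinear F
  for F :: "complex ^ 'n \<Rightarrow> complex ^ 'n \<Rightarrow> complex ^ 'n \<Rightarrow> complex" +
  fixes A B C ai bi aj bj ij ii jj :: "complex ^ 'n"
  assumes chains: "chain_zero A B C ai bi aj bj ij ii jj" "chain_zero B A C bi ai bj aj ij ii jj"
    "chain_zero A B C aj bj ai bi ij jj ii" "chain_zero B A C bj aj bi ai ij jj ii"
begin

lemma swap_ij: "four_chains F A B C aj bj ai bi ij jj ii"
  by unfold_locales (use chains in auto)

text \<open>The part of a chain point of degree 0 in \<open>d\<close> and \<open>e\<close>: the
  marginal covariance of \<open>a\<close> and \<open>b\<close>, normalised to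
  \<open>\<sigma>_ab = 1\<close>.\<close>

definition X :: "real \<Rightarrow> real \<Rightarrow> complex ^ 'n" where
  "X u w = of_real u *s A + of_real w *s B + C"

lemma X_commute: "of_real w *s B + of_real u *s A + C = X u w"
  by (simp add: X_def)

context
  fixes u w :: real
  assumes uw: "5 \<le> u" "5 \<le> w"
begin

text \<open>\<open>u * w - 1\<close> is the determinant of the marginal covariance of
  \<open>a\<close> and \<open>b\<close>; the linear systems below are solved by dividing by
  it.\<close>

lemma uw_neq: "of_real u * of_real w \<noteq> (1::complex)"
proof -
  have "u * w \<ge> 5 * 5" using uw by (intro mult_mono) auto
  then have "u * w \<noteq> 1" by simp
  then show ?thesis by (metis of_real_eq_1_iff of_real_mult)
qed

lemma cube_X: "F (X u w) (X u w) (X u w) = 0"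
  using chain_zero_coeffs(1)[OF chains(1) uw, of 1] by (simp add: X_def)

text \<open>The chain leaving \<open>i\<close> towards \<open>a\<close> kills the direction
  \<open>u ai + bi\<close>, the one leaving towards \<open>b\<close> kills \<open>ai + w bi\<close>.
  These are independent because the determinant \<open>u * w - 1\<close> is nonzero.\<close>

lemma square_X_i: "F (X u w) (X u w) ai = 0" "F (X u w) (X u w) bi = 0"
proof -
  have 1: "of_real u * F (X u w) (X u w) ai + F (X u w) (X u w) bi = 0"
    using chain_zero_coeffs(2)[OF chains(1) uw, of 1]
    unfolding X_def[symmetric] by (simp add: add_right scale_right)
  have 2: "of_real w * F (X u w) (X u w) bi + F (X u w) (X u w) ai = 0"
    using chain_zero_coeffs(2)[OF chains(2) uw(2,1), of 1] 
    unfolding X_commute by (simp add: add_right scale_right)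
  have "(of_real u * of_real w - 1) * F (X u w) (X u w) ai = 0"
    using 1 2 by Groebner_Basis.algebra
  with uw_neq show "F (X u w) (X u w) ai = 0" by simp
  with 1 show "F (X u w) (X u w) bi = 0" by simp
qed

lemma square_X_jj: "F (X u w) (X u w) jj = 0"
  using chain_zero_coeffs(3)[OF chains(3) uw, of 1] by (simp add: X_def)

text \<open>For \<open>q = t aj + (1/t) bj\<close> the value \<open>F x q q\<close> is a combination
  of \<open>t\<^sup>2\<close>, 1 and \<open>1/t\<^sup>2\<close>. Three values of \<open>t\<close>
  with distinct squares separate the coefficients, which is why \<open>t\<close> ranges over 1, 2
  and 1/2.\<close>

lemma X_square_j: "F (X u w) aj aj = 0" "F (X u w) aj bj = 0" "F (X u w) bj bj = 0"
proof -
  have *: "of_real t * (of_real t * F (X u w) aj aj + of_real (1 / t) * F (X u w) aj bj)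
      + of_real (1 / t) * (of_real t * F (X u w) aj bj + of_real (1 / t) * F (X u w) bj bj) = 0"
    if "t \<in> {1, 2, 1/2}" for t :: real
    using chain_zero_coeffs(4)[OF chains(1) uw that] square_X_jj swap23[of "X u w" bj aj]
    unfolding X_def[symmetric]
    by (simp add: add_mid add_right scale_mid scale_right distrib_left add_ac del: of_real_divide)
  have 1: "F (X u w) aj aj + 2 * F (X u w) aj bj + F (X u w) bj bj = 0"
    using *[of 1] by (simp add: add_ac)
  have 2: "16 * F (X u w) aj aj + 8 * F (X u w) aj bj + F (X u w) bj bj = 0"
    using *[of 2] by (simp add: field_simps) Groebner_Basis.algebra
  have 3: "F (X u w) aj aj + 8 * F (X u w) aj bj + 16 * F (X u w) bj bj = 0"
    using *[of "1/2"] by (simp add: field_simps) Groebner_Basis.algebra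
  show "F (X u w) aj aj = 0" "F (X u w) aj bj = 0" "F (X u w) bj bj = 0"
    using 1 2 3 by Groebner_Basis.algebra+
qed

text \<open>The 2 by 2 block of \<open>F (X u w)\<close> between \<open>ai, bi\<close> and
  \<open>aj, bj\<close> is \<open>- F (X u w) (X u w) ij / 2\<close> times the inverse of the
  marginal covariance of \<open>a\<close> and \<open>b\<close>, as for the Schur complement of
  \<open>\<sigma>_ij\<close>. Two values of \<open>t\<close> separate \<open>aj\<close> from
  \<open>bj\<close>.\<close>

lemma X_i_j:
  "2 * (of_real u * of_real w - 1) * F (X u w) ai aj = - of_real w * F (X u w) (X u w) ij"
  "2 * (of_real u * of_real w - 1) * F (X u w) ai bj = F (X u w) (X u w) ij"
  "2 * (of_real u * of_real w - 1) * F (X u w) bi aj = F (X u w) (X u w) ij"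
  "2 * (of_real u * of_real w - 1) * F (X u w) bi bj = - of_real u * F (X u w) (X u w) ij"
proof -
  have *: "2 * (t * F (X u w) aj p + inverse t * F (X u w) bj p) + t * F (X u w) (X u w) ij = 0"
    "2 * (t * F (X u w) aj p' + inverse t * F (X u w) bj p') + inverse t * F (X u w) (X u w) ij = 0"
    if "t \<in> {1, 2}" "p = of_real u *s ai + bi" "p' = of_real w *s bi + ai" for t p p'
  proof -
    have t: "Re t \<in> {1, 2, 1/2}" "1 / Re t \<in> {1, 2, 1/2}" "t = of_real (Re t)" using that(1) by auto
    show "2 * (t * F (X u w) aj p + inverse t * F (X u w) bj p) + t * F (X u w) (X u w) ij = 0"
      using chain_zero_coeffs(5)[OF chains(1) uw t(1)] t(3)
      unfolding X_def[symmetric] that(2)[symmetric] by (simp add: add_mid scale_mid divide_inverse)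
    \<comment> \<open>The second chain starts towards \<open>b\<close> and is used with parameter
      \<open>1 / t\<close>, so that it shares the vector \<open>q\<close> with the first; only the
      coefficient of \<open>ij\<close> changes to \<open>1 / t\<close>.\<close>
    show "2 * (t * F (X u w) aj p' + inverse t * F (X u w) bj p') + inverse t * F (X u w) (X u w) ij = 0"
      using chain_zero_coeffs(5)[OF chains(2) uw(2,1) t(2)] t(3)
      unfolding X_commute that(3)[symmetric] by (simp add: add_mid scale_mid divide_inverse add_ac)
  qed
  define p p' where "p = of_real u *s ai + bi" and "p' = of_real w *s bi + ai"
  have e: "2 * F (X u w) aj p + F (X u w) (X u w) ij = 0" "F (X u w) bj p = 0"
    "F (X u w) aj p' = 0" "2 * F (X u w) bj p' + F (X u w) (X u w) ij = 0"
    using *[of 1, OF _ p_def p'_def] *[of 2, OF _ p_def p'_def] by simp_all Groebner_Basis.algebra+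
  show "2 * (of_real u * of_real w - 1) * F (X u w) ai aj = - of_real w * F (X u w) (X u w) ij"
    "2 * (of_real u * of_real w - 1) * F (X u w) ai bj = F (X u w) (X u w) ij"
    "2 * (of_real u * of_real w - 1) * F (X u w) bi aj = F (X u w) (X u w) ij"
    "2 * (of_real u * of_real w - 1) * F (X u w) bi bj = - of_real u * F (X u w) (X u w) ij"
    using e unfolding p_def p'_def add_right scale_right
      swap23[of _ aj ai] swap23[of _ aj bi] swap23[of _ bj ai] swap23[of _ bj bi]
    by Groebner_Basis.algebra+
qed

end

text \<open>\<open>A\<close> and \<open>B\<close> are the derivatives of \<open>X u w\<close> in
  \<open>u\<close> and \<open>w\<close>, along which the cube remains zero since the parameters may
  only grow; \<open>C\<close> follows by linearity from the cube itself.\<close>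

lemma square_X_span:
  assumes "5 \<le> u" "5 \<le> w"
  shows "F (X u w) (X u w) A = 0" "F (X u w) (X u w) B = 0" "F (X u w) (X u w) C = 0"
proof -
  have e: "X u w + of_real d *s A + (of_real d)\<^sup>2 *s 0 = X (u + d) w"
    "X u w + of_real d *s B + (of_real d)\<^sup>2 *s 0 = X u (w + d)" for d
    by (simp_all add: X_def vec_eq_iff algebra_simps)
  show A: "F (X u w) (X u w) A = 0"
    by (rule quadratic_curve(2)[where r = 0], unfold e Let_def) (use assms cube_X in simp)
  show B: "F (X u w) (X u w) B = 0"
    by (rule quadratic_curve(2)[where r = 0], unfold e Let_def) (use assms cube_X in simp)
  have "F (X u w) (X u w) (of_real u *s A + of_real w *s B + C) = 0"
    using cube_X[OF assms] by (simp add: X_def)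
  then show "F (X u w) (X u w) C = 0"
    by (simp add: add_right scale_right A B)
qed

text \<open>The same differentiation in \<open>u\<close> and \<open>w\<close>, applied to the
  identity for \<open>F (X u w) (X u w) z\<close>.\<close>

lemma X_span_i:
  assumes "5 \<le> u" "5 \<le> w" and z: "z \<in> {ai, bi}"
  shows "F (X u w) A z = 0" "F (X u w) B z = 0" "F (X u w) C z = 0"
proof -
  have e: "X u w + of_real d *s A + (of_real d)\<^sup>2 *s 0 = X (u + d) w"
    "X u w + of_real d *s B + (of_real d)\<^sup>2 *s 0 = X u (w + d)" "z + of_real d *s 0 = z" for d
    by (simp_all add: X_def vec_eq_iff algebra_simps)
  have "2 * F (X u w) A z + F (X u w) (X u w) 0 = 0"
    by (rule linear_quadratic_curve(2)[where r = 0], unfold e Let_def) (use assms square_X_i in auto)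
  then show A: "F (X u w) A z = 0"
    using scale_right[of _ _ 0 0] by simp
  have "2 * F (X u w) B z + F (X u w) (X u w) 0 = 0"
    by (rule linear_quadratic_curve(2)[where r = 0], unfold e Let_def) (use assms square_X_i in auto)
  then show B: "F (X u w) B z = 0"
    using scale_right[of _ _ 0 0] by simp
  have "F (X u w) (of_real u *s A + of_real w *s B + C) z = 0"
    using square_X_i[OF assms(1,2)] z unfolding X_def[symmetric] by auto
  then show "F (X u w) C z = 0"
    by (simp add: add_mid scale_mid A B)
qed

text \<open>Up to the factor \<open>F A B ij\<close>, the part of \<open>F\<close> that is linear in both \<open>i\<close> and \<open>j\<close> is the
  polarisation of the minor of the rows \<open>i, a, b\<close> and columns \<open>j, a, b\<close>.\<close>

lemma F_i_j:
  shows "F A ai bj = 0" "F B ai bj = 0" "F C ai bj = F A B ij"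
    "F A bi aj = 0" "F B bi aj = 0" "F C bi aj = F A B ij"
    "F A ai aj = 0" "F B ai aj = - F A B ij" "F C ai aj = 0"
    "F A bi bj = - F A B ij" "F B bi bj = 0" "F C bi bj = 0"
    and square_X_ij: "5 \<le> u \<Longrightarrow> 5 \<le> w \<Longrightarrow> F (X u w) (X u w) ij = 2 * (of_real u * of_real w - 1) * F A B ij"
proof -
  have X: "F (X u w) y z = of_real u * F A y z + of_real w * F B y z + F C y z" for u w y z
    by (simp add: X_def add_left scale_left)
  have h: "F (X u w) (X u w) ij = of_real u * (of_real u * F A A ij + of_real w * F A B ij + F A C ij)
    + of_real w * (of_real u * F A B ij + of_real w * F B B ij + F B C ij)
    + (of_real u * F A C ij + of_real w * F B C ij + F C C ij)" for u w
    by (simp add: X_def expand swap12[of B A] swap12[of C A] swap12[of C B] algebra_simps)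
  have z: "F A y z = 0 \<and> F B y z = 0 \<and> F C y z = F A B ij"
    if eq: "\<And>u w. 5 \<le> u \<Longrightarrow> 5 \<le> w \<Longrightarrow>
      2 * (of_real u * of_real w - 1) * F (X u w) y z = F (X u w) (X u w) ij" for y z
  proof -
    have e: "2 * (of_nat m * of_nat n - 1) * (of_nat m * F A y z + of_nat n * F B y z + F C y z) = 
       of_nat m * (of_nat m * F A A ij + of_nat n * F A B ij + F A C ij)
    + of_nat n * (of_nat m * F A B ij + of_nat n * F B B ij + F B C ij)
    + (of_nat m * F A C ij + of_nat n * F B C ij + F C C ij)" if "5 \<le> m" "5 \<le> n" for m n :: nat
      using eq[of "real m" "real n"] that unfolding h unfolding X by simp
    \<comment> \<open>Both sides are polynomials in \<open>u\<close> and \<open>w\<close>. Comparing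
      \<open>u\<^sup>2 w\<close>, \<open>u w\<^sup>2\<close> and \<open>u w\<close> gives the three
      claims, and eight integer points in a 3 by 3 grid suffice for this comparison.\<close>
    show ?thesis
      using e[of 5 5] e[of 6 5] e[of 7 5] e[of 5 6] e[of 6 6] e[of 7 6] e[of 5 7] e[of 6 7]
      by simp Groebner_Basis.algebra
  qed
  show 1: "F A ai bj = 0" "F B ai bj = 0" "F C ai bj = F A B ij"
    using z[OF X_i_j(2)] by simp_all
  show 2: "F A bi aj = 0" "F B bi aj = 0" "F C bi aj = F A B ij"
    using z[OF X_i_j(3)] by simp_all
  show 3: "F (X u w) (X u w) ij = 2 * (of_real u * of_real w - 1) * F A B ij" if "5 \<le> u" "5 \<le> w" for u w
    using X_i_j(2)[OF that] by (simp add: X 1)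
  have 4: "F (X u w) ai aj = - of_real w * F A B ij" "F (X u w) bi bj = - of_real u * F A B ij"
    if "5 \<le> u" "5 \<le> w" for u w
  proof -
    let ?k = "2 * (of_real u * of_real w - 1) :: complex"
    have "?k * (F (X u w) ai aj + of_real w * F A B ij) = 0"
      "?k * (F (X u w) bi bj + of_real u * F A B ij) = 0"
      using X_i_j(1,4)[OF that] unfolding 3[OF that] by Groebner_Basis.algebra+
    then show "F (X u w) ai aj = - of_real w * F A B ij" "F (X u w) bi bj = - of_real u * F A B ij"
      using uw_neq[OF that] by (auto simp: eq_neg_iff_add_eq_0)
  qed
  show "F A ai aj = 0" "F B ai aj = - F A B ij" "F C ai aj = 0"
    "F A bi bj = - F A B ij" "F B bi bj = 0" "F C bi bj = 0"
    using 4[of 5 5] 4[of 6 5] 4[of 5 6] unfolding X by (simp_all, Groebner_Basis.algebra+)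
qed

text \<open>The coefficients of a kernel vector are eliminated in the order of their degree in \<open>a\<close> and \<open>b\<close>:
  first that of \<open>ij\<close>, then those of \<open>ai\<close>, \<open>bi\<close>, \<open>aj\<close>, \<open>bj\<close>, finally those of \<open>A\<close>, \<open>B\<close>, \<open>C\<close>.\<close>

lemma kernel_trivial:
  assumes v: "v = c1 *s ij + c2 *s A + c3 *s B + c4 *s C + c5 *s ai + c6 *s bi + c7 *s aj + c8 *s bj + c9 *s cc"
    and ker: "\<And>x y. F v x y = 0" and nz: "F A B ij \<noteq> 0"
    and cc: "F cc (X 5 5) (X 5 5) = 0" "\<And>z. z \<in> {ai, bi, aj, bj} \<Longrightarrow> F cc (X 5 5) z = 0"
      "F cc ai aj = 0" "F cc ai bj = 0" "F cc bi bj = 0"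
  shows "c1 = 0" "c2 = 0" "c3 = 0" "c4 = 0" "c5 = 0" "c6 = 0" "c7 = 0" "c8 = 0"
proof -
  interpret ji: four_chains F A B C aj bj ai bi ij jj ii
    by (rule swap_ij)
  define x where "x = X 5 5"
  have r: "F z x y = F x z y" for z y
    by (rule swap12)
  \<comment> \<open>The factor 48 is \<open>2 * (5 * 5 - 1)\<close>. Among the nine vectors only
    \<open>ij\<close> pairs nontrivially with \<open>x, x\<close>, so this pairing isolates
    \<open>c1\<close>.\<close>
  have xx: "F x x A = 0" "F x x B = 0" "F x x C = 0" "F x x ai = 0" "F x x bi = 0"
    "F x x aj = 0" "F x x bj = 0" "F x x ij = 48 * F A B ij" "F x x cc = 0"
    unfolding x_def using square_X_span[of 5 5] square_X_i[of 5 5] ji.square_X_i[of 5 5] square_X_ij[of 5 5]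
      cc(1) swap12[of cc] swap23[of _ cc] by simp_all
  have "c1 * (48 * F A B ij) = 0"
    using ker[of x x] swap12[of x v x] swap23[of x v x] unfolding v add_right scale_right by (simp add: xx)
  with nz show c1: "c1 = 0" by simp
  have s: "F x A z = 0" "F x B z = 0" "F x C z = 0" "F x cc z = 0" if "z \<in> {ai, bi, aj, bj}" for z
    unfolding x_def using X_span_i[of 5 5 z] ji.X_span_i[of 5 5 z] that cc(2) swap12[of cc] by auto
  have t: "F x y z = 0" if "y \<in> {ai, bi} \<and> z \<in> {ai, bi} \<or> y \<in> {aj, bj} \<and> z \<in> {aj, bj}" for y z
    unfolding x_def using X_square_j[of 5 5] ji.X_square_j[of 5 5] that swap23 by auto
  \<comment> \<open>The block is the matrix with diagonal -5 and off-diagonal 1, scaled by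
    \<open>F A B ij\<close>. Its determinant is 24 times a nonzero square, so both pairs of
    coefficients vanish.\<close>
  have g: "F x ai aj = - 5 * F A B ij" "F x ai bj = F A B ij" "F x bi aj = F A B ij" "F x bi bj = - 5 * F A B ij"
    by (simp_all add: x_def X_def add_left scale_left F_i_j)
  have ij: "c5 * (- 5 * F A B ij) + c6 * F A B ij = 0" "c5 * F A B ij + c6 * (- 5 * F A B ij) = 0"
    using ker[of x aj] ker[of x bj] unfolding v c1 r add_mid scale_mid by (simp_all add: s t g)
  show c5: "c5 = 0" and c6: "c6 = 0"
    using ij nz by Groebner_Basis.algebra+
  have ji: "c7 * (- 5 * F A B ij) + c8 * F A B ij = 0" "c7 * F A B ij + c8 * (- 5 * F A B ij) = 0"
    using ker[of x ai] ker[of x bi] swap23[of x aj ai] swap23[of x bj ai] swap23[of x aj bi] swap23[of x bj bi]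
    unfolding v c1 r add_mid scale_mid by (simp_all add: s t g)
  show c7: "c7 = 0" and c8: "c8 = 0"
    using ji nz by Groebner_Basis.algebra+
  \<comment> \<open>Of \<open>A\<close>, \<open>B\<close>, \<open>C\<close>, only \<open>C\<close>
    pairs nontrivially with \<open>ai, bj\<close>, only \<open>B\<close> with \<open>ai, aj\<close>,
    and only \<open>A\<close> with \<open>bi, bj\<close>.\<close>
  show "c4 = 0" "c3 = 0" "c2 = 0"
    using ker[of ai bj] ker[of ai aj] ker[of bi bj] nz
    unfolding v c1 c5 c6 c7 c8 add_left scale_left by (simp_all add: F_i_j cc)
qed

end

text \<open>Gaussian elimination: an equation with pivot \<open>k\<close> removes the unknown
  \<open>k\<close> from the others, leaving one equation and one unknown less. It supplies the
  common zero of the linear forms in the dimension count.\<close>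

lemma homogeneous_system_nontrivial:
  fixes ls :: "('i \<Rightarrow> 'a::field) list"
  assumes "finite I" "length ls < card I"
  shows "\<exists>c. (\<exists>i\<in>I. c i \<noteq> 0) \<and> (\<forall>l\<in>set ls. (\<Sum>i\<in>I. c i * l i) = 0)"
  using assms
proof (induction "length ls" arbitrary: ls I)
  case 0
  then have "I \<noteq> {}" by auto
  then show ?case using 0 by (intro exI[of _ "\<lambda>_. 1"]) auto
next
  case (Suc n)
  then obtain l ms where ls: "ls = l # ms" "n = length ms"
    by (metis length_Suc_conv)
  show ?case
  proof (cases "\<exists>k\<in>I. l k \<noteq> 0")
    case False
    then show ?thesis
      using Suc.hyps(1)[OF ls(2) Suc.prems(1)] Suc.prems(2) ls by auto
  next
    case True
    then obtain k where k: "k \<in> I" "l k \<noteq> 0" by blast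
    define J where "J = I - {k}"
    have J: "finite J" "k \<notin> J" "I = insert k J" using k Suc.prems by (auto simp: J_def)
    have "length (map (\<lambda>m i. m i - m k * l i / l k) ms) < card J"
      using Suc.prems(2) J ls by simp
    from Suc.hyps(1)[OF _ J(1) this] ls obtain c where
      c: "\<exists>i\<in>J. c i \<noteq> 0" "\<forall>m\<in>set ms. (\<Sum>i\<in>J. c i * (m i - m k * l i / l k)) = 0" by auto
    define c' where "c' = c(k := - (\<Sum>i\<in>J. c i * l i) / l k)"
    have sum: "(\<Sum>i\<in>I. c' i * m i) = - (\<Sum>i\<in>J. c i * l i) / l k * m k + (\<Sum>i\<in>J. c i * m i)" for m
    proof -
      have "(\<Sum>i\<in>J. c' i * m i) = (\<Sum>i\<in>J. c i * m i)"
        using J by (intro sum.cong) (auto simp: c'_def)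
      then show ?thesis using J by (simp add: c'_def)
    qed
    have "(\<Sum>i\<in>I. c' i * m i) = 0" if "m \<in> set ms" for m
    proof -
      have "0 = (\<Sum>i\<in>J. c i * m i - (c i * l i) * (m k / l k))"
        using c(2) that by (auto simp: algebra_simps)
      then show ?thesis
        unfolding sum by (simp add: sum_subtractf sum_distrib_right sum_divide_distrib)
    qed
    moreover have "(\<Sum>i\<in>I. c' i * l i) = 0"
      unfolding sum using k by simp
    moreover have "\<exists>i\<in>I. c' i \<noteq> 0"
      using c(1) J by (auto simp: c'_def)
    ultimately show ?thesis
      using ls by auto
  qed
qed

section \<open>Differences of two products of linear forms\<close>

definition lform :: "complex ^ 'n \<Rightarrow> complex ^ 'n \<Rightarrow> complex" where
  "lform u y = (\<Sum>k\<in>UNIV. u $ k * y $ k)"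

lemma lform_add: "lform u (x + y) = lform u x + lform u y"
  by (simp add: lform_def algebra_simps sum.distrib)

lemma lform_scale: "lform u (c *s x) = c * lform u x"
  by (simp add: lform_def algebra_simps sum_distrib_left)

definition lprod :: "(complex ^ 'n) list \<Rightarrow> complex ^ 'n \<Rightarrow> complex" where
  "lprod us y = prod_list (map (\<lambda>u. lform u y) us)"

lemma lprod_scale: "lprod us (c *s y) = c ^ length us * lprod us y"
  by (induction us) (simp_all add: lprod_def lform_scale)

lemma lprod_append: "lprod (us @ ws) y = lprod us y * lprod ws y"
  by (simp add: lprod_def)

text \<open>What a homogeneous binomial of degree \<open>n\<close> becomes under a linear
  substitution. Vanishing on \<open>M\<close> is recorded with the shape because it is the only
  trace left of membership in the ideal.\<close>

definition two_products :: "nat \<Rightarrow> (complex ^ 'n) set \<Rightarrow> (complex ^ 'n \<Rightarrow> complex) \<Rightarrow> bool" where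
  "two_products n M f \<longleftrightarrow> (\<exists>us ws \<alpha> \<beta>. length us = n \<and> length ws = n \<and>
     (\<forall>y. f y = \<alpha> * lprod us y - \<beta> * lprod ws y) \<and> (\<forall>y\<in>M. f y = 0))"

lemma two_products_scale: "two_products n M f \<Longrightarrow> f (c *s y) = c ^ n * f y"
  unfolding two_products_def by (auto simp: lprod_scale right_diff_distrib  mult_ac)

text \<open>If the degrees differ, comparing the values at \<open>y\<close> and \<open>2 y\<close>
  on the cone shows that both products vanish separately on \<open>M\<close>, so a homogeneous ideal
  contains the two terms individually.\<close>

lemma binomial_split:
  assumes cone: "\<And>y t. y \<in> M \<Longrightarrow> 0 < t \<Longrightarrow> complex_of_real t *s y \<in> M"
    and f: "\<And>y. f y = \<alpha> * lprod us y - \<beta> * lprod ws y" and M: "\<And>y. y \<in> M \<Longrightarrow> f y = 0"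
  shows "\<exists>fs. (\<forall>(n, g)\<in>set fs. two_products n M g) \<and> (\<forall>y. f y = (\<Sum>(n, g)\<leftarrow>fs. g y))"
proof (cases "length us = length ws")
  case True
  then have "two_products (length us) M f"
    using f M unfolding two_products_def by metis
  then show ?thesis
    by (intro exI[of _ "[(length us, f)]"]) auto
next
  case False
  have z: "\<alpha> * lprod us y = 0 \<and> \<beta> * lprod ws y = 0" if "y \<in> M" for y
  proof -
    have "\<alpha> * lprod us y - \<beta> * lprod ws y = 0" using M[OF that] f by simp
    moreover have "\<alpha> * lprod us (of_real 2 *s y) - \<beta> * lprod ws (of_real 2 *s y) = 0"
      using M[OF cone[OF that, of 2]] f by simp
    then have "2 ^ length us * (\<alpha> * lprod us y) = 2 ^ length ws * (\<beta> * lprod ws y)"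
      by (simp add: lprod_scale algebra_simps)
    ultimately have "(2 ^ length us - 2 ^ length ws) * (\<alpha> * lprod us y) = 0"
      by (simp add: algebra_simps)
    moreover have "(2::complex) ^ length us \<noteq> 2 ^ length ws"
    proof
      assume "(2::complex) ^ length us = 2 ^ length ws"
      then have "of_nat (2 ^ length us) = (of_nat (2 ^ length ws) :: complex)" by simp
      then have "(2::nat) ^ length us = 2 ^ length ws" using of_nat_eq_iff by blast
      with False show False by simp
    qed
    ultimately have "\<alpha> * lprod us y = 0" by simp
    with M[OF that] f show ?thesis by simp
  qed
  \<comment> \<open>A single product counts as a difference of two; the second product repeats the
    list to match the length and has coefficient 0.\<close>
  have "two_products (length us) M (\<lambda>y. \<alpha> * lprod us y)"
    unfolding two_products_def using z
    by (intro exI[of _ us] exI[of _ us] exI[of _ \<alpha>] exI[of _ 0]) auto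
  moreover have "two_products (length ws) M (\<lambda>y. - (\<beta> * lprod ws y))"
    unfolding two_products_def using z
    by (intro exI[of _ ws] exI[of _ ws] exI[of _ 0] exI[of _ \<beta>]) auto
  ultimately show ?thesis
    by (intro exI[of _ "[(length us, \<lambda>y. \<alpha> * lprod us y), (length ws, \<lambda>y. - (\<beta> * lprod ws y))]"])
       (auto simp: f)
qed

text \<open>Both sides are polynomials in \<open>t\<close>, so the coefficients of
  \<open>t ^ k\<close> agree.\<close>

lemma homogeneous_part:
  fixes cs :: "(nat \<times> complex) list"
  assumes "\<And>t. (\<Sum>(n, c)\<leftarrow>cs. t ^ n * c) = t ^ k * d"
  shows "(\<Sum>(n, c)\<leftarrow>filter (\<lambda>(n, c). n = k) cs. c) = d"
proof -
  define p where "p = (\<Sum>(n, c)\<leftarrow>cs. monom c n)"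
  have "poly p t = poly (monom d k) t" for t
  proof -
    have "poly p t = (\<Sum>(n, c)\<leftarrow>cs. t ^ n * c)"
      unfolding p_def by (induction cs) (auto simp: poly_monom)
    then show ?thesis
      using assms by (simp add: poly_monom)
  qed
  then have "p = monom d k" by (simp add: poly_eq_poly_eq_iff[symmetric] fun_eq_iff)
  moreover have "coeff p k = (\<Sum>(n, c)\<leftarrow>filter (\<lambda>(n, c). n = k) cs. c)"
    unfolding p_def by (induction cs) auto
  ultimately show ?thesis by simp
qed

section \<open>Polarisation of products of three and four linear forms\<close>

definition perm3 :: "('a \<Rightarrow> complex) \<Rightarrow> ('a \<Rightarrow> complex) \<Rightarrow> ('a \<Rightarrow> complex) \<Rightarrow> 'a \<Rightarrow> 'a \<Rightarrow> 'a \<Rightarrow> complex" where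
  "perm3 f g h x y z = f x * (g y * h z + g z * h y) + f y * (g x * h z + g z * h x)
     + f z * (g x * h y + g y * h x)"

text \<open>Like \<open>perm3\<close>, a permanent of a matrix of values, here expanded along the
  argument \<open>w\<close>. Permanents are the full polarisations of products of linear
  forms.\<close>

definition perm4 :: "('a \<Rightarrow> complex) \<Rightarrow> ('a \<Rightarrow> complex) \<Rightarrow> ('a \<Rightarrow> complex) \<Rightarrow> ('a \<Rightarrow> complex)
    \<Rightarrow> 'a \<Rightarrow> 'a \<Rightarrow> 'a \<Rightarrow> 'a \<Rightarrow> complex" where
  "perm4 e f g h w x y z = e w * perm3 f g h x y z + f w * perm3 e g h x y z
     + g w * perm3 e f h x y z + h w * perm3 e f g x y z"

text \<open>Inclusion-exclusion, without division by 3!, so the diagonal value for a cubic form is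
  \<open>6 * f x\<close>. It makes sense for arbitrary functions and is therefore additive over the
  decomposition into summands.\<close>

definition polar3 :: "(complex ^ 'n \<Rightarrow> complex) \<Rightarrow> complex ^ 'n \<Rightarrow> complex ^ 'n \<Rightarrow> complex ^ 'n \<Rightarrow> complex" where
  "polar3 f x y z = f (x + y + z) - f (x + y) - f (x + z) - f (y + z) + f x + f y + f z"

definition polar4 :: "(complex ^ 'n \<Rightarrow> complex) \<Rightarrow> complex ^ 'n \<Rightarrow> complex ^ 'n \<Rightarrow> complex ^ 'n \<Rightarrow> complex ^ 'n \<Rightarrow> complex" where
  "polar4 f w x y z = f (w + x + y + z) - f (w + x + y) - f (w + x + z) - f (w + y + z) - f (x + y + z)
      + f (w + x) + f (w + y) + f (w + z) + f (x + y) + f (x + z) + f (y + z) - f w - f x - f y - f z"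

lemma polar3_two_products:
  assumes "\<And>y. f y = a * lprod [u1, u2, u3] y - b * lprod [w1, w2, w3] y"
  shows "polar3 f x y z =
    a * perm3 (lform u1) (lform u2) (lform u3) x y z - b * perm3 (lform w1) (lform w2) (lform w3) x y z"
  by (simp add: assms polar3_def perm3_def lprod_def lform_add algebra_simps)

lemma polar4_two_products:
  fixes u1 :: "complex ^ 'n"
  assumes "\<And>y. f y = a * lprod [u1, u2, u3, u4] y - b * lprod [w1, w2, w3, w4] y"
  shows "polar4 f w x y z = a * perm4 (lform u1) (lform u2) (lform u3) (lform u4) w x y z
      - b * perm4 (lform w1) (lform w2) (lform w3) (lform w4) w x y z"
proof -
  have *: "polar4 (lprod us) w x y z = perm4 (lform u1) (lform u2) (lform u3) (lform u4) w x y z"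
    if "us = [u1, u2, u3, u4]" for us and u1 u2 u3 u4 :: "complex ^ 'n"
    by (simp add: that polar4_def perm4_def perm3_def lprod_def lform_add) Groebner_Basis.algebra
  have "polar4 f w x y z = a * polar4 (lprod [u1, u2, u3, u4]) w x y z - b * polar4 (lprod [w1, w2, w3, w4]) w x y z"
    unfolding polar4_def assms by (simp only: ring_distribs) simp
  then show ?thesis
    unfolding *[OF refl] .
qed

section \<open>The dimension count for a single summand\<close>

definition four_chain_points where
  "four_chain_points A B C ai bi aj bj ij ii jj =
     chain_points A B C ai bi aj bj ij ii jj \<union> chain_points B A C bi ai bj aj ij ii jj \<union>
     chain_points A B C aj bj ai bi ij jj ii \<union> chain_points B A C bj aj bi ai ij jj ii"

lemma four_chainsI:
  assumes "sym_trilinear F" "\<And>y. y \<in> four_chain_points A B C ai bi aj bj ij ii jj \<Longrightarrow> F y y y = 0"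
  shows "four_chains F A B C ai bi aj bj ij ii jj"
  using assms by (auto simp: four_chains_def four_chains_axioms_def sym_trilinear.chain_zero_def four_chain_points_def)

text \<open>The six linear forms have a common zero \<open>v\<close> in the span of eight coordinates, and \<open>f\<close> is invariant
  under translation by \<open>v\<close>.\<close>

lemma cubic_contradiction:
  assumes "two_products 3 M f" and zero: "\<And>y. y \<in> four_chain_points A B C ai bi aj bj ij ii jj \<Longrightarrow> f y = 0"
  shows "polar3 f A B ij = 0"
proof (rule ccontr)
  assume nz: "polar3 f A B ij \<noteq> 0"
  obtain us ws \<alpha> \<beta> where len: "length us = 3" "length ws = 3"
    and f: "\<And>y. f y = \<alpha> * lprod us y - \<beta> * lprod ws y"
    using assms(1) unfolding two_products_def by metis
  from len obtain u1 u2 u3 w1 w2 w3 where us: "us = [u1, u2, u3]" "ws = [w1, w2, w3]"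
    by (auto simp: numeral_3_eq_3 length_Suc_conv)
  note P = polar3_two_products[OF f[unfolded us]]
  interpret sym_trilinear "polar3 f"
    by unfold_locales (simp_all add: P perm3_def lform_add lform_scale algebra_simps)
  interpret four_chains "polar3 f" A B C ai bi aj bj ij ii jj
  proof (rule four_chainsI)
    show "polar3 f y y y = 0" if "y \<in> four_chain_points A B C ai bi aj bj ij ii jj" for y
      using zero[OF that] by (simp add: P perm3_def f us lprod_def)
  qed unfold_locales
  define e where "e = (!) [ij, A, B, C, ai, bi, aj, bj]"
  obtain c where c: "\<exists>i\<in>{..<8}. c i \<noteq> 0" "\<forall>l\<in>set (map (\<lambda>u i. lform u (e i)) (us @ ws)). (\<Sum>i<8. c i * l i) = 0"
    using homogeneous_system_nontrivial[of "{..<8::nat}" "map (\<lambda>u i. lform u (e i)) (us @ ws)"] us by auto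
  \<comment> \<open>The final summand fills the slot that \<open>kernel_trivial\<close> reserves for
    \<open>cc\<close>, here with the zero vector.\<close>
  define v where "v = c 0 *s ij + c 1 *s A + c 2 *s B + c 3 *s C + c 4 *s ai + c 5 *s bi + c 6 *s aj + c 7 *s bj + 0 *s 0"
  have "lform u v = (\<Sum>i<8. c i * lform u (e i))" for u
    by (simp add: v_def lform_add lform_scale e_def eval_nat_numeral)
  then have "lform u v = 0" if "u \<in> set (us @ ws)" for u
    using c(2) that by auto
  then have "polar3 f v x y = 0" for x y
    by (simp add: P perm3_def us)
  note k = kernel_trivial[OF v_def this nz, unfolded zero_left]
  have "c i = 0" if "i < 8" for i
  proof -
    from that have "i \<in> {0, 1, 2, 3, 4, 5, 6, 7}" by auto
    then show ?thesis using k by auto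
  qed
  with c(1) show False by auto
qed

text \<open>Eight linear forms have a common zero in the span of nine vectors. Fixing one argument
  at \<open>cc\<close> reduces the quartic to the trilinear case; \<open>k\<close> and
  \<open>l\<close> select the coordinates dual to \<open>A\<close> and \<open>B\<close>.\<close>

lemma quartic_contradiction:
  fixes A :: "complex ^ 'n"
  assumes "two_products 4 M f"
    and zero: "\<And>y s. y \<in> four_chain_points A B C ai bi aj bj ij ii jj \<Longrightarrow> 0 < s \<Longrightarrow> s < 1 \<Longrightarrow> f (y + of_real s *s cc) = 0"
    and A: "A $ k = 1" "B $ k = 0" "C $ k = 0" "ai $ k = 0" "bi $ k = 0" "aj $ k = 0" "bj $ k = 0"
    and B: "A $ l = 0" "B $ l = 1" "C $ l = 0" "ai $ l = 0" "bi $ l = 0" "aj $ l = 0" "bj $ l = 0"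
  shows "polar4 f cc A B ij = 0"
proof (rule ccontr)
  assume nz: "polar4 f cc A B ij \<noteq> 0"
  obtain us ws \<alpha> \<beta> where len: "length us = 4" "length ws = 4"
    and f: "\<And>y. f y = \<alpha> * lprod us y - \<beta> * lprod ws y"
    using assms(1) unfolding two_products_def by metis
  from len obtain u1 u2 u3 u4 w1 w2 w3 w4 where us: "us = [u1, u2, u3, u4]" "ws = [w1, w2, w3, w4]"
    by (auto simp: eval_nat_numeral length_Suc_conv)
  note P = polar4_two_products[OF f[unfolded us]]
  have swap: "polar4 f w x y z = polar4 f x w y z" "polar4 f w x y z = polar4 f w y x z"
    "polar4 f w x y z = polar4 f w x z y" for w x y z
    by (simp_all add: polar4_def add_ac)
  have lin: "polar4 f (w + w') x y z = polar4 f w x y z + polar4 f w' x y z"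
    "polar4 f (c *s w) x y z = c * polar4 f w x y z" for w w' x y z c
    by (simp_all add: P perm4_def perm3_def lform_add lform_scale algebra_simps)
  interpret sym_trilinear "polar4 f w" for w
    by unfold_locales (use swap lin in metis)+
  have zero2: "polar4 f cc y y y = 0" "polar4 f cc cc y y = 0"
    if y: "y \<in> four_chain_points A B C ai bi aj bj ij ii jj" for y
  proof -
    \<comment> \<open>The expansion of \<open>24 * f (y + d cc)\<close> in powers of
      \<open>d\<close>, with binomial coefficients 1, 4, 6, 4, 1; the factor 24 turns values of
      \<open>f\<close> into diagonal values of \<open>polar4 f\<close>.\<close>
    define p where "p = [:24 * f y, 4 * polar4 f cc y y y, 6 * polar4 f cc cc y y, 4 * polar4 f cc cc cc y, 24 * f cc:]"
    have "p = 0"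
    proof (rule poly_eq_0_if_zero_on_interval)
      fix d :: real assume d: "0 < d" "d < 1"
      have "poly p (of_real d) = 24 * f (y + of_real d *s cc)"
        unfolding p_def P unfolding f us
        by (simp add: perm4_def perm3_def lprod_def lform_add lform_scale) Groebner_Basis.algebra
      with zero[OF y d] show "poly p (of_real d) = 0" by simp
    qed
    then show "polar4 f cc y y y = 0" "polar4 f cc cc y y = 0"
      by (simp_all add: p_def)
  qed
  interpret four_chains "polar4 f cc" A B C ai bi aj bj ij ii jj
    by (rule four_chainsI) (unfold_locales, rule zero2)
  define H where "H = polar4 f cc cc"
  have H: "H (x + x') y = H x y + H x' y" "H (c *s x) y = c * H x y" "H x y = H y x" for x x' y c
    unfolding H_def using swap lin by metis+
  \<comment> \<open>The bilinear form \<open>H\<close> is only known to vanish on the diagonal at the chain points; multiplying it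
    by a coordinate turns it into a trilinear form to which the previous results apply.\<close>
  define G where "G m x y z = x $ m * H y z + y $ m * H x z + z $ m * H x y" for m x y z
  have "sym_trilinear (G m)" for m
    by unfold_locales (simp_all add: G_def H(1,2) H(3)[of _ "_ + _"] algebra_simps, (metis H(3))+)
  then have G: "four_chains (G m) A B C ai bi aj bj ij ii jj" for m
    by (rule four_chainsI) (simp add: G_def H_def zero2)
  interpret GA: four_chains "G k" A B C ai bi aj bj ij ii jj by (rule G)
  interpret GB: four_chains "G l" A B C ai bi aj bj ij ii jj by (rule G)
  interpret GA': four_chains "G k" A B C aj bj ai bi ij jj ii by (rule GA.swap_ij)
  \<comment> \<open>The pair \<open>bi, bj\<close> is read off at coordinate \<open>l\<close>: at
    \<open>k\<close> the value \<open>G k A bi bj\<close> is only known to be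
    \<open>- G k A B ij\<close>, whereas \<open>G l B bi bj\<close> is zero.\<close>
  have H0: "H ai aj = 0" "H ai bj = 0" "H bi bj = 0"
    using GA.F_i_j(1,7) GB.F_i_j(11) by (simp_all add: G_def A B)
  have Xk: "X 5 5 $ k = 5"
    by (simp add: X_def A)
  have X_eq: "X 5 5 = 5 *s A + 5 *s B + C"
    by (simp add: X_def)
  have HX: "H (X 5 5) z = 0" if "z \<in> {ai, bi, aj, bj}" for z
  proof -
    have zk: "z $ k = 0" using that A by auto
    have "G k (X 5 5) A z = 0" "G k (X 5 5) B z = 0" "G k (X 5 5) C z = 0"
      using GA.X_span_i[of 5 5 z] GA'.X_span_i[of 5 5 z] that by auto
    then have "5 * H A z + H (X 5 5) z = 0" "H B z = 0" "H C z = 0"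
      by (simp_all add: G_def Xk zk A)
    then show ?thesis
      unfolding X_eq H(1,2) by simp
  qed
  have HXX: "H (X 5 5) (X 5 5) = 0"
    using GA.cube_X[of 5 5] by (simp add: G_def Xk)
  define e where "e = (!) [ij, A, B, C, ai, bi, aj, bj, cc]"
  obtain c where c: "\<exists>i\<in>{..<9}. c i \<noteq> 0" "\<forall>l\<in>set (map (\<lambda>u i. lform u (e i)) (us @ ws)). (\<Sum>i<9. c i * l i) = 0"
    using homogeneous_system_nontrivial[of "{..<9::nat}" "map (\<lambda>u i. lform u (e i)) (us @ ws)"] us by auto
  define v where "v = c 0 *s ij + c 1 *s A + c 2 *s B + c 3 *s C + c 4 *s ai + c 5 *s bi + c 6 *s aj + c 7 *s bj + c 8 *s cc"
  have "lform u v = (\<Sum>i<9. c i * lform u (e i))" for u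
    by (simp add: v_def lform_add lform_scale e_def eval_nat_numeral)
  then have "lform u v = 0" if "u \<in> set (us @ ws)" for u
    using c(2) that by auto
  then have v0: "polar4 f w v x y = 0" for w x y
    by (simp add: P perm4_def perm3_def us)
  have k: "c 0 = 0" "c 1 = 0" "c 2 = 0" "c 3 = 0" "c 4 = 0" "c 5 = 0" "c 6 = 0" "c 7 = 0"
    using kernel_trivial[OF v_def v0 nz, folded H_def] HXX HX H0 by blast+
  have "v = c 8 *s cc"
    unfolding v_def by (simp add: k k(2)[unfolded One_nat_def])
  \<comment> \<open>Only \<open>cc\<close> is left in \<open>v\<close>, and pairing it with
    \<open>A\<close>, \<open>B\<close>, \<open>ij\<close> gives \<open>c 8\<close> times the value
    assumed nonzero.\<close>
  then have "c 8 = 0"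
    using v0[of A B ij] swap(1)[of A v] lin(2)[of "c 8" cc A B ij] nz by simp
  have "c i = 0" if "i < 9" for i
  proof -
    from that have "i \<in> {0, 1, 2, 3, 4, 5, 6, 7, 8}" by auto
    then show ?thesis using k \<open>c 8 = 0\<close> by auto
  qed
  with c(1) show False by auto
qed

text \<open>The point \<open>y\<close> need not lie in \<open>M\<close>; it is the limit of a curve
  in \<open>M\<close>, and the constant coefficient along the curve is a multiple of
  \<open>g y\<close>. In the 5-cycle the curve scales the vertex \<open>c\<close> down to
  zero.\<close>

lemma two_products_cubic_limit:
  assumes g: "two_products 3 M g" and M: "\<And>d. 0 < d \<Longrightarrow> d < 1 \<Longrightarrow> y + of_real d *s p + (of_real d)\<^sup>2 *s r \<in> M"
  shows "g y = 0"
proof -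
  obtain us ws \<alpha> \<beta> where len: "length us = 3" "length ws = 3"
    and g_eq: "\<And>y. g y = \<alpha> * lprod us y - \<beta> * lprod ws y" and zero: "\<And>y. y \<in> M \<Longrightarrow> g y = 0"
    using g unfolding two_products_def by metis
  from len obtain u1 u2 u3 w1 w2 w3 where us: "us = [u1, u2, u3]" "ws = [w1, w2, w3]"
    by (auto simp: numeral_3_eq_3 length_Suc_conv)
  note P = polar3_two_products[OF g_eq[unfolded us]]
  interpret sym_trilinear "polar3 g"
    by unfold_locales (simp_all add: P perm3_def lform_add lform_scale algebra_simps)
  have diag: "polar3 g x x x = 6 * g x" for x
    by (simp add: P perm3_def g_eq us lprod_def)
  show ?thesis
    using quadratic_curve(1)[of y p r] M zero by (simp add: diag Let_def)
qed

lemma polar3_sum_list: "polar3 (\<lambda>y. \<Sum>g\<leftarrow>gs. g y) x y z = (\<Sum>g\<leftarrow>gs. polar3 g x y z)"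
  by (simp add: polar3_def sum_list_addf sum_list_subtractf)

lemma polar4_sum_list: "polar4 (\<lambda>y. \<Sum>g\<leftarrow>gs. g y) w x y z = (\<Sum>g\<leftarrow>gs. polar4 g w x y z)"
  by (simp add: polar4_def sum_list_addf sum_list_subtractf)

section \<open>Gaussian models and separation\<close>

lemma
  fixes A :: "'a::semiring_1 ^ 'n ^ 'm"
  assumes "invertible A"
  shows matrix_inv_right: "A ** matrix_inv A = mat 1"
    and matrix_inv_left: "matrix_inv A ** A = mat 1"
  using someI_ex[OF assms[unfolded invertible_def]] by (simp_all add: matrix_inv_def)

lemma matrix_inv_unique:
  fixes A :: "'a::semiring_1 ^ 'n ^ 'm"
  assumes "A ** B = mat 1" "B ** A = mat 1"
  shows "matrix_inv A = B"
proof -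
  have "invertible A" using assms by (auto simp: invertible_def)
  then have "matrix_inv A = matrix_inv A ** (A ** B)" using assms by simp
  also have "\<dots> = B"
    using matrix_inv_left[OF \<open>invertible A\<close>] by (simp add: matrix_mul_assoc)
  finally show ?thesis .
qed

lemma sym_pos_def_sym: "sym_pos_def A \<Longrightarrow> A $ i $ j = A $ j $ i"
  unfolding sym_pos_def_def by (metis transpose_def vec_lambda_beta)

lemma sym_pos_def_kernel: "sym_pos_def A \<Longrightarrow> x \<bullet> (A *v x) = 0 \<Longrightarrow> x = 0"
  unfolding sym_pos_def_def by force

lemma sym_pos_def_diag: "sym_pos_def A \<Longrightarrow> 0 < A $ i $ i"
proof -
  assume A: "sym_pos_def A"
  have "axis i 1 \<noteq> (0 :: real ^ 'a)" by (simp add: axis_eq_0_iff)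
  with A have "0 < axis i 1 \<bullet> (A *v axis i 1)" by (simp add: sym_pos_def_def)
  also have "axis i 1 \<bullet> (A *v axis i 1) = A $ i $ i"
    by (simp add: matrix_vector_mul_component inner_axis inner_axis' inner_commute)
  finally show ?thesis .
qed

lemma sym_pos_def_invertible: "sym_pos_def (A :: real ^ 'n ^ 'n) \<Longrightarrow> invertible A"
  unfolding invertible_left_inverse matrix_left_invertible_ker
  using sym_pos_def_kernel[of A] by (metis inner_zero_right)

lemma sym_pos_def_inv:
  assumes "sym_pos_def (A :: real ^ 'n ^ 'n)"
  shows "sym_pos_def (matrix_inv A)"
  unfolding sym_pos_def_def
proof (intro conjI allI impI)
  have inv: "invertible A" by (rule sym_pos_def_invertible[OF assms])
  have tA: "transpose A = A" using assms by (simp add: sym_pos_def_def)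
  show t: "transpose (matrix_inv A) = matrix_inv A"
  proof -
    have "transpose (matrix_inv A) ** A = mat 1"
      using matrix_transpose_mul[of A "matrix_inv A"] matrix_inv_right[OF inv] tA by (simp add: transpose_mat)
    then have "transpose (matrix_inv A) ** A ** matrix_inv A = matrix_inv A"
      by simp
    then show ?thesis
      using matrix_inv_right[OF inv] by (simp add: matrix_mul_assoc[symmetric])
  qed
  fix x :: "real ^ 'n" assume "x \<noteq> 0"
  have x: "A *v (matrix_inv A *v x) = x"
    using matrix_inv_right[OF inv] by (simp add: matrix_vector_mul_assoc)
  then have "matrix_inv A *v x \<noteq> 0" using \<open>x \<noteq> 0\<close> by auto
  then have "0 < (matrix_inv A *v x) \<bullet> (A *v (matrix_inv A *v x))"
    using assms by (auto simp: sym_pos_def_def)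
  then show "0 < x \<bullet> (matrix_inv A *v x)"
    unfolding x by (simp add: inner_commute)
qed

lemma matrix_inv_matrix_inv:
  assumes "invertible (A :: real ^ 'n ^ 'n)"
  shows "matrix_inv (matrix_inv A) = A"
  using matrix_inv_unique matrix_inv_left[OF assms] matrix_inv_right[OF assms] by blast

lemma inverse_sum:
  fixes A :: "real ^ 'n ^ 'n"
  assumes "A ** K = mat 1"
  shows "(\<Sum>w\<in>UNIV. A $ v $ w * K $ w $ i) = (if v = i then 1 else 0)"
proof -
  have "(\<Sum>w\<in>UNIV. A $ v $ w * K $ w $ i) = (A ** K) $ v $ i"
    by (simp add: matrix_matrix_mult_def)
  then show ?thesis using assms by (simp add: mat_def)
qed

section \<open>Separation in the graph and relations between covariances\<close>

definition separated :: "'n set set \<Rightarrow> 'n set \<Rightarrow> 'n set \<Rightarrow> bool" where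
  "separated E S T \<longleftrightarrow> (\<forall>u\<in>S. \<forall>v\<in>T. {u, v} \<notin> E)"

text \<open>Nonsingularity of the principal submatrix on \<open>S\<close>, expressed without forming
  it: every summand of the quadratic form at \<open>x\<close> vanishes.\<close>

lemma inner_matrix_zero_on_support:
  fixes A :: "real ^ 'n ^ 'n"
  assumes "sym_pos_def A" "\<And>v. v \<notin> S \<Longrightarrow> x $ v = 0" "\<And>v. v \<in> S \<Longrightarrow> (\<Sum>w\<in>UNIV. A $ v $ w * x $ w) = 0"
  shows "x = 0"
proof (rule sym_pos_def_kernel[OF assms(1)])
  have "x $ v * (A *v x) $ v = 0" for v
    using assms(2,3) by (cases "v \<in> S") (auto simp: matrix_vector_mult_def)
  then show "x \<bullet> (A *v x) = 0"
    unfolding inner_vec_def by (intro sum.neutral) auto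
qed

text \<open>Conditional independence given \<open>k\<close>: up to the factor
  \<open>A $ k $ k\<close>, \<open>x\<close> is the conditional covariance of \<open>S\<close> with
  \<open>v\<close>. Rows of \<open>K\<close> in \<open>S\<close> are supported on
  \<open>insert k S\<close> and annihilate it, so the principal block of \<open>K\<close> on
  \<open>S\<close> forces it to be zero.\<close>

lemma gaussian_model_separated:
  fixes A :: "real ^ 'n ^ 'n"
  assumes A: "A \<in> gaussian_model E" and sep: "separated E S (- insert k S)" and k: "k \<notin> S"
    and "w \<in> S" "v \<notin> S" "v \<noteq> k"
  shows "A $ v $ w * A $ k $ k = A $ v $ k * A $ k $ w"
proof -
  define K where "K = matrix_inv A"
  have pd: "sym_pos_def A" and K0: "\<And>i j. i \<noteq> j \<Longrightarrow> {i, j} \<notin> E \<Longrightarrow> K $ i $ j = 0"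
    using A by (auto simp: gaussian_model_def K_def)
  have KA: "K ** A = mat 1"
    unfolding K_def by (rule matrix_inv_left[OF sym_pos_def_invertible[OF pd]])
  define x :: "real ^ 'n" where
    "x = (\<chi> w. if w \<in> S then A $ w $ v * A $ k $ k - A $ w $ k * A $ k $ v else 0)"
  have "x = 0"
  proof (rule inner_matrix_zero_on_support[of K S])
    show "sym_pos_def K" unfolding K_def by (rule sym_pos_def_inv[OF pd])
    show "x $ u = 0" if "u \<notin> S" for u using that by (simp add: x_def)
    fix u assume u: "u \<in> S"
    have "(\<Sum>w\<in>UNIV. K $ u $ w * x $ w) = (\<Sum>w\<in>UNIV. K $ u $ w * (A $ w $ v * A $ k $ k - A $ w $ k * A $ k $ v))"
    proof (rule sum.cong[OF refl])
      fix w
      show "K $ u $ w * x $ w = K $ u $ w * (A $ w $ v * A $ k $ k - A $ w $ k * A $ k $ v)"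
      proof (cases "w \<in> insert k S")
        case True
        then show ?thesis using k by (auto simp: x_def)
      next
        case False
        then have "K $ u $ w = 0"
          using K0[of u w] sep u by (auto simp: separated_def)
        then show ?thesis by simp
      qed
    qed
    also have "\<dots> = (\<Sum>w\<in>UNIV. K $ u $ w * A $ w $ v) * A $ k $ k - (\<Sum>w\<in>UNIV. K $ u $ w * A $ w $ k) * A $ k $ v"
      by (simp add: sum_subtractf sum_distrib_right right_diff_distrib mult.assoc)
    also have "\<dots> = 0"
      using u k \<open>v \<notin> S\<close> by (auto simp: inverse_sum[OF KA])
    finally show "(\<Sum>w\<in>UNIV. K $ u $ w * x $ w) = 0" .
  qed
  then have "x $ w = 0" by simp
  then show ?thesis
    using \<open>w \<in> S\<close> sym_pos_def_sym[OF pd, of w v] sym_pos_def_sym[OF pd, of w k] sym_pos_def_sym[OF pd, of k v]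
    by (simp add: x_def mult.commute)
qed

lemma gaussian_model_disconnected:
  fixes A :: "real ^ 'n ^ 'n"
  assumes A: "A \<in> gaussian_model E" and sep: "separated E S (- S)" and "w \<in> S" "v \<notin> S"
  shows "A $ v $ w = 0"
proof -
  define K where "K = matrix_inv A"
  have pd: "sym_pos_def A" and K0: "\<And>i j. i \<noteq> j \<Longrightarrow> {i, j} \<notin> E \<Longrightarrow> K $ i $ j = 0"
    using A by (auto simp: gaussian_model_def K_def)
  have KA: "K ** A = mat 1"
    unfolding K_def by (rule matrix_inv_left[OF sym_pos_def_invertible[OF pd]])
  define x :: "real ^ 'n" where "x = (\<chi> w. if w \<in> S then A $ w $ v else 0)"
  have "x = 0"
  proof (rule inner_matrix_zero_on_support[of K S])
    show "sym_pos_def K" unfolding K_def by (rule sym_pos_def_inv[OF pd])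
    show "x $ u = 0" if "u \<notin> S" for u using that by (simp add: x_def)
    fix u assume u: "u \<in> S"
    have "(\<Sum>w\<in>UNIV. K $ u $ w * x $ w) = (\<Sum>w\<in>UNIV. K $ u $ w * A $ w $ v)"
    proof (rule sum.cong[OF refl])
      fix w
      show "K $ u $ w * x $ w = K $ u $ w * A $ w $ v"
        using K0[of u w] sep u by (cases "w \<in> S") (auto simp: x_def separated_def)
    qed
    also have "\<dots> = 0"
      using u \<open>v \<notin> S\<close> by (auto simp: inverse_sum[OF KA])
    finally show "(\<Sum>w\<in>UNIV. K $ u $ w * x $ w) = 0" .
  qed
  then have "x $ w = 0" by simp
  then show ?thesis
    using \<open>w \<in> S\<close> sym_pos_def_sym[OF pd, of w v] by (simp add: x_def)
qed

text \<open>A column \<open>y\<close> of the inverse, restricted to the side of \<open>S\<close> not containing its index and corrected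
  at the cut vertex \<open>k\<close>, is isotropic for the positive definite form \<open>A\<close>, hence zero.\<close>

lemma gaussian_modelI:
  fixes A :: "real ^ 'n ^ 'n"
  assumes pd: "sym_pos_def A"
    and sep: "\<And>i j. i \<noteq> j \<Longrightarrow> {i, j} \<notin> E \<Longrightarrow> \<exists>S. (i \<in> S \<and> j \<notin> S \<or> j \<in> S \<and> i \<notin> S) \<and>
      ((\<forall>w\<in>S. \<forall>v\<in>-S. A $ v $ w = 0) \<or>
       (\<exists>k. k \<notin> S \<and> k \<noteq> i \<and> k \<noteq> j \<and> (\<forall>w\<in>S. \<forall>v\<in>- insert k S. A $ v $ w * A $ k $ k = A $ v $ k * A $ k $ w)))"
  shows "A \<in> gaussian_model E"
proof -
  define K where "K = matrix_inv A"
  have AK: "A ** K = mat 1"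
    unfolding K_def by (rule matrix_inv_right[OF sym_pos_def_invertible[OF pd]])
  have Ksym: "K $ i $ j = K $ j $ i" for i j
    unfolding K_def by (rule sym_pos_def_sym[OF sym_pos_def_inv[OF pd]])
  have *: "K $ i $ j = 0" if S: "i \<in> S" "j \<notin> S" and
      d: "(\<forall>w\<in>S. \<forall>v\<in>-S. A $ v $ w = 0) \<or>
       (\<exists>k. k \<notin> S \<and> k \<noteq> i \<and> k \<noteq> j \<and> (\<forall>w\<in>S. \<forall>v\<in>- insert k S. A $ v $ w * A $ k $ k = A $ v $ k * A $ k $ w))"
    for i j S
  proof -
    define y where "y w = K $ w $ i" for w
    have row: "(\<Sum>w\<in>UNIV. A $ v $ w * y w) = (if v = i then 1 else 0)" for v
      unfolding y_def by (rule inverse_sum[OF AK])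
    have "y j = 0"
      using d
    proof
      assume z: "\<forall>w\<in>S. \<forall>v\<in>-S. A $ v $ w = 0"
      define x :: "real ^ 'n" where "x = (\<chi> w. if w \<in> S then 0 else y w)"
      have "x = 0"
      proof (rule inner_matrix_zero_on_support[OF pd, of "-S"])
        show "x $ v = 0" if "v \<notin> - S" for v using that by (simp add: x_def)
        fix v assume v: "v \<in> - S"
        have "(\<Sum>w\<in>UNIV. A $ v $ w * x $ w) = (\<Sum>w\<in>UNIV. A $ v $ w * y w)"
          using z v by (intro sum.cong) (auto simp: x_def)
        with v S show "(\<Sum>w\<in>UNIV. A $ v $ w * x $ w) = 0" by (auto simp: row)
      qed
      then have "x $ j = 0" by simp
      with S show ?thesis by (simp add: x_def)
    next
      assume "\<exists>k. k \<notin> S \<and> k \<noteq> i \<and> k \<noteq> j \<and> (\<forall>w\<in>S. \<forall>v\<in>- insert k S. A $ v $ w * A $ k $ k = A $ v $ k * A $ k $ w)"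
      then obtain k where k: "k \<notin> S" "k \<noteq> j"
        and z: "\<And>w v. w \<in> S \<Longrightarrow> v \<notin> S \<Longrightarrow> v \<noteq> k \<Longrightarrow> A $ v $ w * A $ k $ k = A $ v $ k * A $ k $ w" by auto
      have kk: "A $ k $ k \<noteq> 0" using sym_pos_def_diag[OF pd, of k] by simp
      define B where "B = - insert k S"
      have split: "(\<Sum>w\<in>UNIV. f w) = f k + sum f S + sum f B" for f :: "'n \<Rightarrow> real"
      proof -
        have U: "insert k (S \<union> B) = UNIV" by (auto simp: B_def)
        have "sum f (insert k (S \<union> B)) = f k + (sum f S + sum f B)"
          using k by (subst sum.insert) (auto simp: B_def intro!: sum.union_disjoint)
        then show ?thesis unfolding U by (simp add: add.assoc)
      qed
      \<comment> \<open>This \<open>m\<close> makes row \<open>k\<close> of \<open>A *v x\<close>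
        vanish. For the other rows outside \<open>S\<close>, subtracting the multiple
        \<open>A $ v $ k / A $ k $ k\<close> of row \<open>k\<close> cancels the contribution of
        \<open>S\<close>.\<close>
      define m where "m = (\<Sum>w\<in>B. A $ k $ w * y w) / A $ k $ k"
      define x :: "real ^ 'n" where "x = (\<chi> w. if w = k then - m else if w \<in> S then 0 else y w)"
      have sx: "(\<Sum>w\<in>UNIV. A $ v $ w * x $ w) = - A $ v $ k * m + (\<Sum>w\<in>B. A $ v $ w * y w)" for v
      proof -
        have "(\<Sum>w\<in>S. A $ v $ w * x $ w) = 0"
          using k by (intro sum.neutral) (auto simp: x_def)
        moreover have "(\<Sum>w\<in>B. A $ v $ w * x $ w) = (\<Sum>w\<in>B. A $ v $ w * y w)"
          by (intro sum.cong) (auto simp: x_def B_def)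
        ultimately show ?thesis unfolding split[of "\<lambda>w. A $ v $ w * x $ w"] by (simp add: x_def)
      qed
      have rk: "A $ k $ k * y k + (\<Sum>w\<in>S. A $ k $ w * y w) + (\<Sum>w\<in>B. A $ k $ w * y w) = 0"
        using row[of k] S k unfolding split[of "\<lambda>w. A $ k $ w * y w"] by auto
      have "x = 0"
      proof (rule inner_matrix_zero_on_support[OF pd, of "-S"])
        show "x $ v = 0" if "v \<notin> - S" for v using that k by (auto simp: x_def)
        fix v assume v: "v \<in> - S"
        show "(\<Sum>w\<in>UNIV. A $ v $ w * x $ w) = 0"
        proof (cases "v = k")
          case True
          then show ?thesis unfolding sx m_def using kk by simp
        next
          case False
          have alg: "kk * s1 = vk * s2 \<Longrightarrow> vk * yk + s1 + b1 = 0 \<Longrightarrow> kk * yk + s2 + b2 = 0 \<Longrightarrow> kk * b1 = vk * b2"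
            for kk vk yk s1 s2 b1 b2 :: real
          proof -
            assume "kk * s1 = vk * s2" "vk * yk + s1 + b1 = 0" "kk * yk + s2 + b2 = 0"
            then have b: "kk * s1 = vk * s2" "b1 = - (vk * yk) - s1" "b2 = - (kk * yk) - s2" by linarith+
            have "kk * b1 = - (kk * vk * yk) - kk * s1" unfolding b(2) by (simp add: algebra_simps)
            also have "\<dots> = vk * b2" unfolding b(1,3) by (simp add: algebra_simps)
            finally show ?thesis .
          qed
          have "A $ k $ k * (\<Sum>w\<in>S. A $ v $ w * y w) = A $ v $ k * (\<Sum>w\<in>S. A $ k $ w * y w)"
            unfolding sum_distrib_left
          proof (rule sum.cong[OF refl])
            fix w assume "w \<in> S"
            then have "A $ v $ w * A $ k $ k * y w = A $ v $ k * A $ k $ w * y w" using z[of w v] v False by simp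
            then show "A $ k $ k * (A $ v $ w * y w) = A $ v $ k * (A $ k $ w * y w)" by (simp only: mult_ac)
          qed
          moreover have "A $ v $ k * y k + (\<Sum>w\<in>S. A $ v $ w * y w) + (\<Sum>w\<in>B. A $ v $ w * y w) = 0"
            using row[of v] S v unfolding split[of "\<lambda>w. A $ v $ w * y w"] by auto
          ultimately have "A $ k $ k * (\<Sum>w\<in>B. A $ v $ w * y w) = A $ v $ k * (\<Sum>w\<in>B. A $ k $ w * y w)"
            using rk by (rule alg)
          then show ?thesis unfolding sx m_def using kk by (simp add: field_simps)
        qed
      qed
      then have "x $ j = 0" by simp
      with S k show ?thesis by (simp add: x_def)
    qed
    then show ?thesis using Ksym[of i j] by (simp add: y_def)
  qed
  have "K $ i $ j = 0" if ij: "i \<noteq> j" "{i, j} \<notin> E" for i j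
    using sep[OF ij] *[of i _ j] *[of j _ i] Ksym[of i j] by metis
  with pd show ?thesis by (auto simp: gaussian_model_def K_def)
qed

lemma gaussian_model_scale:
  fixes A :: "real ^ 'n ^ 'n"
  assumes A: "A \<in> gaussian_model E" and d: "\<And>i. 0 < d i"
  shows "(\<chi> i j. d i * d j * A $ i $ j) \<in> gaussian_model E"
proof -
  define B :: "real ^ 'n ^ 'n" where "B = (\<chi> i j. d i * d j * A $ i $ j)"
  define K :: "real ^ 'n ^ 'n" where "K = (\<chi> i j. matrix_inv A $ i $ j / (d i * d j))"
  have pd: "sym_pos_def A" using A by (simp add: gaussian_model_def)
  have inv: "invertible A" by (rule sym_pos_def_invertible[OF pd])
  have d0: "d i \<noteq> 0" for i using d[of i] by simp
  have "sym_pos_def B"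
    unfolding sym_pos_def_def
  proof (intro conjI allI impI)
    show "transpose B = B"
      using sym_pos_def_sym[OF pd] by (simp add: B_def transpose_def vec_eq_iff mult.commute)
    fix x :: "real ^ 'n" assume "x \<noteq> 0"
    define y :: "real ^ 'n" where "y = (\<chi> i. d i * x $ i)"
    have "y \<noteq> 0" using \<open>x \<noteq> 0\<close> d0 by (auto simp: y_def vec_eq_iff)
    then have "0 < y \<bullet> (A *v y)" using pd by (simp add: sym_pos_def_def)
    also have "y \<bullet> (A *v y) = x \<bullet> (B *v x)"
      by (simp add: inner_vec_def matrix_vector_mult_def y_def B_def sum_distrib_left mult_ac)
    finally show "0 < x \<bullet> (B *v x)" .
  qed
  moreover have "matrix_inv B = K"
  proof (rule matrix_inv_unique)
    show "B ** K = mat 1"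
      using inverse_sum[OF matrix_inv_right[OF inv]] d0
      by (simp add: matrix_matrix_mult_def B_def K_def mat_def vec_eq_iff sum_distrib_left[symmetric] sum_divide_distrib[symmetric] mult.assoc)
    show "K ** B = mat 1"
      using inverse_sum[OF matrix_inv_left[OF inv]] d0
      by (simp add: matrix_matrix_mult_def B_def K_def mat_def vec_eq_iff sum_distrib_left[symmetric] sum_divide_distrib[symmetric] mult_ac)
  qed
  ultimately show ?thesis
    using A unfolding B_def[symmetric] by (auto simp: gaussian_model_def K_def)
qed

text \<open>Each vertex is regressed on its predecessor: \<open>l1\<close>, ..., \<open>l4\<close>
  are the regression coefficients, \<open>t2\<close>, ..., \<open>t5\<close> the residual variances,
  and completing squares gives positive definiteness. A consecutive pair needs an edge only if its
  covariance is nonzero, so the chain may break at a zero link.\<close>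

lemma markov_chain_in_gaussian_model:
  fixes A :: "real ^ 'n ^ 'n"
  assumes U: "UNIV = {v1, v2, v3, v4, v5}" and dist: "distinct [v1, v2, v3, v4, v5]"
    and sym: "\<And>x y. A $ x $ y = A $ y $ x"
    and pos: "0 < A $ v1 $ v1" "(A $ v1 $ v2)\<^sup>2 < A $ v1 $ v1 * A $ v2 $ v2" "(A $ v2 $ v3)\<^sup>2 < A $ v2 $ v2 * A $ v3 $ v3"
      "(A $ v3 $ v4)\<^sup>2 < A $ v3 $ v3 * A $ v4 $ v4" "(A $ v4 $ v5)\<^sup>2 < A $ v4 $ v4 * A $ v5 $ v5"
    and markov: "A $ v1 $ v3 * A $ v2 $ v2 = A $ v1 $ v2 * A $ v2 $ v3"
      "A $ v1 $ v4 * A $ v3 $ v3 = A $ v1 $ v3 * A $ v3 $ v4" "A $ v2 $ v4 * A $ v3 $ v3 = A $ v2 $ v3 * A $ v3 $ v4"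
      "A $ v1 $ v5 * A $ v4 $ v4 = A $ v1 $ v4 * A $ v4 $ v5" "A $ v2 $ v5 * A $ v4 $ v4 = A $ v2 $ v4 * A $ v4 $ v5"
      "A $ v3 $ v5 * A $ v4 $ v4 = A $ v3 $ v4 * A $ v4 $ v5"
    and edges: "A $ v1 $ v2 \<noteq> 0 \<Longrightarrow> {v1, v2} \<in> E" "A $ v2 $ v3 \<noteq> 0 \<Longrightarrow> {v2, v3} \<in> E"
      "A $ v3 $ v4 \<noteq> 0 \<Longrightarrow> {v3, v4} \<in> E" "A $ v4 $ v5 \<noteq> 0 \<Longrightarrow> {v4, v5} \<in> E"
  shows "A \<in> gaussian_model E"
proof -
  have next_pos: "0 < b" if "0 < a" "c\<^sup>2 < a * b" for a b c :: real
    using that by (meson le_less_trans zero_le_power2 zero_less_mult_pos)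
  note p2 = next_pos[OF pos(1,2)]
  note p3 = next_pos[OF p2 pos(3)]
  note p4 = next_pos[OF p3 pos(4)]
  define s1 l1 l2 l3 l4 where "s1 = A $ v1 $ v1" and "l1 = A $ v1 $ v2 / A $ v1 $ v1"
    and "l2 = A $ v2 $ v3 / A $ v2 $ v2" and "l3 = A $ v3 $ v4 / A $ v3 $ v3" and "l4 = A $ v4 $ v5 / A $ v4 $ v4"
  define t2 t3 t4 t5 where "t2 = A $ v2 $ v2 - l1\<^sup>2 * A $ v1 $ v1" and "t3 = A $ v3 $ v3 - l2\<^sup>2 * A $ v2 $ v2"
    and "t4 = A $ v4 $ v4 - l3\<^sup>2 * A $ v3 $ v3" and "t5 = A $ v5 $ v5 - l4\<^sup>2 * A $ v4 $ v4"
  have tpos: "0 < s1" "0 < t2" "0 < t3" "0 < t4" "0 < t5"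
    using pos p2 p3 p4 unfolding s1_def t2_def t3_def t4_def t5_def l1_def l2_def l3_def l4_def
    by (simp_all add: field_simps power2_eq_square)
  define s2 s3 s4 s5 where "s2 = l1\<^sup>2 * s1 + t2" and "s3 = l2\<^sup>2 * s2 + t3" and "s4 = l3\<^sup>2 * s3 + t4"
    and "s5 = l4\<^sup>2 * s4 + t5"
  have d: "A $ v1 $ v1 = s1" "A $ v2 $ v2 = s2" "A $ v3 $ v3 = s3" "A $ v4 $ v4 = s4" "A $ v5 $ v5 = s5"
    by (simp_all add: s1_def s2_def s3_def s4_def s5_def t2_def t3_def t4_def t5_def)
  have spos: "0 < s2" "0 < s3" "0 < s4" using p2 p3 p4 d by simp_all
  have e1: "A $ v1 $ v2 = l1 * s1" "A $ v2 $ v3 = l2 * s2" "A $ v3 $ v4 = l3 * s3" "A $ v4 $ v5 = l4 * s4"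
    using pos(1) p2 p3 p4 by (simp_all add: l1_def l2_def l3_def l4_def d[symmetric])
  have step: "x = l * y" if "x * s = y * (l * s)" "0 < s" for x y l s :: real
    using that by simp
  have e2: "A $ v1 $ v3 = l2 * (l1 * s1)" "A $ v2 $ v4 = l3 * (l2 * s2)" "A $ v3 $ v5 = l4 * (l3 * s3)"
    using step[OF markov(1)[unfolded d e1] spos(1)] step[OF markov(3)[unfolded d e1] spos(2)]
      step[OF markov(6)[unfolded d e1] spos(3)] by simp_all
  have e3: "A $ v1 $ v4 = l3 * (l2 * (l1 * s1))" "A $ v2 $ v5 = l4 * (l3 * (l2 * s2))"
    using step[OF markov(2)[unfolded d e1 e2] spos(2)] step[OF markov(5)[unfolded d e1 e2] spos(3)] by simp_all
  have e4: "A $ v1 $ v5 = l4 * (l3 * (l2 * (l1 * s1)))"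
    using step[OF markov(4)[unfolded d e1 e2 e3] spos(3)] by simp
  note e = d e1 e2 e3 e4
  note e' = e(6-)[unfolded sym[of v1] sym[of v2 v3] sym[of v2 v4] sym[of v2 v5] sym[of v3 v4] sym[of v3 v5] sym[of v4 v5]]
  have su: "sum f UNIV = f v1 + (f v2 + (f v3 + (f v4 + f v5)))" for f :: "'n \<Rightarrow> real"
    unfolding U using dist by (simp add: add_ac)
  have sq: "x \<bullet> (A *v x) = s1 * (x $ v1 + l1 * (x $ v2 + l2 * (x $ v3 + l3 * (x $ v4 + l4 * x $ v5))))\<^sup>2
    + t2 * (x $ v2 + l2 * (x $ v3 + l3 * (x $ v4 + l4 * x $ v5)))\<^sup>2 + t3 * (x $ v3 + l3 * (x $ v4 + l4 * x $ v5))\<^sup>2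
    + t4 * (x $ v4 + l4 * x $ v5)\<^sup>2 + t5 * (x $ v5)\<^sup>2" for x
    unfolding inner_vec_def matrix_vector_mult_def su
    by (simp add: su e e' s2_def s3_def s4_def s5_def) (simp add: algebra_simps power2_eq_square)
  have pd: "sym_pos_def A"
    unfolding sym_pos_def_def
  proof (intro conjI allI impI)
    show "Finite_Cartesian_Product.transpose A = A"
      using sym by (simp add: Finite_Cartesian_Product.transpose_def vec_eq_iff)
    fix x :: "real ^ 'n" assume x: "x \<noteq> 0"
    show "0 < x \<bullet> (A *v x)"
    proof (rule ccontr)
      assume "\<not> ?thesis"
      moreover have nn: "0 \<le> s1 * a\<^sup>2" "0 \<le> t2 * a\<^sup>2" "0 \<le> t3 * a\<^sup>2" "0 \<le> t4 * a\<^sup>2" "0 \<le> t5 * a\<^sup>2" for a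
        using tpos by simp_all
      ultimately have z: "s1 * (x $ v1 + l1 * (x $ v2 + l2 * (x $ v3 + l3 * (x $ v4 + l4 * x $ v5))))\<^sup>2 = 0"
        "t2 * (x $ v2 + l2 * (x $ v3 + l3 * (x $ v4 + l4 * x $ v5)))\<^sup>2 = 0" "t3 * (x $ v3 + l3 * (x $ v4 + l4 * x $ v5))\<^sup>2 = 0"
        "t4 * (x $ v4 + l4 * x $ v5)\<^sup>2 = 0" "t5 * (x $ v5)\<^sup>2 = 0"
        unfolding sq by (smt (verit))+
      have x5: "x $ v5 = 0" using z(5) tpos by simp
      have x4: "x $ v4 = 0" using z(4) tpos x5 by simp
      have x3: "x $ v3 = 0" using z(3) tpos x5 x4 by simp
      have x2: "x $ v2 = 0" using z(2) tpos x5 x4 x3 by simp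
      have x1: "x $ v1 = 0" using z(1) tpos x5 x4 x3 x2 by simp
      have "x $ v = 0" for v using U x1 x2 x3 x4 x5 by (metis UNIV_I empty_iff insert_iff)
      with x show False by (simp add: vec_eq_iff)
    qed
  qed
  have l0: "{v1, v2} \<notin> E \<Longrightarrow> l1 = 0" "{v2, v3} \<notin> E \<Longrightarrow> l2 = 0" "{v3, v4} \<notin> E \<Longrightarrow> l3 = 0" "{v4, v5} \<notin> E \<Longrightarrow> l4 = 0"
    using edges by (auto simp: l1_def l2_def l3_def l4_def)
  let ?P = "\<lambda>i j S. (i \<in> S \<and> j \<notin> S \<or> j \<in> S \<and> i \<notin> S) \<and>
      ((\<forall>w\<in>S. \<forall>v\<in>-S. A $ v $ w = 0) \<or>
       (\<exists>k. k \<notin> S \<and> k \<noteq> i \<and> k \<noteq> j \<and> (\<forall>w\<in>S. \<forall>v\<in>- insert k S. A $ v $ w * A $ k $ k = A $ v $ k * A $ k $ w)))"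
  have c: "- {v1} = {v2, v3, v4, v5}" "- {v1, v2} = {v3, v4, v5}" "- {v1, v2, v3} = {v4, v5}" "- {v1, v2, v3, v4} = {v5}"
    using U dist by auto
  have c': "- {v2, v1} = {v3, v4, v5}" "- {v3, v1, v2} = {v4, v5}" "- {v4, v1, v2, v3} = {v5}"
    using U dist by auto
  have P1: "?P v1 j {v1}" if "j \<in> {v3, v4, v5}" for j
    unfolding c by (rule conjI, use that dist in force, rule disjI2, rule exI[of _ v2]) (use that dist in \<open>auto simp: c' e e'\<close>)
  have P2: "?P v2 j {v1, v2}" if "j \<in> {v4, v5}" for j
    unfolding c by (rule conjI, use that dist in force, rule disjI2, rule exI[of _ v3]) (use that dist in \<open>auto simp: c' e e'\<close>)
  have P3: "?P v3 v5 {v1, v2, v3}"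
    unfolding c by (rule conjI, use dist in force, rule disjI2, rule exI[of _ v4]) (use dist in \<open>auto simp: c' e e'\<close>)
  have P4: "{v1, v2} \<notin> E \<Longrightarrow> ?P v1 v2 {v1}" "{v2, v3} \<notin> E \<Longrightarrow> ?P v2 v3 {v1, v2}"
    "{v3, v4} \<notin> E \<Longrightarrow> ?P v3 v4 {v1, v2, v3}" "{v4, v5} \<notin> E \<Longrightarrow> ?P v4 v5 {v1, v2, v3, v4}"
    unfolding c using dist l0 by (auto simp: e e')
  define Q where "Q i j \<longleftrightarrow> (\<exists>S. ?P i j S)" for i j
  have Q_sym: "Q j i" if "Q i j" for i j
    using that unfolding Q_def by blast
  have q: "Q v1 v3" "Q v1 v4" "Q v1 v5" "Q v2 v4" "Q v2 v5" "Q v3 v5"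
    unfolding Q_def
    by (rule exI, rule P1, simp) (rule exI, rule P1, simp, rule exI, rule P1, simp, rule exI, rule P2, simp,
        rule exI, rule P2, simp, rule exI, rule P3)
  have qe: "{v1, v2} \<notin> E \<Longrightarrow> Q v1 v2" "{v2, v3} \<notin> E \<Longrightarrow> Q v2 v3" "{v3, v4} \<notin> E \<Longrightarrow> Q v3 v4" "{v4, v5} \<notin> E \<Longrightarrow> Q v4 v5"
    unfolding Q_def by (rule exI, erule P4)+
  have qe': "{v2, v1} \<notin> E \<Longrightarrow> Q v2 v1" "{v3, v2} \<notin> E \<Longrightarrow> Q v3 v2" "{v4, v3} \<notin> E \<Longrightarrow> Q v4 v3" "{v5, v4} \<notin> E \<Longrightarrow> Q v5 v4"
    using qe Q_sym by (simp_all add: insert_commute)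
  show ?thesis
  proof (rule gaussian_modelI[OF pd])
    fix i j assume ij: "i \<noteq> j" "{i, j} \<notin> E"
    have "\<forall>i\<in>{v1, v2, v3, v4, v5}. \<forall>j\<in>{v1, v2, v3, v4, v5}. i \<noteq> j \<longrightarrow> {i, j} \<notin> E \<longrightarrow> Q i j"
      by (simp add: q q[THEN Q_sym] qe qe')
    then have "Q i j"
      unfolding U[symmetric] using ij by blast
    then show "\<exists>S. ?P i j S"
      unfolding Q_def .
  qed
qed

section \<open>Toric vanishing ideals\<close>

lemma poly_eval_0 [simp]: "poly_eval 0 x = 0"
  by (simp add: poly_eval_def)

lemma poly_eval_uminus: "poly_eval (- f) x = - poly_eval f x"
  using poly_eval_add[of f "- f" x] by (simp add: add_eq_0_iff)

lemma poly_eval_diff: "poly_eval (f - g) x = poly_eval f x - poly_eval g x"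
  using poly_eval_add[of f "- g" x] by (simp add: poly_eval_uminus)

interpretation cpoly: cring cpoly_ring
  by (rule cring_cpoly_ring)

lemma cpoly_ring_simps [simp]:
  "carrier cpoly_ring = UNIV" "f \<oplus>\<^bsub>cpoly_ring\<^esub> g = f + g" "f \<otimes>\<^bsub>cpoly_ring\<^esub> g = f * g" "\<zero>\<^bsub>cpoly_ring\<^esub> = 0"
  by (simp_all add: cpoly_ring_def)

lemma ideal_cpoly_iff:
  "ideal J cpoly_ring \<longleftrightarrow> 0 \<in> J \<and> (\<forall>f\<in>J. \<forall>g\<in>J. f + g \<in> J) \<and> (\<forall>f\<in>J. \<forall>g. g * f \<in> J)"
proof
  assume "ideal J cpoly_ring"
  then interpret ideal J cpoly_ring .
  show "0 \<in> J \<and> (\<forall>f\<in>J. \<forall>g\<in>J. f + g \<in> J) \<and> (\<forall>f\<in>J. \<forall>g. g * f \<in> J)"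
    using zero_closed a_closed I_l_closed by simp
next
  assume J: "0 \<in> J \<and> (\<forall>f\<in>J. \<forall>g\<in>J. f + g \<in> J) \<and> (\<forall>f\<in>J. \<forall>g. g * f \<in> J)"
  show "ideal J cpoly_ring"
  proof (rule idealI)
    show "subgroup J (add_monoid cpoly_ring)"
    proof
      fix f assume "f \<in> J"
      have "inv\<^bsub>add_monoid cpoly_ring\<^esub> f = - f"
        by (rule group.inv_equality[OF cpoly.a_group]) (simp_all add: cpoly_ring_def)
      moreover have "- 1 * f \<in> J" using J \<open>f \<in> J\<close> by blast
      ultimately show "inv\<^bsub>add_monoid cpoly_ring\<^esub> f \<in> J" by simp
    qed (use J in \<open>auto simp: cpoly_ring_def\<close>)
  qed (use J in \<open>auto simp: cpoly.ring_axioms mult.commute\<close>)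
qed

lemma ideal_cpoly_sum:
  assumes "ideal J cpoly_ring" "\<And>i. i \<in> A \<Longrightarrow> f i \<in> J"
  shows "sum f A \<in> J"
  using assms(2) assms(1)[unfolded ideal_cpoly_iff]
  by (induction A rule: infinite_finite_induct) auto

lemma ideal_cpoly_diff:
  assumes "ideal J cpoly_ring" "f \<in> J" "g \<in> J"
  shows "f - g \<in> J"
proof -
  have "f + (- 1) * g \<in> J" using assms unfolding ideal_cpoly_iff by blast
  then show ?thesis by simp
qed

lemma ideal_vanishing_ideal: "ideal (vanishing_ideal X) cpoly_ring"
  unfolding ideal_cpoly_iff by (simp add: vanishing_ideal_def poly_eval_add poly_eval_mult)

subsection \<open>Vanishing ideals of multiplicatively closed sets\<close>

definition monomial_eval :: "('v::finite \<Rightarrow>\<^sub>0 nat) \<Rightarrow> complex ^ 'v \<Rightarrow> complex" where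
  "monomial_eval m x = (\<Prod>v\<in>UNIV. x $ v ^ Poly_Mapping.lookup m v)"

lemma poly_eval_single_eq: "poly_eval (Poly_Mapping.single m c) x = c * monomial_eval m x"
  by (simp add: poly_eval_single monomial_eval_def)

lemma Const_mult_single: "Const c * Poly_Mapping.single m d = Poly_Mapping.single m (c * d)"
  by (simp add: Const_def mult_single)

text \<open>Dedekind's argument: translating a relation by \<open>z\<close> and subtracting
  \<open>ch k z\<close> times the relation eliminates \<open>k\<close>. As \<open>X\<close> is only
  a semigroup, characters may vanish identically on it, which \<open>nz\<close> excludes.\<close>

lemma characters_independent:
  fixes ch :: "'i \<Rightarrow> 'x \<Rightarrow> 'a::field"
  assumes "finite S"
    and mult: "\<And>i x y. x \<in> X \<Longrightarrow> y \<in> X \<Longrightarrow> ch i (m x y) = ch i x * ch i y"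
    and closed: "\<And>x y. x \<in> X \<Longrightarrow> y \<in> X \<Longrightarrow> m x y \<in> X"
    and nz: "\<And>i. i \<in> S \<Longrightarrow> \<exists>x\<in>X. ch i x \<noteq> 0"
    and distinct: "\<And>i j. i \<in> S \<Longrightarrow> j \<in> S \<Longrightarrow> i \<noteq> j \<Longrightarrow> \<exists>x\<in>X. ch i x \<noteq> ch j x"
    and zero: "\<And>x. x \<in> X \<Longrightarrow> (\<Sum>i\<in>S. c i * ch i x) = 0"
    and "i \<in> S"
  shows "c i = 0"
  using assms(1,4-7)
proof (induction S arbitrary: c i)
  case (insert k S)
  have S: "c i = 0" if "i \<in> S" for i
  proof -
    from insert.hyps that have "i \<noteq> k" by auto
    then obtain z where z: "z \<in> X" "ch i z \<noteq> ch k z"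
      using insert.prems(2)[of i k] \<open>i \<in> S\<close> by auto
    have "c i * (ch i z - ch k z) = 0"
    proof (rule insert.IH[OF _ _ _ \<open>i \<in> S\<close>])
      fix x assume x: "x \<in> X"
      have "(\<Sum>i\<in>S. c i * (ch i z - ch k z) * ch i x) = (\<Sum>i\<in>insert k S. c i * (ch i z - ch k z) * ch i x)"
        using insert.hyps by simp
      also have "\<dots> = (\<Sum>i\<in>insert k S. c i * ch i (m x z)) - ch k z * (\<Sum>i\<in>insert k S. c i * ch i x)"
        unfolding sum_distrib_left sum_subtractf[symmetric]
        by (intro sum.cong) (simp_all add: mult[OF x z(1)] algebra_simps)
      also have "\<dots> = 0"
        using insert.prems(3)[OF x] insert.prems(3)[OF closed[OF x z(1)]] by simp
      finally show "(\<Sum>i\<in>S. c i * (ch i z - ch k z) * ch i x) = 0" .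
    qed (use insert.prems in auto)
    with z show ?thesis by simp
  qed
  obtain x where x: "x \<in> X" "ch k x \<noteq> 0" using insert.prems(1) by blast
  have "c k * ch k x = 0"
    using insert.prems(3)[OF x(1)] insert.hyps S by simp
  with x have "c k = 0" by simp
  with S insert.prems show ?case by auto
qed simp

text \<open>Monomials with equal restriction to \<open>X\<close> differ by unital binomials of the
  ideal, so every \<open>f\<close> is congruent to a combination of representatives. These are
  distinct characters of \<open>X\<close>, so by independence only representatives vanishing
  identically on \<open>X\<close> survive, and those are monomials of the ideal.\<close>

lemma toric_vanishing_ideal:
  fixes X :: "(complex ^ 'v::finite) set"
  assumes closed: "\<And>x y. x \<in> X \<Longrightarrow> y \<in> X \<Longrightarrow> (\<chi> v. x $ v * y $ v) \<in> X"
    and prime: "primeideal (vanishing_ideal X) cpoly_ring"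
  shows "toric_ideal (vanishing_ideal X)"
proof -
  define I where "I = vanishing_ideal X"
  define B where "B = {f \<in> I. unital_binomial f}"
  define J where "J = genideal cpoly_ring B"
  have J: "ideal J cpoly_ring" "B \<subseteq> J"
    unfolding J_def by (rule cpoly.genideal_ideal, simp) (rule cpoly.genideal_self, simp)
  have JI: "J \<subseteq> I"
    unfolding J_def I_def by (rule cpoly.genideal_minimal[OF ideal_vanishing_ideal]) (auto simp: B_def I_def)
  have cJ: "Const c * f \<in> J" if "f \<in> B" for c f
    using J that unfolding ideal_cpoly_iff by blast
  define rep where "rep m = (SOME m'. \<forall>x\<in>X. monomial_eval m' x = monomial_eval m x)" for m :: "'v \<Rightarrow>\<^sub>0 nat"
  have rep: "\<forall>x\<in>X. monomial_eval (rep m) x = monomial_eval m x" for m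
    unfolding rep_def by (rule someI_ex) auto
  have rep_eq: "rep m = rep m'" if "\<forall>x\<in>X. monomial_eval m x = monomial_eval m' x" for m m'
    unfolding rep_def using that by simp
  have "f \<in> J" if f: "f \<in> I" for f
  proof -
    define f' where "f' = (\<Sum>m\<in>Poly_Mapping.keys f. Poly_Mapping.single (rep m) (Poly_Mapping.lookup f m))"
    have ff': "f - f' \<in> J"
    proof -
      have "f - f' = (\<Sum>m\<in>Poly_Mapping.keys f. Const (Poly_Mapping.lookup f m) *
         (Poly_Mapping.single m 1 - Poly_Mapping.single (rep m) 1))"
        by (subst cpoly_sum_single[of f])
           (simp add: f'_def sum_subtractf right_diff_distrib Const_mult_single)
      also have "\<dots> \<in> J"
      proof (rule ideal_cpoly_sum[OF J(1)])
        fix m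
        have "Poly_Mapping.single m 1 - Poly_Mapping.single (rep m) 1 \<in> B"
          unfolding B_def I_def vanishing_ideal_def unital_binomial_def
          using rep[of m] by (auto simp: poly_eval_diff poly_eval_single_eq)
        then show "Const (Poly_Mapping.lookup f m) * (Poly_Mapping.single m 1 - Poly_Mapping.single (rep m) 1) \<in> J"
          by (rule cJ)
      qed
      finally show ?thesis .
    qed
    define N where "N = rep ` Poly_Mapping.keys f"
    define c where "c n = (\<Sum>m\<in>{m \<in> Poly_Mapping.keys f. rep m = n}. Poly_Mapping.lookup f m)" for n
    have f'_eq: "f' = (\<Sum>n\<in>N. Poly_Mapping.single n (c n))"
    proof -
      have "f' = (\<Sum>n\<in>N. \<Sum>m\<in>{m \<in> Poly_Mapping.keys f. rep m = n}. Poly_Mapping.single (rep m) (Poly_Mapping.lookup f m))"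
        unfolding f'_def N_def by (rule sum.image_gen) simp
      also have "\<dots> = (\<Sum>n\<in>N. Poly_Mapping.single n (c n))"
      proof (intro sum.cong refl)
        fix n :: "'v \<Rightarrow>\<^sub>0 nat"
        have "(\<Sum>m\<in>A. Poly_Mapping.single n (Poly_Mapping.lookup f m)) = Poly_Mapping.single n (\<Sum>m\<in>A. Poly_Mapping.lookup f m)"
          for A by (induction A rule: infinite_finite_induct) (simp_all add: single_add)
        then show "(\<Sum>m\<in>{m \<in> Poly_Mapping.keys f. rep m = n}. Poly_Mapping.single (rep m) (Poly_Mapping.lookup f m)) = Poly_Mapping.single n (c n)"
          unfolding c_def by simp
      qed
      finally show ?thesis .
    qed
    have "f - f' \<in> I" using ff' JI by blast
    then have "f - (f - f') \<in> I"
      using f ideal_cpoly_diff[OF ideal_vanishing_ideal] unfolding I_def by blast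
    then have "f' \<in> I" by simp
    define Z where "Z = {n \<in> N. \<forall>x\<in>X. monomial_eval n x = 0}"
    have fin: "finite N" by (simp add: N_def)
    have c0: "c n = 0" if n: "n \<in> N - Z" for n
    proof (rule characters_independent[where X = X and S = "N - Z" and ch = monomial_eval and m = "\<lambda>x y. \<chi> v. x $ v * y $ v"])
      fix i j assume ij: "i \<in> N - Z" "j \<in> N - Z" "i \<noteq> j"
      then obtain i' j' where i': "i = rep i'" "j = rep j'" by (auto simp: N_def)
      show "\<exists>x\<in>X. monomial_eval i x \<noteq> monomial_eval j x"
      proof (rule ccontr)
        assume "\<not> ?thesis"
        then have "\<forall>x\<in>X. monomial_eval i' x = monomial_eval j' x"
          using rep[of i'] rep[of j'] by (simp add: i')
        then show False using rep_eq[of i' j'] ij by (simp add: i')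
      qed
    next
      fix x assume x: "x \<in> X"
      have "poly_eval f' x = 0" using \<open>f' \<in> I\<close> x by (auto simp: I_def vanishing_ideal_def)
      then have "(\<Sum>n\<in>N. c n * monomial_eval n x) = 0"
        by (simp add: f'_eq poly_eval_sum poly_eval_single_eq)
      moreover have "(\<Sum>n\<in>N - Z. c n * monomial_eval n x) = (\<Sum>n\<in>N. c n * monomial_eval n x)"
        using fin x by (intro sum.mono_neutral_left) (auto simp: Z_def)
      ultimately show "(\<Sum>n\<in>N - Z. c n * monomial_eval n x) = 0" by simp
    qed (use n fin closed in \<open>auto simp: Z_def monomial_eval_def power_mult_distrib prod.distrib\<close>)
    have "f' \<in> J"
      unfolding f'_eq
    proof (rule ideal_cpoly_sum[OF J(1)])
      fix n assume n: "n \<in> N"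
      show "Poly_Mapping.single n (c n) \<in> J"
      proof (cases "n \<in> Z")
        case True
        \<comment> \<open>The subtracted term is the zero polynomial: a monomial is a unital
          binomial with coefficient 0.\<close>
        have "Poly_Mapping.single n 1 - Poly_Mapping.single 0 0 \<in> B"
          unfolding B_def I_def vanishing_ideal_def unital_binomial_def
          using True by (auto simp: Z_def poly_eval_single_eq poly_eval_diff)
        from cJ[OF this, of "c n"] show ?thesis by (simp add: Const_mult_single)
      next
        case False
        with n c0 J(1) show ?thesis by (simp add: ideal_cpoly_iff)
      qed
    qed
    then have "(f - f') + f' \<in> J" using ff' J(1) unfolding ideal_cpoly_iff by blast
    then show "f \<in> J" by simp
  qed
  with JI have "I = genideal cpoly_ring B" by (auto simp: J_def)
  then show ?thesis
    unfolding toric_ideal_def I_def[symmetric]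
    using prime[folded I_def] by (intro conjI exI[of _ B]) (auto simp: B_def)
qed

subsection \<open>Vanishing ideals of Gaussian models are prime\<close>

text \<open>Concentration matrices in the model form a convex set, and along a segment of them the covariance
  matrix is a rational function without poles.\<close>

definition rational_fun :: "(real \<Rightarrow> complex) \<Rightarrow> bool" where
  "rational_fun g \<longleftrightarrow> (\<exists>p q. \<forall>s\<in>{0..1}. poly q (complex_of_real s) \<noteq> 0 \<and> g s * poly q (complex_of_real s) = poly p (complex_of_real s))"

lemma rational_fun_poly: "rational_fun (\<lambda>s. poly p (complex_of_real s))"
  unfolding rational_fun_def by (rule exI[of _ p], rule exI[of _ 1]) simp

lemma rational_fun_const: "rational_fun (\<lambda>s. c)"
  using rational_fun_poly[of "[:c:]"] by simp

lemma rational_fun_add: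
  assumes "rational_fun f" "rational_fun g"
  shows "rational_fun (\<lambda>s. f s + g s)"
proof -
  obtain p q p' q' where
    f: "\<forall>s\<in>{0..1}. poly q (complex_of_real s) \<noteq> 0 \<and> f s * poly q (complex_of_real s) = poly p (complex_of_real s)" and
    g: "\<forall>s\<in>{0..1}. poly q' (complex_of_real s) \<noteq> 0 \<and> g s * poly q' (complex_of_real s) = poly p' (complex_of_real s)"
    using assms unfolding rational_fun_def by blast
  show ?thesis
    unfolding rational_fun_def
  proof (rule exI[of _ "p * q' + p' * q"], rule exI[of _ "q * q'"], intro ballI conjI)
    fix s :: real assume s: "s \<in> {0..1}"
    note e = f[rule_format, OF s, THEN conjunct2, symmetric] g[rule_format, OF s, THEN conjunct2, symmetric]
    show "(f s + g s) * poly (q * q') (complex_of_real s) = poly (p * q' + p' * q) (complex_of_real s)"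
      by (simp add: e algebra_simps)
  qed (use f g in simp)
qed

lemma rational_fun_mult:
  assumes "rational_fun f" "rational_fun g"
  shows "rational_fun (\<lambda>s. f s * g s)"
proof -
  obtain p q p' q' where
    f: "\<forall>s\<in>{0..1}. poly q (complex_of_real s) \<noteq> 0 \<and> f s * poly q (complex_of_real s) = poly p (complex_of_real s)" and
    g: "\<forall>s\<in>{0..1}. poly q' (complex_of_real s) \<noteq> 0 \<and> g s * poly q' (complex_of_real s) = poly p' (complex_of_real s)"
    using assms unfolding rational_fun_def by blast
  show ?thesis
    unfolding rational_fun_def
  proof (rule exI[of _ "p * p'"], rule exI[of _ "q * q'"], intro ballI conjI)
    fix s :: real assume s: "s \<in> {0..1}"
    note e = f[rule_format, OF s, THEN conjunct2, symmetric] g[rule_format, OF s, THEN conjunct2, symmetric]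
    show "f s * g s * poly (q * q') (complex_of_real s) = poly (p * p') (complex_of_real s)"
      by (simp add: e mult_ac)
  qed (use f g in simp)
qed

lemma rational_fun_inverse:
  assumes "rational_fun f" "\<And>s. s \<in> {0..1} \<Longrightarrow> f s \<noteq> 0"
  shows "rational_fun (\<lambda>s. inverse (f s))"
proof -
  obtain p q where
    f: "\<forall>s\<in>{0..1}. poly q (complex_of_real s) \<noteq> 0 \<and> f s * poly q (complex_of_real s) = poly p (complex_of_real s)"
    using assms unfolding rational_fun_def by blast
  show ?thesis
    unfolding rational_fun_def
  proof (rule exI[of _ q], rule exI[of _ p], rule ballI)
    fix s :: real assume s: "s \<in> {0..1}"
    show "poly p (complex_of_real s) \<noteq> 0 \<and> inverse (f s) * poly p (complex_of_real s) = poly q (complex_of_real s)"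
      using f[rule_format, OF s] assms(2)[OF s] by (metis (no_types, lifting) left_inverse mult.assoc mult_1 mult_eq_0_iff)
  qed
qed

lemma rational_fun_sum: "(\<And>i. i \<in> A \<Longrightarrow> rational_fun (f i)) \<Longrightarrow> rational_fun (\<lambda>s. \<Sum>i\<in>A. f i s)"
  by (induction A rule: infinite_finite_induct) (simp_all add: rational_fun_const rational_fun_add)

lemma rational_fun_prod: "(\<And>i. i \<in> A \<Longrightarrow> rational_fun (f i)) \<Longrightarrow> rational_fun (\<lambda>s. \<Prod>i\<in>A. f i s)"
  by (induction A rule: infinite_finite_induct) (simp_all add: rational_fun_const rational_fun_mult)

lemma rational_fun_power: "rational_fun f \<Longrightarrow> rational_fun (\<lambda>s. f s ^ n)"
  by (induction n) (simp_all add: rational_fun_const rational_fun_mult)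

lemma rational_fun_poly_eval:
  assumes "\<And>v. rational_fun (\<lambda>s. x s $ v)"
  shows "rational_fun (\<lambda>s. poly_eval f (x s))"
  unfolding poly_eval_def
  by (intro rational_fun_sum rational_fun_mult rational_fun_const rational_fun_prod rational_fun_power assms)

lemma rational_fun_det:
  fixes M :: "real \<Rightarrow> real ^ 'n ^ 'n"
  assumes "\<And>i j. rational_fun (\<lambda>s. complex_of_real (M s $ i $ j))"
  shows "rational_fun (\<lambda>s. complex_of_real (det (M s)))"
  unfolding det_def of_real_sum of_real_mult of_real_prod
  by (intro rational_fun_sum rational_fun_mult rational_fun_const rational_fun_prod assms)

lemma rational_fun_mult_eq_0:
  assumes "rational_fun f" "rational_fun g" "\<And>s. s \<in> {0..1} \<Longrightarrow> f s * g s = 0"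
  shows "(\<forall>s\<in>{0..1}. f s = 0) \<or> (\<forall>s\<in>{0..1}. g s = 0)"
proof -
  obtain p q p' q' where
    f: "\<forall>s\<in>{0..1}. poly q (complex_of_real s) \<noteq> 0 \<and> f s * poly q (complex_of_real s) = poly p (complex_of_real s)" and
    g: "\<forall>s\<in>{0..1}. poly q' (complex_of_real s) \<noteq> 0 \<and> g s * poly q' (complex_of_real s) = poly p' (complex_of_real s)"
    using assms unfolding rational_fun_def by blast
  have "p * p' = 0"
  proof (rule ccontr)
    assume "p * p' \<noteq> 0"
    then have "finite {z. poly (p * p') z = 0}"
      by (rule poly_roots_finite)
    moreover have "complex_of_real ` {0..1} \<subseteq> {z. poly (p * p') z = 0}"
    proof
      fix z assume "z \<in> complex_of_real ` {0..1}"
      then obtain s where s: "s \<in> {0..1}" "z = complex_of_real s" by blast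
      note e = f[rule_format, OF s(1)] g[rule_format, OF s(1)]
      have "poly p (complex_of_real s) * poly p' (complex_of_real s)
          = f s * g s * (poly q (complex_of_real s) * poly q' (complex_of_real s))"
        by (simp add: e[THEN conjunct2, symmetric] mult_ac)
      then show "z \<in> {z. poly (p * p') z = 0}"
        using assms(3)[OF s(1)] s(2) by simp
    qed
    ultimately have "finite (complex_of_real ` {0..1})" by (rule finite_subset[rotated])
    then have "finite {0..1::real}" by (rule finite_imageD) (simp add: inj_on_def)
    then show False using infinite_Icc[of "0::real" 1] by simp
  qed
  then show ?thesis using f g by fastforce
qed

text \<open>Cramer's rule writes the entry as a quotient of determinants, whose denominator has no
  zero on the interval.\<close>

lemma rational_fun_matrix_inv:
  fixes K :: "real \<Rightarrow> real ^ 'n ^ 'n"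
  assumes "\<And>i j. rational_fun (\<lambda>s. complex_of_real (K s $ i $ j))"
    and inv: "\<And>s. s \<in> {0..1} \<Longrightarrow> invertible (K s)"
  shows "\<exists>h. rational_fun h \<and> (\<forall>s\<in>{0..1}. h s = complex_of_real (matrix_inv (K s) $ i $ j))"
proof -
  define N where "N s = (\<chi> k l. if l = i then axis j 1 $ k else K s $ k $ l)" for s
  define h where "h s = complex_of_real (det (N s)) * inverse (complex_of_real (det (K s)))" for s
  have "rational_fun h"
    unfolding h_def
  proof (intro rational_fun_mult rational_fun_inverse rational_fun_det)
    show "rational_fun (\<lambda>s. complex_of_real (N s $ k $ l))" for k l
      by (cases "l = i") (simp_all add: N_def rational_fun_const assms)
    show "complex_of_real (det (K s)) \<noteq> 0" if "s \<in> {0..1}" for s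
      using inv[OF that] by (simp add: invertible_det_nz)
  qed (rule assms)
  moreover have "h s = complex_of_real (matrix_inv (K s) $ i $ j)" if s: "s \<in> {0..1}" for s
  proof -
    define x where "x = (\<chi> k. matrix_inv (K s) $ k $ j)"
    have "K s *v x = axis j 1"
      using inverse_sum[OF matrix_inv_right[OF inv[OF s]]]
      by (simp add: x_def matrix_vector_mult_def vec_eq_iff axis_def)
    moreover have "det (K s) \<noteq> 0" using inv[OF s] by (simp add: invertible_det_nz)
    ultimately have "x = (\<chi> k. det (\<chi> i l. if l = k then axis j 1 $ i else K s $ i $ l) / det (K s))"
      using cramer by blast
    then have "x $ i = det (N s) / det (K s)"
      by (simp add: N_def)
    then show ?thesis
      by (simp add: x_def h_def divide_inverse)
  qed
  ultimately show ?thesis by blast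
qed

lemma gaussian_model_segment:
  fixes A1 A2 :: "real ^ 'n ^ 'n"
  assumes A: "A1 \<in> gaussian_model E" "A2 \<in> gaussian_model E" and s: "s \<in> {0..1}"
  defines "K \<equiv> (1 - s) *\<^sub>R matrix_inv A1 + s *\<^sub>R matrix_inv A2"
  shows "invertible K" "matrix_inv K \<in> gaussian_model E"
proof -
  have pd: "sym_pos_def A1" "sym_pos_def A2" using A by (auto simp: gaussian_model_def)
  note pdi = sym_pos_def_inv[OF pd(1)] sym_pos_def_inv[OF pd(2)]
  have "sym_pos_def K"
    unfolding sym_pos_def_def
  proof (intro conjI allI impI)
    show "Finite_Cartesian_Product.transpose K = K"
      using sym_pos_def_sym[OF pdi(1)] sym_pos_def_sym[OF pdi(2)]
      by (simp add: K_def Finite_Cartesian_Product.transpose_def vec_eq_iff)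
    fix x :: "real ^ 'n" assume x: "x \<noteq> 0"
    have "0 < x \<bullet> (matrix_inv A1 *v x)" "0 < x \<bullet> (matrix_inv A2 *v x)"
      using pdi x by (auto simp: sym_pos_def_def)
    then have "0 < (1 - s) * (x \<bullet> (matrix_inv A1 *v x)) + s * (x \<bullet> (matrix_inv A2 *v x))"
      using s by (cases "s = 0") (auto intro: add_nonneg_pos)
    also have "\<dots> = x \<bullet> (K *v x)"
      by (simp add: K_def matrix_vector_mult_add_rdistrib scaleR_matrix_vector_assoc[symmetric] inner_add_right)
    finally show "0 < x \<bullet> (K *v x)" .
  qed
  then show inv: "invertible K" by (rule sym_pos_def_invertible)
  have "K $ i $ j = 0" if "i \<noteq> j" "{i, j} \<notin> E" for i j
    using A that by (simp add: K_def gaussian_model_def)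
  then show "matrix_inv K \<in> gaussian_model E"
    unfolding gaussian_model_def using sym_pos_def_inv[OF \<open>sym_pos_def K\<close>]
    by (simp add: matrix_inv_matrix_inv[OF inv])
qed

lemma identity_in_gaussian_model: "(mat 1 :: real ^ 'n ^ 'n) \<in> gaussian_model E"
proof -
  have "matrix_inv (mat 1) = (mat 1 :: real ^ 'n ^ 'n)"
    by (rule matrix_inv_unique) simp_all
  moreover have "\<forall>i j. i \<noteq> j \<longrightarrow> (mat 1 :: real ^ 'n ^ 'n) $ i $ j = 0"
    by (simp add: mat_def)
  ultimately show ?thesis
    unfolding gaussian_model_def sym_pos_def_def by simp
qed

text \<open>If \<open>f\<close> is nonzero at \<open>A1\<close> and \<open>g\<close> at
  \<open>A2\<close>, then along the segment between their inverses two rational functions have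
  product zero although neither is identically zero.\<close>

lemma primeideal_gaussian_model:
  "primeideal (vanishing_ideal (sigma_coords ` gaussian_model E)) cpoly_ring"
proof (rule primeidealI[OF ideal_vanishing_ideal cring_cpoly_ring])
  let ?I = "vanishing_ideal (sigma_coords ` gaussian_model E)"
  have "1 \<notin> ?I"
    using identity_in_gaussian_model[of E] by (auto simp: vanishing_ideal_def)
  then show "carrier cpoly_ring \<noteq> ?I" by auto
  fix f g :: "sigma_var cpoly"
  assume fg: "f \<otimes>\<^bsub>cpoly_ring\<^esub> g \<in> ?I"
  show "f \<in> ?I \<or> g \<in> ?I"
  proof (rule ccontr)
    assume "\<not> ?thesis"
    then obtain A1 A2 where A: "A1 \<in> gaussian_model E" "A2 \<in> gaussian_model E"
      and nz: "poly_eval f (sigma_coords A1) \<noteq> 0" "poly_eval g (sigma_coords A2) \<noteq> 0"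
      by (auto simp: vanishing_ideal_def)
    define K where "K s = (1 - s) *\<^sub>R matrix_inv A1 + s *\<^sub>R matrix_inv A2" for s
    have inv: "invertible (K s)" and M: "matrix_inv (K s) \<in> gaussian_model E" if "s \<in> {0..1}" for s
      using gaussian_model_segment[OF A that] by (simp_all add: K_def)
    have "rational_fun (\<lambda>s. complex_of_real (K s $ i $ j))" for i j
    proof -
      have "rational_fun (\<lambda>s. poly [:complex_of_real (matrix_inv A1 $ i $ j),
          complex_of_real (matrix_inv A2 $ i $ j - matrix_inv A1 $ i $ j):] (complex_of_real s))"
        by (rule rational_fun_poly)
      then show ?thesis
        by (rule back_subst[of rational_fun]) (auto simp: K_def fun_eq_iff algebra_simps)
    qed
    from rational_fun_matrix_inv[OF this inv] obtain h where
      h: "\<And>i j. rational_fun (h i j)" "\<And>i j s. s \<in> {0..1} \<Longrightarrow> h i j s = complex_of_real (matrix_inv (K s) $ i $ j)"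
      by metis
    define x where "x s = (\<chi> v. case Rep_sigma_var v of (i, j) \<Rightarrow> h i j s)" for s
    have x: "x s = sigma_coords (matrix_inv (K s))" if "s \<in> {0..1}" for s
      by (auto simp: x_def sigma_coords_def vec_eq_iff h(2)[OF that] split: prod.split)
    have rx: "rational_fun (\<lambda>s. x s $ v)" for v
      by (cases "Rep_sigma_var v") (simp add: x_def h(1))
    have "(\<forall>s\<in>{0..1}. poly_eval f (x s) = 0) \<or> (\<forall>s\<in>{0..1}. poly_eval g (x s) = 0)"
    proof (rule rational_fun_mult_eq_0)
      fix s :: real assume s: "s \<in> {0..1}"
      have "poly_eval (f * g) (x s) = 0"
        using fg M[OF s] by (auto simp: x[OF s] vanishing_ideal_def)
      then show "poly_eval f (x s) * poly_eval g (x s) = 0" by (simp add: poly_eval_mult)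
    qed (rule rational_fun_poly_eval, rule rx)+
    moreover have "x 0 = sigma_coords A1" "x 1 = sigma_coords A2"
      using A by (simp_all add: x K_def gaussian_model_def sym_pos_def_invertible matrix_inv_matrix_inv)
    moreover have "(0::real) \<in> {0..1}" "(1::real) \<in> {0..1}" by simp_all
    ultimately show False using nz by metis
  qed
qed

section \<open>Graphs all of whose separations are by cut vertices\<close>

definition markov_set :: "'n::finite set set \<Rightarrow> (real ^ 'n ^ 'n) set" where
  "markov_set E = {A. (\<forall>i j. A $ i $ j = A $ j $ i) \<and> (\<forall>i. 0 < A $ i $ i) \<and>
     (\<forall>S k w v. separated E S (- insert k S) \<and> k \<notin> S \<and> w \<in> S \<and> v \<notin> S \<and> v \<noteq> k \<longrightarrow>
        A $ v $ w * A $ k $ k = A $ v $ k * A $ k $ w) \<and>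
     (\<forall>S w v. separated E S (- S) \<and> w \<in> S \<and> v \<notin> S \<longrightarrow> A $ v $ w = 0)}"

lemma markov_setI:
  assumes "\<And>i j. A $ i $ j = A $ j $ i" "\<And>i. 0 < A $ i $ i"
    and "\<And>S k w v. separated E S (- insert k S) \<Longrightarrow> k \<notin> S \<Longrightarrow> w \<in> S \<Longrightarrow> v \<notin> S \<Longrightarrow> v \<noteq> k \<Longrightarrow>
        A $ v $ w * A $ k $ k = A $ v $ k * A $ k $ w"
    and "\<And>S w v. separated E S (- S) \<Longrightarrow> w \<in> S \<Longrightarrow> v \<notin> S \<Longrightarrow> A $ v $ w = 0"
  shows "A \<in> markov_set E"
  using assms unfolding markov_set_def by blast

lemma gaussian_model_subset_markov_set: "gaussian_model E \<subseteq> markov_set E"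
proof
  fix A assume A: "A \<in> gaussian_model E"
  then have pd: "sym_pos_def A" by (simp add: gaussian_model_def)
  show "A \<in> markov_set E"
    unfolding markov_set_def
    using sym_pos_def_sym[OF pd] sym_pos_def_diag[OF pd] gaussian_model_separated[OF A] gaussian_model_disconnected[OF A]
    by blast
qed

lemma markov_set_mult:
  assumes "A \<in> markov_set E" "B \<in> markov_set E"
  shows "(\<chi> i j. A $ i $ j * B $ i $ j) \<in> markov_set E"
proof -
  have eq: "A $ v $ w * B $ v $ w * (A $ k $ k * B $ k $ k) = A $ v $ k * B $ v $ k * (A $ k $ w * B $ k $ w)"
    if "separated E S (- insert k S)" "k \<notin> S" "w \<in> S" "v \<notin> S" "v \<noteq> k" for S k w v
  proof -
    have "A $ v $ w * A $ k $ k = A $ v $ k * A $ k $ w" "B $ v $ w * B $ k $ k = B $ v $ k * B $ k $ w"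
      using assms that unfolding markov_set_def by blast+
    then have "(A $ v $ w * A $ k $ k) * (B $ v $ w * B $ k $ k) = (A $ v $ k * A $ k $ w) * (B $ v $ k * B $ k $ w)"
      by simp
    then show ?thesis by (simp only: mult_ac)
  qed
  have diag: "A $ i $ j * B $ i $ j = A $ j $ i * B $ j $ i" "0 < A $ i $ i * B $ i $ i" for i j
    using assms unfolding markov_set_def by simp_all
 have zero: "A $ v $ w = 0" if "separated E S (- S)" "w \<in> S" "v \<notin> S" for S v w
    using assms(1) that unfolding markov_set_def by blast
  show ?thesis
    by (rule markov_setI; simp only: vec_lambda_beta) (rule diag, rule diag, rule eq, assumption+, simp add: zero)
qed

section \<open>Graph distances and the contraction towards the diagonal\<close>

definition edge_rel :: "'n set set \<Rightarrow> ('n \<times> 'n) set" where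
  "edge_rel E = {(u, v). {u, v} \<in> E}"

text \<open>Meaningless if \<open>v\<close> is not reachable from \<open>u\<close>.\<close>

definition graph_dist :: "'n set set \<Rightarrow> 'n \<Rightarrow> 'n \<Rightarrow> nat" where
  "graph_dist E u v = (LEAST n. (u, v) \<in> edge_rel E ^^ n)"

lemma edge_rel_pow_sym: "(u, v) \<in> edge_rel E ^^ n \<longleftrightarrow> (v, u) \<in> edge_rel E ^^ n"
proof -
  have "(v, u) \<in> edge_rel E ^^ n" if "(u, v) \<in> edge_rel E ^^ n" for u v
    using that
  proof (induction n arbitrary: v)
    case (Suc n)
    then obtain y where "(u, y) \<in> edge_rel E ^^ n" "(y, v) \<in> edge_rel E" by auto
    then have "(y, u) \<in> edge_rel E ^^ n" "(v, y) \<in> edge_rel E"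
      using Suc.IH by (auto simp: edge_rel_def insert_commute)
    then show ?case by (rule relpow_Suc_I2[rotated])
  qed simp
  then show ?thesis by blast
qed

lemma graph_dist_commute: "graph_dist E u v = graph_dist E v u"
  unfolding graph_dist_def by (simp add: edge_rel_pow_sym[of u v])

lemma graph_dist_self [simp]: "graph_dist E u u = 0"
  unfolding graph_dist_def by (rule Least_equality) auto

text \<open>No edge joins \<open>S\<close> to the vertices outside \<open>insert k S\<close>, so a
  walk starting outside \<open>S\<close> can enter it only from \<open>k\<close>.\<close>

lemma path_through_separator:
  assumes sep: "separated E S (- insert k S)" and "w \<in> S"
  shows "(v, w) \<in> edge_rel E ^^ n \<Longrightarrow> v \<notin> S \<Longrightarrow> \<exists>a b. a + b = n \<and> (v, k) \<in> edge_rel E ^^ a \<and> (k, w) \<in> edge_rel E ^^ b"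
proof (induction n arbitrary: v)
  case 0
  then show ?case using assms by auto
next
  case (Suc n)
  show ?case
  proof (cases "v = k")
    case True
    then show ?thesis using Suc.prems(1) by (metis add_0 relpow_0_I)
  next
    case False
    obtain y where y: "(v, y) \<in> edge_rel E" "(y, w) \<in> edge_rel E ^^ n"
      using relpow_Suc_D2[OF Suc.prems(1)] by blast
    have "y \<notin> S"
      using sep y(1) False Suc.prems(2) by (auto simp: separated_def edge_rel_def insert_commute)
    then obtain a b where "a + b = n" "(y, k) \<in> edge_rel E ^^ a" "(k, w) \<in> edge_rel E ^^ b"
      using Suc.IH[OF y(2)] by blast
    then show ?thesis
      using relpow_Suc_I2[OF y(1)] by (metis add_Suc)
  qed
qed

lemma graph_dist_separator:
  assumes sep: "separated E S (- insert k S)" and "w \<in> S" "v \<notin> S" and conn: "(v, w) \<in> edge_rel E ^^ n"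
  shows "graph_dist E v w = graph_dist E v k + graph_dist E k w"
proof (rule antisym)
  have l: "(x, y) \<in> edge_rel E ^^ graph_dist E x y" if "(x, y) \<in> edge_rel E ^^ m" for x y m
    unfolding graph_dist_def using that by (rule LeastI)
  obtain a b where ab: "a + b = graph_dist E v w" "(v, k) \<in> edge_rel E ^^ a" "(k, w) \<in> edge_rel E ^^ b"
    using path_through_separator[OF sep \<open>w \<in> S\<close> l[OF conn] \<open>v \<notin> S\<close>] by blast
  have "graph_dist E v k \<le> a" "graph_dist E k w \<le> b"
    unfolding graph_dist_def using ab by (auto intro: Least_le)
  with ab show "graph_dist E v k + graph_dist E k w \<le> graph_dist E v w" by simp
  have "(v, w) \<in> edge_rel E ^^ (graph_dist E v k + graph_dist E k w)"
    unfolding relpow_add using l[OF ab(2)] l[OF ab(3)] by blast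
  then show "graph_dist E v w \<le> graph_dist E v k + graph_dist E k w"
    unfolding graph_dist_def[of E v w] by (rule Least_le)
qed

text \<open>The connected component of \<open>w\<close> is separated from its complement.\<close>

lemma markov_set_unreachable:
  assumes "A \<in> markov_set E" "\<And>n. (v, w) \<notin> edge_rel E ^^ n"
  shows "A $ v $ w = 0"
proof -
  define S where "S = {x. \<exists>n. (x, w) \<in> edge_rel E ^^ n}"
  have "separated E S (- S)"
    unfolding separated_def S_def
  proof (intro ballI notI)
    fix u x assume "u \<in> {x. \<exists>n. (x, w) \<in> edge_rel E ^^ n}" "x \<in> - {x. \<exists>n. (x, w) \<in> edge_rel E ^^ n}" "{u, x} \<in> E"
    moreover from this obtain n where "(u, w) \<in> edge_rel E ^^ n" "\<And>n. (x, w) \<notin> edge_rel E ^^ n" by blast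
    moreover from \<open>{u, x} \<in> E\<close> have "(x, u) \<in> edge_rel E" by (simp add: edge_rel_def insert_commute)
    ultimately show False
      using relpow_Suc_I2 by metis
  qed
  moreover have "(w, w) \<in> edge_rel E ^^ 0" by simp
  then have "w \<in> S" unfolding S_def by blast
  moreover have "v \<notin> S" using assms(2) by (auto simp: S_def)
  ultimately show ?thesis using assms(1) unfolding markov_set_def by blast
qed

text \<open>Distances add up along cut vertices, so this curve stays in \<^const>\<open>markov_set\<close>; it is positive definite for
  small \<open>t\<close> and passes through \<open>A\<close> at \<open>t = 1\<close>.\<close>

definition shrink :: "'n::finite set set \<Rightarrow> real ^ 'n ^ 'n \<Rightarrow> real \<Rightarrow> real ^ 'n ^ 'n" where
  "shrink E A t = (\<chi> i j. t ^ graph_dist E i j * A $ i $ j)"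

lemma shrink_in_markov_set:
  assumes A: "A \<in> markov_set E"
  shows "shrink E A t \<in> markov_set E"
proof -
  have eq: "t ^ graph_dist E v w * A $ v $ w * A $ k $ k = t ^ graph_dist E v k * A $ v $ k * (t ^ graph_dist E k w * A $ k $ w)"
    if "separated E S (- insert k S)" "k \<notin> S" "w \<in> S" "v \<notin> S" "v \<noteq> k" for S k w v
  proof -
    have A_eq: "A $ v $ w * A $ k $ k = A $ v $ k * A $ k $ w"
      using A that unfolding markov_set_def by blast
    show ?thesis
    proof (cases "\<exists>n. (v, w) \<in> edge_rel E ^^ n")
      case True
      then obtain n where "(v, w) \<in> edge_rel E ^^ n" by blast
      then have "graph_dist E v w = graph_dist E v k + graph_dist E k w"
        using graph_dist_separator that by metis
      then have "t ^ graph_dist E v w * A $ v $ w * A $ k $ k = t ^ graph_dist E v k * t ^ graph_dist E k w * (A $ v $ w * A $ k $ k)"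
        by (simp add: power_add)
      then show ?thesis unfolding A_eq by (simp add: mult_ac)
    next
      \<comment> \<open>The distance from \<open>v\<close> to \<open>w\<close> is meaningless here,
        but \<open>A $ v $ w = 0\<close> makes both sides vanish.\<close>
      case False
      then have "A $ v $ w = 0" using markov_set_unreachable[OF A] by blast
      with A_eq show ?thesis by auto
    qed
  qed
  have diag: "0 < A $ i $ i" for i
    using A unfolding markov_set_def by simp
 have zero: "A $ v $ w = 0" if "separated E S (- S)" "w \<in> S" "v \<notin> S" for S v w
    using A that unfolding markov_set_def by blast
  have sym: "t ^ graph_dist E i j * A $ i $ j = t ^ graph_dist E j i * A $ j $ i" for i j
    using A graph_dist_commute[of E i j] unfolding markov_set_def by simp
  show ?thesis
    unfolding shrink_def
    by (rule markov_setI; simp only: vec_lambda_beta graph_dist_self power_0 mult_1)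
      (rule sym, rule diag, rule eq, assumption+, simp add: zero)
qed

lemma sym_pos_def_diagonally_dominant:
  fixes B :: "real ^ 'n ^ 'n"
  assumes sym: "\<And>i j. B $ i $ j = B $ j $ i" and diag: "\<And>i. \<delta> \<le> B $ i $ i"
    and off: "\<And>i j. i \<noteq> j \<Longrightarrow> \<bar>B $ i $ j\<bar> \<le> \<eta>" and "0 \<le> \<eta>" and small: "real CARD('n) * \<eta> < \<delta>"
  shows "sym_pos_def B"
  unfolding sym_pos_def_def
proof (intro conjI allI impI)
  show "Finite_Cartesian_Product.transpose B = B"
    using sym by (simp add: Finite_Cartesian_Product.transpose_def vec_eq_iff)
  fix x :: "real ^ 'n" assume x: "x \<noteq> 0"
  have "0 < (\<delta> - real CARD('n) * \<eta>) * (x \<bullet> x)"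
    using small x by simp
  \<comment> \<open>The term with \<open>\<eta>\<close> is subtracted for \<open>i = j\<close> as
    well, which lets the double sum be evaluated uniformly; the bound used is
    \<open>2 * \<bar>x y\<bar> \<le> x\<^sup>2 + y\<^sup>2\<close>.\<close>
  also have "\<dots> = (\<Sum>i\<in>UNIV. \<Sum>j\<in>UNIV. (if i = j then \<delta> * (x $ i)\<^sup>2 else 0) - \<eta> * ((x $ i)\<^sup>2 + (x $ j)\<^sup>2) / 2)"
  proof -
    let ?X = "\<Sum>i\<in>UNIV. (x $ i)\<^sup>2"
    have a: "(\<Sum>j\<in>UNIV. \<eta> * ((x $ i)\<^sup>2 + (x $ j)\<^sup>2) / 2) = \<eta> * (real CARD('n) * (x $ i)\<^sup>2 + ?X) / 2" for i
      by (simp add: sum_divide_distrib[symmetric] sum_distrib_left[symmetric] sum.distrib)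
    have b: "(\<Sum>i\<in>UNIV. \<eta> * (real CARD('n) * (x $ i)\<^sup>2 + ?X) / 2) = real CARD('n) * \<eta> * ?X"
      by (simp add: sum_divide_distrib[symmetric] sum_distrib_left[symmetric] sum.distrib)
    show ?thesis
      unfolding sum_subtractf a b
      by (simp add: sum_distrib_left[symmetric] inner_vec_def power2_eq_square[symmetric] left_diff_distrib)
  qed
  also have "\<dots> \<le> (\<Sum>i\<in>UNIV. \<Sum>j\<in>UNIV. x $ i * (B $ i $ j * x $ j))"
  proof (intro sum_mono)
    fix i j
    show "(if i = j then \<delta> * (x $ i)\<^sup>2 else 0) - \<eta> * ((x $ i)\<^sup>2 + (x $ j)\<^sup>2) / 2 \<le> x $ i * (B $ i $ j * x $ j)"
    proof (cases "i = j")
      case True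
      have "\<delta> * (x $ i)\<^sup>2 \<le> B $ i $ i * (x $ i)\<^sup>2" using diag[of i] by (simp add: mult_right_mono)
      moreover have "0 \<le> \<eta> * (x $ i)\<^sup>2" using \<open>0 \<le> \<eta>\<close> by simp
      ultimately show ?thesis using True by (simp add: power2_eq_square algebra_simps)
    next
      case False
      have "2 * \<bar>x $ i * x $ j\<bar> \<le> (x $ i)\<^sup>2 + (x $ j)\<^sup>2"
        using sum_squares_bound[of "\<bar>x $ i\<bar>" "\<bar>x $ j\<bar>"] by (simp add: abs_mult)
      then have "\<bar>B $ i $ j\<bar> * \<bar>x $ i * x $ j\<bar> \<le> \<eta> * (((x $ i)\<^sup>2 + (x $ j)\<^sup>2) / 2)"
        using off[OF False] \<open>0 \<le> \<eta>\<close> by (intro mult_mono) auto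
      moreover have "- (\<bar>B $ i $ j\<bar> * \<bar>x $ i * x $ j\<bar>) \<le> x $ i * (B $ i $ j * x $ j)"
        using abs_ge_minus_self[of "B $ i $ j * (x $ i * x $ j)"] by (simp add: abs_mult mult_ac)
      ultimately show ?thesis using False by simp
    qed
  qed
  also have "\<dots> = x \<bullet> (B *v x)"
    by (simp add: inner_vec_def matrix_vector_mult_def sum_distrib_left)
  finally show "0 < x \<bullet> (B *v x)" .
qed

lemma shrink_pos_def:
  fixes A :: "real ^ 'n ^ 'n"
  assumes A: "A \<in> markov_set E"
  shows "\<exists>\<epsilon>>0. \<forall>t. 0 < t \<and> t < \<epsilon> \<longrightarrow> sym_pos_def (shrink E A t)"
proof -
  define \<delta> where "\<delta> = Min (range (\<lambda>i. A $ i $ i))"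
  define c where "c = (\<Sum>i\<in>UNIV. \<Sum>j\<in>UNIV. \<bar>A $ i $ j\<bar>)"
  have "0 < \<delta>"
    using A by (simp add: \<delta>_def markov_set_def)
  have \<delta>: "\<delta> \<le> A $ i $ i" for i
    unfolding \<delta>_def by (rule Min_le) auto
  have c: "\<bar>A $ i $ j\<bar> \<le> c" for i j
  proof -
    have "\<bar>A $ i $ j\<bar> \<le> (\<Sum>j\<in>UNIV. \<bar>A $ i $ j\<bar>)" by (rule member_le_sum) auto
    also have "\<dots> \<le> c" unfolding c_def by (rule member_le_sum) (auto intro: sum_nonneg)
    finally show ?thesis .
  qed
  have "0 \<le> c" using c[of undefined undefined] by linarith
  \<comment> \<open>The bound 1 ensures \<open>t ^ n \<le> t\<close> for \<open>n \<ge> 1\<close>,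
    so off-diagonal entries are at most \<open>t * c\<close>; the quotient makes them small against
    \<open>\<delta>\<close>, and the summand 1 keeps its denominator positive.\<close>
  define \<epsilon> where "\<epsilon> = min 1 (\<delta> / (real CARD('n) * c + 1))"
  have den: "0 < real CARD('n) * c + 1" using \<open>0 \<le> c\<close> by (simp add: add_nonneg_pos)
  have "0 < \<epsilon>" using \<open>0 < \<delta>\<close> den by (simp add: \<epsilon>_def)
  moreover have "sym_pos_def (shrink E A t)" if t: "0 < t" "t < \<epsilon>" for t
  proof (rule sym_pos_def_diagonally_dominant[where \<delta> = \<delta> and \<eta> = "t * c"])
    show "shrink E A t $ i $ j = shrink E A t $ j $ i" for i j
      using shrink_in_markov_set[OF A, of t] by (simp add: markov_set_def)
    show "\<delta> \<le> shrink E A t $ i $ i" for i using \<delta> by (simp add: shrink_def)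
    show "0 \<le> t * c" using t \<open>0 \<le> c\<close> by simp
    have "t * (real CARD('n) * c + 1) < \<delta>"
      using t den by (simp add: \<epsilon>_def pos_less_divide_eq)
    then show "real CARD('n) * (t * c) < \<delta>" using t by (simp add: algebra_simps)
    fix i j :: 'n assume "i \<noteq> j"
    show "\<bar>shrink E A t $ i $ j\<bar> \<le> t * c"
    proof (cases "\<exists>n. (i, j) \<in> edge_rel E ^^ n")
      case True
      then have "(i, j) \<in> edge_rel E ^^ graph_dist E i j"
        unfolding graph_dist_def by (rule LeastI_ex)
      then have "graph_dist E i j \<noteq> 0" using \<open>i \<noteq> j\<close> by (metis relpow_0_E)
      then obtain m where "graph_dist E i j = Suc m" using not0_implies_Suc by blast
      then have "t ^ graph_dist E i j \<le> t"
        using t power_le_one[of t m] by (simp add: \<epsilon>_def mult_left_le)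
      then show ?thesis
        using c[of i j] t by (auto simp: shrink_def abs_mult intro!: mult_mono)
    next
      case False
      then have "A $ i $ j = 0" using markov_set_unreachable[OF A] by blast
      then show ?thesis using t \<open>0 \<le> c\<close> by (simp add: shrink_def)
    qed
  qed
  ultimately show ?thesis by blast
qed

section \<open>Density of the model when all separations are by cut vertices\<close>

definition cut_vertex_separated :: "'n set set \<Rightarrow> 'n \<Rightarrow> 'n \<Rightarrow> bool" where
  "cut_vertex_separated E i j \<longleftrightarrow> (\<exists>S. (i \<in> S \<and> j \<notin> S \<or> j \<in> S \<and> i \<notin> S) \<and>
     (separated E S (- S) \<or> (\<exists>k. k \<notin> S \<and> k \<noteq> i \<and> k \<noteq> j \<and> separated E S (- insert k S))))"

lemma markov_set_pos_def_in_gaussian_model: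
  fixes A :: "real ^ 'n ^ 'n"
  assumes A: "A \<in> markov_set E" and pd: "sym_pos_def A"
    and sep: "\<And>i j. i \<noteq> j \<Longrightarrow> {i, j} \<notin> E \<Longrightarrow> cut_vertex_separated E i j"
  shows "A \<in> gaussian_model E"
proof (rule gaussian_modelI[OF pd])
  fix i j :: 'n assume "i \<noteq> j" "{i, j} \<notin> E"
  from sep[OF this] obtain S where S: "i \<in> S \<and> j \<notin> S \<or> j \<in> S \<and> i \<notin> S"
    "separated E S (- S) \<or> (\<exists>k. k \<notin> S \<and> k \<noteq> i \<and> k \<noteq> j \<and> separated E S (- insert k S))"
    unfolding cut_vertex_separated_def by blast
  have d: "\<forall>w\<in>S. \<forall>v\<in>- S. A $ v $ w = 0" if "separated E S (- S)"
    using A that unfolding markov_set_def by blast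
  have k: "\<forall>w\<in>S. \<forall>v\<in>- insert k S. A $ v $ w * A $ k $ k = A $ v $ k * A $ k $ w"
    if "separated E S (- insert k S)" "k \<notin> S" for k
  proof (intro ballI)
    fix w v assume "w \<in> S" "v \<in> - insert k S"
    then show "A $ v $ w * A $ k $ k = A $ v $ k * A $ k $ w"
      using A that unfolding markov_set_def by blast
  qed
  show "\<exists>S. (i \<in> S \<and> j \<notin> S \<or> j \<in> S \<and> i \<notin> S) \<and>
      ((\<forall>w\<in>S. \<forall>v\<in>-S. A $ v $ w = 0) \<or>
       (\<exists>k. k \<notin> S \<and> k \<noteq> i \<and> k \<noteq> j \<and> (\<forall>w\<in>S. \<forall>v\<in>- insert k S. A $ v $ w * A $ k $ k = A $ v $ k * A $ k $ w)))"
    using S d k by (intro exI[of _ S]) blast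
qed

lemma rational_fun_eq_0_extend:
  assumes "rational_fun g" "0 < \<epsilon>" "\<And>s. 0 < s \<Longrightarrow> s < \<epsilon> \<Longrightarrow> g s = 0"
  shows "g 1 = 0"
proof -
  obtain p q where
    f: "\<forall>s\<in>{0..1}. poly q (complex_of_real s) \<noteq> 0 \<and> g s * poly q (complex_of_real s) = poly p (complex_of_real s)"
    using assms unfolding rational_fun_def by blast
  have "p = 0"
  proof (rule ccontr)
    assume "p \<noteq> 0"
    then have "finite {z. poly p z = 0}"
      by (rule poly_roots_finite)
    moreover have "complex_of_real ` {0<..<min \<epsilon> 1} \<subseteq> {z. poly p z = 0}"
    proof
      fix z assume "z \<in> complex_of_real ` {0<..<min \<epsilon> 1}"
      then obtain s where s: "0 < s" "s < \<epsilon>" "s < 1" "z = complex_of_real s" by auto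
      then have "s \<in> {0..1}" by simp
      from f[rule_format, OF this] assms(3)[OF s(1,2)] s(4) show "z \<in> {z. poly p z = 0}" by simp
    qed
    ultimately have "finite (complex_of_real ` {0<..<min \<epsilon> 1})" by (rule finite_subset[rotated])
    then have "finite {0<..<min \<epsilon> 1}" by (rule finite_imageD) (simp add: inj_on_def)
    then show False using infinite_Ioo[of 0 "min \<epsilon> 1"] \<open>0 < \<epsilon>\<close> by simp
  qed
  with f show ?thesis by (auto dest: bspec[of _ _ 1])
qed

text \<open>A polynomial vanishing on the model vanishes along \<open>shrink\<close> for small
  \<open>t\<close>, hence at \<open>t = 1\<close>. So both sets have the same ideal: the model
  contributes primality, \<open>markov_set\<close> closure under entrywise products.\<close>

lemma toric_graph_ideal:
  assumes sep: "\<And>i j. i \<noteq> j \<Longrightarrow> {i, j} \<notin> E \<Longrightarrow> cut_vertex_separated E i j"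
  shows "toric_ideal (graph_ideal E)"
proof -
  have eq: "vanishing_ideal (sigma_coords ` gaussian_model E) = vanishing_ideal (sigma_coords ` markov_set E)"
  proof
    show "vanishing_ideal (sigma_coords ` markov_set E) \<subseteq> vanishing_ideal (sigma_coords ` gaussian_model E)"
      using gaussian_model_subset_markov_set[of E] by (auto simp: vanishing_ideal_def)
    show "vanishing_ideal (sigma_coords ` gaussian_model E) \<subseteq> vanishing_ideal (sigma_coords ` markov_set E)"
    proof
      fix f assume f: "f \<in> vanishing_ideal (sigma_coords ` gaussian_model E)"
      have "poly_eval f (sigma_coords A) = 0" if A: "A \<in> markov_set E" for A
      proof -
        obtain \<epsilon> where \<epsilon>: "0 < \<epsilon>" "\<And>t. 0 < t \<Longrightarrow> t < \<epsilon> \<Longrightarrow> sym_pos_def (shrink E A t)"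
          using shrink_pos_def[OF A] by blast
        have "rational_fun (\<lambda>t. poly_eval f (sigma_coords (shrink E A t)))"
        proof (rule rational_fun_poly_eval)
          fix v
          obtain i j where ij: "Rep_sigma_var v = (i, j)" by fastforce
          have "rational_fun (\<lambda>t. poly (monom (complex_of_real (A $ i $ j)) (graph_dist E i j)) (complex_of_real t))"
            by (rule rational_fun_poly)
          then show "rational_fun (\<lambda>t. sigma_coords (shrink E A t) $ v)"
            by (simp add: sigma_coords_def ij shrink_def poly_monom mult.commute)
        qed
        moreover have "poly_eval f (sigma_coords (shrink E A t)) = 0" if "0 < t" "t < \<epsilon>" for t
          using f markov_set_pos_def_in_gaussian_model[OF shrink_in_markov_set[OF A] \<epsilon>(2)[OF that] sep]
          by (auto simp: vanishing_ideal_def)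
        ultimately have "poly_eval f (sigma_coords (shrink E A 1)) = 0"
          by (rule rational_fun_eq_0_extend[OF _ \<epsilon>(1)])
        moreover have "shrink E A 1 = A" by (simp add: shrink_def vec_eq_iff)
        ultimately show ?thesis by simp
      qed
      then show "f \<in> vanishing_ideal (sigma_coords ` markov_set E)" by (auto simp: vanishing_ideal_def)
    qed
  qed
  have "toric_ideal (vanishing_ideal (sigma_coords ` markov_set E))"
  proof (rule toric_vanishing_ideal)
    show "primeideal (vanishing_ideal (sigma_coords ` markov_set E)) cpoly_ring"
      unfolding eq[symmetric] by (rule primeideal_gaussian_model)
    fix x y assume "x \<in> sigma_coords ` markov_set E" "y \<in> sigma_coords ` markov_set E"
    then obtain A B where AB: "A \<in> markov_set E" "B \<in> markov_set E" "x = sigma_coords A" "y = sigma_coords B" by blast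
    have "(\<chi> v. x $ v * y $ v) = sigma_coords (\<chi> i j. A $ i $ j * B $ i $ j)"
      by (auto simp: AB sigma_coords_def vec_eq_iff split: prod.split)
    with markov_set_mult[OF AB(1,2)] show "(\<chi> v. x $ v * y $ v) \<in> sigma_coords ` markov_set E" by blast
  qed
  then show ?thesis
    by (simp add: graph_ideal_def vanishing_ideal_zariski_closure eq)
qed

section \<open>Toric ideals after a linear change of coordinates\<close>

text \<open>The linear span of the unital binomials in \<open>J\<close>. Monomial multiples of
  unital binomials are again unital binomials, so for an ideal \<open>J\<close> this span is an
  ideal, and it exhausts \<open>J\<close> as soon as \<open>J\<close> has unital binomial
  generators.\<close>

inductive_set binomial_span :: "'v cpoly set \<Rightarrow> 'v cpoly set" for J where
  zero: "0 \<in> binomial_span J"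
| add: "h \<in> binomial_span J \<Longrightarrow> f \<in> J \<Longrightarrow> unital_binomial f \<Longrightarrow> h + Const c * f \<in> binomial_span J"

lemma binomial_span_add:
  "h \<in> binomial_span J \<Longrightarrow> g \<in> binomial_span J \<Longrightarrow> g + h \<in> binomial_span J"
proof (induction h rule: binomial_span.induct)
  case (add h f c)
  then show ?case
    using binomial_span.add[of "g + h" J f c] by (simp add: add.assoc)
qed simp

lemma binomial_span_sum:
  "(\<And>i. i \<in> A \<Longrightarrow> f i \<in> binomial_span J) \<Longrightarrow> sum f A \<in> binomial_span J"
  by (induction A rule: infinite_finite_induct) (auto intro: binomial_span.zero binomial_span_add)

lemma unital_binomial_mult_monomial:
  "unital_binomial f \<Longrightarrow> unital_binomial (Poly_Mapping.single m 1 * f)"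
  unfolding unital_binomial_def by (auto simp: right_diff_distrib mult_single) blast+

lemma ideal_binomial_span:
  assumes "ideal J cpoly_ring"
  shows "ideal (binomial_span J) cpoly_ring"
  unfolding ideal_cpoly_iff
proof (intro conjI ballI allI)
  show "0 \<in> binomial_span J" by (rule binomial_span.zero)
  show "g + h \<in> binomial_span J" if "g \<in> binomial_span J" "h \<in> binomial_span J" for g h
    using that by (simp add: binomial_span_add)
  fix h g assume h: "h \<in> binomial_span J"
  have single: "Poly_Mapping.single m d * h \<in> binomial_span J" for m d
    using h
  proof (induction h rule: binomial_span.induct)
    case (add h f c)
    have "Poly_Mapping.single m d * (h + Const c * f)
        = Poly_Mapping.single m d * h + Const (d * c) * (Poly_Mapping.single m 1 * f)"
      by (simp add: distrib_left Const_def mult_single mult.assoc[symmetric])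
    moreover have "Poly_Mapping.single m 1 * f \<in> J"
      using assms add.hyps(2) unfolding ideal_cpoly_iff by blast
    ultimately show ?case
      using binomial_span.add[OF add.IH _ unital_binomial_mult_monomial[OF add.hyps(3)]] by simp
  qed (simp add: binomial_span.zero)
  have "g * h = (\<Sum>m\<in>Poly_Mapping.keys g. Poly_Mapping.single m (Poly_Mapping.lookup g m) * h)"
    by (subst (1) cpoly_sum_single[of g]) (simp add: sum_distrib_right)
  also have "\<dots> \<in> binomial_span J"
    by (rule binomial_span_sum) (rule single)
  finally show "g * h \<in> binomial_span J" .
qed

lemma genideal_unital_binomials_subset:
  assumes "\<forall>f\<in>B. unital_binomial f" "J = genideal cpoly_ring B"
  shows "J \<subseteq> binomial_span J"
proof -
  have J: "ideal J cpoly_ring" "B \<subseteq> J"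
    unfolding assms(2) by (rule cpoly.genideal_ideal, simp) (rule cpoly.genideal_self, simp)
  have "f \<in> binomial_span J" if "f \<in> B" for f
  proof -
    have "0 + Const 1 * f \<in> binomial_span J"
      using that J(2) assms(1) by (intro binomial_span.intros) auto
    then show ?thesis by (simp add: Const_def)
  qed
  then show ?thesis
    by (subst assms(2)) (intro cpoly.genideal_minimal ideal_binomial_span J; blast)
qed

lemma monomial_eval_linear:
  fixes S :: "complex ^ 'v::finite ^ 'v"
  shows "\<exists>us. \<forall>y. monomial_eval m (S *v y) = lprod us y"
proof -
  have "\<exists>us. \<forall>y. (\<Prod>v\<in>A. (S *v y) $ v ^ Poly_Mapping.lookup m v) = lprod us y" for A
  proof (induction A rule: infinite_finite_induct)
    case (insert v A)
    then obtain us where us: "\<And>y. (\<Prod>v\<in>A. (S *v y) $ v ^ Poly_Mapping.lookup m v) = lprod us y" by blast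
    have "lform (S $ v) y = (S *v y) $ v" for y
      by (simp add: lform_def matrix_vector_mult_def)
    then have "lprod (replicate n (S $ v)) y = (S *v y) $ v ^ n" for n y
      by (induction n) (simp_all add: lprod_def)
    then show ?case
      using insert.hyps by (intro exI[of _ "replicate (Poly_Mapping.lookup m v) (S $ v) @ us"]) (simp add: lprod_append us)
  qed (auto intro!: exI[of _ "[]"] simp: lprod_def)
  then show ?thesis by (simp add: monomial_eval_def)
qed

text \<open>Evaluating at \<open>S *v y\<close> undoes the action on \<open>D\<close> and turns each
  monomial into a product of linear forms given by rows of \<open>S\<close>.\<close>

lemma toric_change_decomposition:
  fixes S :: "complex ^ 'v::finite ^ 'v"
  assumes toric: "toric_ideal (lin_act S ` vanishing_ideal X)" and S: "invertible S"
    and cone: "\<And>y t. y \<in> X \<Longrightarrow> 0 < t \<Longrightarrow> complex_of_real t *s y \<in> X"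
    and D: "D \<in> vanishing_ideal X"
  shows "\<exists>fs. (\<forall>(n, g)\<in>set fs. two_products n X g) \<and> (\<forall>y. poly_eval D y = (\<Sum>(n, g)\<leftarrow>fs. g y))"
proof -
  define J where "J = lin_act S ` vanishing_ideal X"
  obtain B where B: "\<forall>f\<in>B. unital_binomial f" "J = genideal cpoly_ring B"
    using toric unfolding toric_ideal_def J_def by blast
  have inv: "matrix_inv S *v (S *v y) = y" for y
    by (simp add: matrix_vector_mul_assoc matrix_inv_left[OF S])
  have "\<exists>fs. (\<forall>(n, g)\<in>set fs. two_products n X g) \<and> (\<forall>y. poly_eval h (S *v y) = (\<Sum>(n, g)\<leftarrow>fs. g y))"
    if "h \<in> binomial_span J" for h
    using that
  proof (induction h rule: binomial_span.induct)
    case zero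
    show ?case by (intro exI[of _ "[]"]) simp
  next
    case (add h f c)
    from add.hyps(3) obtain a b k where f: "f = Poly_Mapping.single a 1 - Poly_Mapping.single b k"
      unfolding unital_binomial_def by blast
    obtain us ws where us: "\<And>y. monomial_eval a (S *v y) = lprod us y" "\<And>y. monomial_eval b (S *v y) = lprod ws y"
      using monomial_eval_linear by metis
    have "\<exists>gs. (\<forall>(n, g)\<in>set gs. two_products n X g) \<and> (\<forall>y. poly_eval (Const c * f) (S *v y) = (\<Sum>(n, g)\<leftarrow>gs. g y))"
    proof (rule binomial_split[OF cone])
      show "poly_eval (Const c * f) (S *v y) = c * lprod us y - (c * k) * lprod ws y" for y
        by (simp add: f poly_eval_mult poly_eval_diff poly_eval_single_eq us algebra_simps)
      fix y assume "y \<in> X"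
      obtain f' where "f' \<in> vanishing_ideal X" "f = lin_act S f'" using add.hyps(2) by (auto simp: J_def)
      then have "poly_eval f (S *v y) = 0"
        using \<open>y \<in> X\<close> by (auto simp: poly_eval_lin_act inv vanishing_ideal_def)
      then show "poly_eval (Const c * f) (S *v y) = 0" by (simp add: poly_eval_mult)
    qed
    then obtain gs where gs: "\<forall>(n, g)\<in>set gs. two_products n X g"
      "\<And>y. poly_eval (Const c * f) (S *v y) = (\<Sum>(n, g)\<leftarrow>gs. g y)" by blast
    obtain fs where fs: "\<forall>(n, g)\<in>set fs. two_products n X g"
      "\<And>y. poly_eval h (S *v y) = (\<Sum>(n, g)\<leftarrow>fs. g y)" using add.IH by blast
    show ?case
      by (intro exI[of _ "fs @ gs"]) (use fs gs in \<open>auto simp: poly_eval_add\<close>)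
  qed
  moreover have "lin_act S D \<in> binomial_span J"
    using genideal_unital_binomials_subset[OF B] D by (auto simp: J_def)
  ultimately have "\<exists>fs. (\<forall>(n, g)\<in>set fs. two_products n X g) \<and>
      (\<forall>y. poly_eval (lin_act S D) (S *v y) = (\<Sum>(n, g)\<leftarrow>fs. g y))" by blast
  then show ?thesis
    unfolding poly_eval_lin_act inv .
qed

text \<open>Replacing \<open>y\<close> by \<open>t *s y\<close> multiplies each summand by
  \<open>t\<close> to its degree, so comparing \<open>t ^ k\<close> discards the summands of other
  degrees.\<close>

lemma toric_change_homogeneous_decomposition:
  fixes S :: "complex ^ 'v::finite ^ 'v"
  assumes toric: "toric_ideal (lin_act S ` vanishing_ideal X)" and S: "invertible S"
    and cone: "\<And>y t. y \<in> X \<Longrightarrow> 0 < t \<Longrightarrow> complex_of_real t *s y \<in> X"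
    and D: "D \<in> vanishing_ideal X" and hom: "\<And>t y. poly_eval D (t *s y) = t ^ k * poly_eval D y"
  obtains gs where "\<And>g. g \<in> set gs \<Longrightarrow> two_products k X g" "poly_eval D = (\<lambda>y. \<Sum>g\<leftarrow>gs. g y)"
proof -
  obtain fs where fs: "\<And>n g. (n, g) \<in> set fs \<Longrightarrow> two_products n X g"
    "\<And>y. poly_eval D y = (\<Sum>(n, g)\<leftarrow>fs. g y)"
    using toric_change_decomposition[OF toric S cone D] by blast
  define gs where "gs = map snd (filter (\<lambda>(n, g). n = k) fs)"
  have "poly_eval D y = (\<Sum>g\<leftarrow>gs. g y)" for y
  proof -
    have "(\<Sum>(n, c)\<leftarrow>map (\<lambda>(n, g). (n, g y)) fs. t ^ n * c) = t ^ k * poly_eval D y" for t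
    proof -
      have "(\<Sum>(n, c)\<leftarrow>map (\<lambda>(n, g). (n, g y)) fs. t ^ n * c) = (\<Sum>(n, g)\<leftarrow>fs. g (t *s y))"
        using two_products_scale[OF fs(1)] by (auto simp: comp_def intro!: arg_cong[where f = sum_list])
      then show ?thesis by (simp add: fs(2)[symmetric] hom)
    qed
    from homogeneous_part[OF this] show ?thesis
      by (simp add: gs_def filter_map comp_def case_prod_unfold)
  qed
  then show ?thesis
    using fs(1) by (intro that[of gs]) (auto simp: gs_def)
qed

section \<open>Markov chains inside Gaussian models\<close>

definition sigma_index :: "5 \<Rightarrow> 5 \<Rightarrow> sigma_var" where
  "sigma_index x y = Abs_sigma_var (min x y, max x y)"

lemma Rep_sigma_index: "Rep_sigma_var (sigma_index x y) = (min x y, max x y)"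
  unfolding sigma_index_def by (rule Abs_sigma_var_inverse) (auto simp: min_def max_def)

lemma sigma_index_commute: "sigma_index x y = sigma_index y x"
  by (simp add: sigma_index_def min.commute max.commute)

lemma sigma_index_eq_iff:
  "sigma_index x y = sigma_index x' y' \<longleftrightarrow> x = x' \<and> y = y' \<or> x = y' \<and> y = x'"
  unfolding Rep_sigma_var_inject[symmetric] Rep_sigma_index by (auto simp: min_def max_def split: if_splits)

lemma sigma_index_exhaust: "\<exists>x y. v = sigma_index x y"
proof -
  obtain x y where xy: "Rep_sigma_var v = (x, y)" by fastforce
  with Rep_sigma_var[of v] have "x \<le> y" by simp
  then have "v = sigma_index x y"
    unfolding Rep_sigma_var_inject[symmetric] Rep_sigma_index xy by (simp add: min_def max_def)
  then show ?thesis by blast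
qed

lemma sigma_coords_index:
  assumes "\<And>x y. A $ x $ y = A $ y $ x"
  shows "sigma_coords A $ sigma_index x y = complex_of_real (A $ x $ y)"
  using assms[of x y] by (simp add: sigma_coords_def Rep_sigma_index min_def max_def)

definition sigma_axis :: "5 \<Rightarrow> 5 \<Rightarrow> complex ^ sigma_var" where
  "sigma_axis x y = axis (sigma_index x y) 1"

lemma sigma_axis_commute: "sigma_axis x y = sigma_axis y x"
  by (simp add: sigma_axis_def sigma_index_commute)

lemma sigma_axis_index:
  "sigma_axis x y $ sigma_index x' y' = (if x = x' \<and> y = y' \<or> x = y' \<and> y = x' then 1 else 0)"
  by (auto simp: sigma_axis_def axis_def sigma_index_eq_iff)

lemma distinct_all_neq:
  assumes "distinct [i, a, j, b, c]"
  shows "i \<noteq> a" "i \<noteq> j" "i \<noteq> b" "i \<noteq> c" 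
    "a \<noteq> i" "a \<noteq> j" "a \<noteq> b" "a \<noteq> c" 
    "j \<noteq> i" "j \<noteq> a" "j \<noteq> b" "j \<noteq> c" 
    "b \<noteq> i" "b \<noteq> a" "b \<noteq> j" "b \<noteq> c" 
    "c \<noteq> i" "c \<noteq> a" "c \<noteq> j" "c \<noteq> b"
  using assms by auto

text \<open>With \<open>isolated\<close>, the fifth vertex \<open>c\<close> is independent of the chain; otherwise only the marginal on
  \<open>i, a, j, b\<close> is prescribed.\<close>

definition chain_realizable :: "5 set set \<Rightarrow> bool \<Rightarrow> 5 \<Rightarrow> 5 \<Rightarrow> 5 \<Rightarrow> 5 \<Rightarrow> 5 \<Rightarrow> bool" where
  "chain_realizable E isolated c i a j b \<longleftrightarrow>
     (\<forall>u w t S. 5 \<le> u \<and> 5 \<le> w \<and> t \<in> {1, 2, 1/2} \<and> u + w \<le> S \<longrightarrow>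
       (\<exists>A\<in>gaussian_model E. A $ a $ a = u \<and> A $ b $ b = w \<and> A $ a $ b = 1 \<and> A $ i $ a = u \<and> A $ i $ b = 1 \<and>
          A $ j $ a = t \<and> A $ j $ b = 1 / t \<and> A $ i $ j = t \<and> A $ i $ i = S \<and> A $ j $ j = 1 \<and>
          (isolated \<longrightarrow> A $ c $ i = 0 \<and> A $ c $ a = 0 \<and> A $ c $ j = 0 \<and> A $ c $ b = 0 \<and> A $ c $ c = 1)))"

text \<open>The normalised covariance is rescaled by \<open>d\<close> at \<open>i\<close>,
  \<open>e\<close> at \<open>j\<close> and \<open>r\<close> at \<open>c\<close>. Then
  \<open>p\<close> collects the covariances of \<open>c\<close> and \<open>q\<close> its variance,
  and the desired point is the limit for \<open>r\<close> tending to 0.\<close>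

lemma chain_point_realizable:
  assumes real: "chain_realizable E isolated c i a j b"
    and U: "UNIV = {i, a, j, b, c}" and dist: "distinct [i, a, j, b, c]"
    and y: "y \<in> chain_points (sigma_axis a a) (sigma_axis b b) (sigma_axis a b) (sigma_axis a i) (sigma_axis b i)
      (sigma_axis a j) (sigma_axis b j) (sigma_axis i j) (sigma_axis i i) (sigma_axis j j)"
  shows "\<exists>p q. (\<forall>r>0. y + complex_of_real r *s p + (complex_of_real r)\<^sup>2 *s q \<in> sigma_coords ` gaussian_model E) \<and>
     (isolated \<longrightarrow> p = 0 \<and> q = sigma_axis c c)"
proof -
  from y obtain u w t S d e :: real where
    y: "y = of_real u *s sigma_axis a a + of_real w *s sigma_axis b b + sigma_axis a b
       + of_real d *s (of_real u *s sigma_axis a i + sigma_axis b i)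
       + of_real e *s (of_real t *s sigma_axis a j + of_real (1 / t) *s sigma_axis b j)
       + of_real (d * e * t) *s sigma_axis i j + of_real (d\<^sup>2 * S) *s sigma_axis i i + of_real (e\<^sup>2) *s sigma_axis j j"
    and par: "5 \<le> u" "5 \<le> w" "t \<in> {1, 2, 1/2}" "u + w \<le> S" "0 < d" "0 < e"
    unfolding chain_points_def by blast
  obtain A where A: "A \<in> gaussian_model E"
    and e: "A $ a $ a = u" "A $ b $ b = w" "A $ a $ b = 1" "A $ i $ a = u" "A $ i $ b = 1"
      "A $ j $ a = t" "A $ j $ b = 1 / t" "A $ i $ j = t" "A $ i $ i = S" "A $ j $ j = 1"
    and iso: "isolated \<Longrightarrow> A $ c $ i = 0 \<and> A $ c $ a = 0 \<and> A $ c $ j = 0 \<and> A $ c $ b = 0 \<and> A $ c $ c = 1"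
    using real[unfolded chain_realizable_def, rule_format, of u w t S] par by blast
  have sym: "A $ x $ y = A $ y $ x" for x y
    using A sym_pos_def_sym by (auto simp: gaussian_model_def)
  have e': "A $ b $ a = 1" "A $ a $ i = u" "A $ b $ i = 1" "A $ a $ j = t" "A $ b $ j = 1 / t" "A $ j $ i = t"
    using e sym by metis+
  note ne = distinct_all_neq[OF dist]
  note c' = sym[of i c] sym[of a c] sym[of j c] sym[of b c]
  define p where "p = of_real (d * A $ c $ i) *s sigma_axis c i + of_real (A $ c $ a) *s sigma_axis c a
    + of_real (e * A $ c $ j) *s sigma_axis c j + of_real (A $ c $ b) *s sigma_axis c b"
  define q where "q = of_real (A $ c $ c) *s sigma_axis c c"
  have "y + complex_of_real r *s p + (complex_of_real r)\<^sup>2 *s q \<in> sigma_coords ` gaussian_model E" if r: "0 < r" for r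
  proof -
    define \<delta> where "\<delta> x = (if x = i then d else if x = j then e else if x = c then r else 1)" for x
    define A' where "A' = (\<chi> x y. \<delta> x * \<delta> y * A $ x $ y)"
    have "A' \<in> gaussian_model E"
      unfolding A'_def by (rule gaussian_model_scale[OF A]) (use par r in \<open>simp add: \<delta>_def\<close>)
    moreover have "y + complex_of_real r *s p + (complex_of_real r)\<^sup>2 *s q = sigma_coords A'"
      unfolding vec_eq_iff
    proof
      fix v
      obtain x z where v: "v = sigma_index x z" using sigma_index_exhaust by blast
      have c: "sigma_coords A' $ v = complex_of_real (\<delta> x * \<delta> z * A $ x $ z)"
        unfolding v by (subst sigma_coords_index) (simp_all add: A'_def sym mult_ac)
      define P where "P x z \<longleftrightarrow> (y + complex_of_real r *s p + (complex_of_real r)\<^sup>2 *s q) $ sigma_index x z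
          = complex_of_real (\<delta> x * \<delta> z * A $ x $ z)" for x z
      have P_sym: "P z x" if "P x z" for x z
        using that unfolding P_def by (simp only: sigma_index_commute[of z x] sym[of z x] mult.commute[of "\<delta> z"])
      have P: "P i i" "P i a" "P i j" "P i b" "P i c" "P a a" "P a j" "P a b" "P a c" "P j j" "P j b" "P j c" "P b b" "P b c" "P c c"
        unfolding P_def y p_def q_def by (simp_all add: ne sigma_axis_index \<delta>_def e e' c' power2_eq_square)
      have "\<forall>x\<in>{i, a, j, b, c}. \<forall>z\<in>{i, a, j, b, c}. P x z"
        by (simp add: P P[THEN P_sym])
      then have "P x z" unfolding U[symmetric] by simp
      then show "(y + complex_of_real r *s p + (complex_of_real r)\<^sup>2 *s q) $ v = sigma_coords A' $ v"
        unfolding c unfolding v P_def .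
    qed
    ultimately show ?thesis by simp
  qed
  moreover have "isolated \<longrightarrow> p = 0 \<and> q = sigma_axis c c"
    using iso by (simp add: p_def q_def)
  ultimately show ?thesis by blast
qed

lemma chain_parameter_bounds:
  fixes t :: real
  assumes "t \<in> {1, 2, 1/2}"
  shows "t * t \<le> 4" "1 / (t * t) \<le> 4" "0 < t"
proof -
  have "t = 1 \<or> t = 2 \<or> t = 1/2" using assms by blast
  then have "t * t \<le> 4 \<and> 1 / (t * t) \<le> 4 \<and> 0 < t" by (elim disjE; hypsubst; simp)
  then show "t * t \<le> 4" "1 / (t * t) \<le> 4" "0 < t" by blast+
qed

lemma chain_realizable_isolated:
  assumes U: "UNIV = {i, a, j, b, c}" and dist: "distinct [i, a, j, b, c]"
    and edges: "{i, a} \<in> E" "{a, j} \<in> E" "{j, b} \<in> E"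
  shows "chain_realizable E True c i a j b"
  unfolding chain_realizable_def
proof (intro allI impI)
  fix u w t S :: real
  assume par: "5 \<le> u \<and> 5 \<le> w \<and> t \<in> {1, 2, 1/2} \<and> u + w \<le> S"
  \<comment> \<open>The chain is \<open>i - a - j - b\<close>: each covariance of non-neighbours is
    the product along the path divided by the variance in between, for instance
    \<open>\<sigma>_ij = u * t / u\<close> and \<open>\<sigma>_ab = t * (1 / t) / 1\<close>.\<close>
  define f where "f = (\<lambda>_. 0 :: real)(sigma_index a a := u, sigma_index b b := w, sigma_index a b := 1, sigma_index i a := u, sigma_index i b := 1, sigma_index j a := t, sigma_index j b := 1 / t, sigma_index i j := t, sigma_index i i := S, sigma_index j j := 1, sigma_index c c := 1)"
  define A :: "real ^ 5 ^ 5" where "A = (\<chi> x y. f (sigma_index x y))"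
  note ne = distinct_all_neq[OF dist]
  have A: "A $ x $ y = f (sigma_index x y)" for x y
    by (simp add: A_def)
  have e: "A $ c $ c = 1" "A $ c $ i = 0" "A $ c $ a = 0" "A $ c $ j = 0" "A $ c $ b = 0" "A $ i $ c = 0" "A $ i $ i = S" "A $ i $ a = u" "A $ i $ j = t" "A $ i $ b = 1" "A $ a $ c = 0" "A $ a $ i = u" "A $ a $ a = u" "A $ a $ j = t" "A $ a $ b = 1" "A $ j $ c = 0" "A $ j $ i = t" "A $ j $ a = t" "A $ j $ j = 1" "A $ j $ b = 1 / t" "A $ b $ c = 0" "A $ b $ i = 1" "A $ b $ a = 1" "A $ b $ j = 1 / t" "A $ b $ b = w"
    by (simp_all add: A f_def sigma_index_eq_iff ne)
  have t: "t * t \<le> 4" "1 / (t * t) \<le> 4" "0 < t"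
    using chain_parameter_bounds par by auto
  have bounds: "0 < S" "u\<^sup>2 < S * u" "(u + 1)\<^sup>2 < S * (u + 1)" "u\<^sup>2 < (u + 1) * u" "t\<^sup>2 < u" "(1 / t)\<^sup>2 < w"
    "(9 / 8 * t)\<^sup>2 < u * (9 / 8)" "(9 / 8 * (1 / t))\<^sup>2 < 9 / 8 * w"
    using par t by (simp_all add: power2_eq_square)
  have "A \<in> gaussian_model E"
  proof (rule markov_chain_in_gaussian_model[of c i a j b])
    show "UNIV = {c, i, a, j, b}" unfolding U by auto
    show "distinct [c, i, a, j, b]" using dist by auto
    show "A $ x $ y = A $ y $ x" for x y by (simp add: A sigma_index_commute)
    show "0 < A $ c $ c" "(A $ c $ i)\<^sup>2 < A $ c $ c * A $ i $ i" "(A $ i $ a)\<^sup>2 < A $ i $ i * A $ a $ a" "(A $ a $ j)\<^sup>2 < A $ a $ a * A $ j $ j" "(A $ j $ b)\<^sup>2 < A $ j $ j * A $ b $ b"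
      unfolding e using bounds by simp_all
  qed (use edges t(3) in \<open>simp_all add: e insert_commute\<close>)
  then show "\<exists>A\<in>gaussian_model E. A $ a $ a = u \<and> A $ b $ b = w \<and> A $ a $ b = 1 \<and> A $ i $ a = u \<and> A $ i $ b = 1 \<and>
          A $ j $ a = t \<and> A $ j $ b = 1 / t \<and> A $ i $ j = t \<and> A $ i $ i = S \<and> A $ j $ j = 1 \<and>
          (True \<longrightarrow> A $ c $ i = 0 \<and> A $ c $ a = 0 \<and> A $ c $ j = 0 \<and> A $ c $ b = 0 \<and> A $ c $ c = 1)"
    by (rule bexI[rotated]) (simp add: e)
qed

lemma chain_realizable_subdivided_ia:
  assumes U: "UNIV = {i, a, j, b, c}" and dist: "distinct [i, a, j, b, c]"
    and edges: "{i, c} \<in> E" "{c, a} \<in> E" "{a, j} \<in> E" "{j, b} \<in> E"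
  shows "chain_realizable E False c i a j b"
  unfolding chain_realizable_def
proof (intro allI impI)
  fix u w t S :: real
  assume par: "5 \<le> u \<and> 5 \<le> w \<and> t \<in> {1, 2, 1/2} \<and> u + w \<le> S"
  \<comment> \<open>With \<open>\<sigma>_cc = \<sigma>_ci = u + 1\<close> and
    \<open>\<sigma>_ca = u\<close> the product through \<open>c\<close> gives
    \<open>\<sigma>_ia = u\<close>. Since \<open>w \<ge> 5\<close>, \<open>S\<close> exceeds
    \<open>u + 1\<close>.\<close>
  define f where "f = (\<lambda>_. 0 :: real)(sigma_index a a := u, sigma_index b b := w, sigma_index a b := 1, sigma_index i a := u, sigma_index i b := 1, sigma_index j a := t, sigma_index j b := 1 / t, sigma_index i j := t, sigma_index i i := S, sigma_index j j := 1, sigma_index c c := u + 1, sigma_index c i := u + 1, sigma_index c a := u, sigma_index c j := t, sigma_index c b := 1)"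
  define A :: "real ^ 5 ^ 5" where "A = (\<chi> x y. f (sigma_index x y))"
  note ne = distinct_all_neq[OF dist]
  have A: "A $ x $ y = f (sigma_index x y)" for x y
    by (simp add: A_def)
  have e: "A $ i $ i = S" "A $ i $ c = u + 1" "A $ i $ a = u" "A $ i $ j = t" "A $ i $ b = 1" "A $ c $ i = u + 1" "A $ c $ c = u + 1" "A $ c $ a = u" "A $ c $ j = t" "A $ c $ b = 1" "A $ a $ i = u" "A $ a $ c = u" "A $ a $ a = u" "A $ a $ j = t" "A $ a $ b = 1" "A $ j $ i = t" "A $ j $ c = t" "A $ j $ a = t" "A $ j $ j = 1" "A $ j $ b = 1 / t" "A $ b $ i = 1" "A $ b $ c = 1" "A $ b $ a = 1" "A $ b $ j = 1 / t" "A $ b $ b = w"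
    by (simp_all add: A f_def sigma_index_eq_iff ne)
  have t: "t * t \<le> 4" "1 / (t * t) \<le> 4" "0 < t"
    using chain_parameter_bounds par by auto
  have bounds: "0 < S" "u\<^sup>2 < S * u" "(u + 1)\<^sup>2 < S * (u + 1)" "u\<^sup>2 < (u + 1) * u" "t\<^sup>2 < u" "(1 / t)\<^sup>2 < w"
    "(9 / 8 * t)\<^sup>2 < u * (9 / 8)" "(9 / 8 * (1 / t))\<^sup>2 < 9 / 8 * w"
    using par t by (simp_all add: power2_eq_square)
  have "A \<in> gaussian_model E"
  proof (rule markov_chain_in_gaussian_model[of i c a j b])
    show "UNIV = {i, c, a, j, b}" unfolding U by auto
    show "distinct [i, c, a, j, b]" using dist by auto
    show "A $ x $ y = A $ y $ x" for x y by (simp add: A sigma_index_commute)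
    show "0 < A $ i $ i" "(A $ i $ c)\<^sup>2 < A $ i $ i * A $ c $ c" "(A $ c $ a)\<^sup>2 < A $ c $ c * A $ a $ a" "(A $ a $ j)\<^sup>2 < A $ a $ a * A $ j $ j" "(A $ j $ b)\<^sup>2 < A $ j $ j * A $ b $ b"
      unfolding e using bounds by simp_all
  qed (use edges t(3) in \<open>simp_all add: e insert_commute\<close>)
  then show "\<exists>A\<in>gaussian_model E. A $ a $ a = u \<and> A $ b $ b = w \<and> A $ a $ b = 1 \<and> A $ i $ a = u \<and> A $ i $ b = 1 \<and>
          A $ j $ a = t \<and> A $ j $ b = 1 / t \<and> A $ i $ j = t \<and> A $ i $ i = S \<and> A $ j $ j = 1 \<and>
          (False \<longrightarrow> A $ c $ i = 0 \<and> A $ c $ a = 0 \<and> A $ c $ j = 0 \<and> A $ c $ b = 0 \<and> A $ c $ c = 1)"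
    by (rule bexI[rotated]) (simp add: e)
qed

lemma chain_realizable_subdivided_aj:
  assumes U: "UNIV = {i, a, j, b, c}" and dist: "distinct [i, a, j, b, c]"
    and edges: "{i, a} \<in> E" "{a, c} \<in> E" "{c, j} \<in> E" "{j, b} \<in> E"
  shows "chain_realizable E False c i a j b"
  unfolding chain_realizable_def
proof (intro allI impI)
  fix u w t S :: real
  assume par: "5 \<le> u \<and> 5 \<le> w \<and> t \<in> {1, 2, 1/2} \<and> u + w \<le> S"
  \<comment> \<open>The value 9/8 lies strictly between 1 and 5/4: the link from \<open>c\<close> to
    \<open>j\<close> needs more than 1, the link from \<open>a\<close> to \<open>c\<close> less than
    \<open>u / t\<^sup>2\<close>, which can be as small as 5/4. It cancels in
    \<open>\<sigma>_aj\<close>.\<close>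
  define f where "f = (\<lambda>_. 0 :: real)(sigma_index a a := u, sigma_index b b := w, sigma_index a b := 1, sigma_index i a := u, sigma_index i b := 1, sigma_index j a := t, sigma_index j b := 1 / t, sigma_index i j := t, sigma_index i i := S, sigma_index j j := 1, sigma_index c c := 9 / 8, sigma_index c i := 9 / 8 * t, sigma_index c a := 9 / 8 * t, sigma_index c j := 1, sigma_index c b := 1 / t)"
  define A :: "real ^ 5 ^ 5" where "A = (\<chi> x y. f (sigma_index x y))"
  note ne = distinct_all_neq[OF dist]
  have A: "A $ x $ y = f (sigma_index x y)" for x y
    by (simp add: A_def)
  have e: "A $ i $ i = S" "A $ i $ a = u" "A $ i $ c = 9 / 8 * t" "A $ i $ j = t" "A $ i $ b = 1" "A $ a $ i = u" "A $ a $ a = u" "A $ a $ c = 9 / 8 * t" "A $ a $ j = t" "A $ a $ b = 1" "A $ c $ i = 9 / 8 * t" "A $ c $ a = 9 / 8 * t" "A $ c $ c = 9 / 8" "A $ c $ j = 1" "A $ c $ b = 1 / t" "A $ j $ i = t" "A $ j $ a = t" "A $ j $ c = 1" "A $ j $ j = 1" "A $ j $ b = 1 / t" "A $ b $ i = 1" "A $ b $ a = 1" "A $ b $ c = 1 / t" "A $ b $ j = 1 / t" "A $ b $ b = w"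
    by (simp_all add: A f_def sigma_index_eq_iff ne)
  have t: "t * t \<le> 4" "1 / (t * t) \<le> 4" "0 < t"
    using chain_parameter_bounds par by auto
  have bounds: "0 < S" "u\<^sup>2 < S * u" "(u + 1)\<^sup>2 < S * (u + 1)" "u\<^sup>2 < (u + 1) * u" "t\<^sup>2 < u" "(1 / t)\<^sup>2 < w"
    "(9 / 8 * t)\<^sup>2 < u * (9 / 8)" "(9 / 8 * (1 / t))\<^sup>2 < 9 / 8 * w"
    using par t by (simp_all add: power2_eq_square)
  have "A \<in> gaussian_model E"
  proof (rule markov_chain_in_gaussian_model[of i a c j b])
    show "UNIV = {i, a, c, j, b}" unfolding U by auto
    show "distinct [i, a, c, j, b]" using dist by auto
    show "A $ x $ y = A $ y $ x" for x y by (simp add: A sigma_index_commute)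
    show "0 < A $ i $ i" "(A $ i $ a)\<^sup>2 < A $ i $ i * A $ a $ a" "(A $ a $ c)\<^sup>2 < A $ a $ a * A $ c $ c" "(A $ c $ j)\<^sup>2 < A $ c $ c * A $ j $ j" "(A $ j $ b)\<^sup>2 < A $ j $ j * A $ b $ b"
      unfolding e using bounds by simp_all
  qed (use edges t(3) in \<open>simp_all add: e insert_commute\<close>)
  then show "\<exists>A\<in>gaussian_model E. A $ a $ a = u \<and> A $ b $ b = w \<and> A $ a $ b = 1 \<and> A $ i $ a = u \<and> A $ i $ b = 1 \<and>
          A $ j $ a = t \<and> A $ j $ b = 1 / t \<and> A $ i $ j = t \<and> A $ i $ i = S \<and> A $ j $ j = 1 \<and>
          (False \<longrightarrow> A $ c $ i = 0 \<and> A $ c $ a = 0 \<and> A $ c $ j = 0 \<and> A $ c $ b = 0 \<and> A $ c $ c = 1)"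
    by (rule bexI[rotated]) (simp add: e)
qed

lemma chain_realizable_subdivided_jb:
  assumes U: "UNIV = {i, a, j, b, c}" and dist: "distinct [i, a, j, b, c]"
    and edges: "{i, a} \<in> E" "{a, j} \<in> E" "{j, c} \<in> E" "{c, b} \<in> E"
  shows "chain_realizable E False c i a j b"
  unfolding chain_realizable_def
proof (intro allI impI)
  fix u w t S :: real
  assume par: "5 \<le> u \<and> 5 \<le> w \<and> t \<in> {1, 2, 1/2} \<and> u + w \<le> S"
  \<comment> \<open>As for the edge between \<open>a\<close> and \<open>j\<close>, with
    \<open>w\<close> and \<open>1 / t\<close> in place of \<open>u\<close> and \<open>t\<close> in
    the bound for 9/8.\<close>
  define f where "f = (\<lambda>_. 0 :: real)(sigma_index a a := u, sigma_index b b := w, sigma_index a b := 1, sigma_index i a := u, sigma_index i b := 1, sigma_index j a := t, sigma_index j b := 1 / t, sigma_index i j := t, sigma_index i i := S, sigma_index j j := 1, sigma_index c c := 9 / 8, sigma_index c i := t, sigma_index c a := t, sigma_index c j := 1, sigma_index c b := 9 / 8 * (1 / t))"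
  define A :: "real ^ 5 ^ 5" where "A = (\<chi> x y. f (sigma_index x y))"
  note ne = distinct_all_neq[OF dist]
  have A: "A $ x $ y = f (sigma_index x y)" for x y
    by (simp add: A_def)
  have e: "A $ i $ i = S" "A $ i $ a = u" "A $ i $ j = t" "A $ i $ c = t" "A $ i $ b = 1" "A $ a $ i = u" "A $ a $ a = u" "A $ a $ j = t" "A $ a $ c = t" "A $ a $ b = 1" "A $ j $ i = t" "A $ j $ a = t" "A $ j $ j = 1" "A $ j $ c = 1" "A $ j $ b = 1 / t" "A $ c $ i = t" "A $ c $ a = t" "A $ c $ j = 1" "A $ c $ c = 9 / 8" "A $ c $ b = 9 / 8 * (1 / t)" "A $ b $ i = 1" "A $ b $ a = 1" "A $ b $ j = 1 / t" "A $ b $ c = 9 / 8 * (1 / t)" "A $ b $ b = w"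
    by (simp_all add: A f_def sigma_index_eq_iff ne)
  have t: "t * t \<le> 4" "1 / (t * t) \<le> 4" "0 < t"
    using chain_parameter_bounds par by auto
  have bounds: "0 < S" "u\<^sup>2 < S * u" "(u + 1)\<^sup>2 < S * (u + 1)" "u\<^sup>2 < (u + 1) * u" "t\<^sup>2 < u" "(1 / t)\<^sup>2 < w"
    "(9 / 8 * t)\<^sup>2 < u * (9 / 8)" "(9 / 8 * (1 / t))\<^sup>2 < 9 / 8 * w"
    using par t by (simp_all add: power2_eq_square)
  have "A \<in> gaussian_model E"
  proof (rule markov_chain_in_gaussian_model[of i a j c b])
    show "UNIV = {i, a, j, c, b}" unfolding U by auto
    show "distinct [i, a, j, c, b]" using dist by auto
    show "A $ x $ y = A $ y $ x" for x y by (simp add: A sigma_index_commute)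
    show "0 < A $ i $ i" "(A $ i $ a)\<^sup>2 < A $ i $ i * A $ a $ a" "(A $ a $ j)\<^sup>2 < A $ a $ a * A $ j $ j" "(A $ j $ c)\<^sup>2 < A $ j $ j * A $ c $ c" "(A $ c $ b)\<^sup>2 < A $ c $ c * A $ b $ b"
      unfolding e using bounds by simp_all
  qed (use edges t(3) in \<open>simp_all add: e insert_commute\<close>)
  then show "\<exists>A\<in>gaussian_model E. A $ a $ a = u \<and> A $ b $ b = w \<and> A $ a $ b = 1 \<and> A $ i $ a = u \<and> A $ i $ b = 1 \<and>
          A $ j $ a = t \<and> A $ j $ b = 1 / t \<and> A $ i $ j = t \<and> A $ i $ i = S \<and> A $ j $ j = 1 \<and>
          (False \<longrightarrow> A $ c $ i = 0 \<and> A $ c $ a = 0 \<and> A $ c $ j = 0 \<and> A $ c $ b = 0 \<and> A $ c $ c = 1)"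
    by (rule bexI[rotated]) (simp add: e)
qed

section \<open>Graphs with a cycle that is not a clique\<close>

lemma poly_eval_of_int: "poly_eval (of_int k) x = of_int k"
proof -
  have n: "poly_eval (of_nat n) x = of_nat n" for n
    by (induction n) (simp_all add: poly_eval_add)
  show ?thesis
    by (cases k) (simp_all add: n poly_eval_diff poly_eval_uminus)
qed

lemma poly_eval_det:
  fixes M :: "'v::finite cpoly ^ 'n ^ 'n"
  shows "poly_eval (det M) x = det (\<chi> i j. poly_eval (M $ i $ j) x)"
  by (simp add: det_def poly_eval_sum poly_eval_mult poly_eval_prod poly_eval_of_int)

text \<open>Replacing row \<open>i\<close> by the \<open>j\<close>-th unit vector deletes row \<open>i\<close> and column \<open>j\<close>; for \<open>c \<in> C\<close> also row
  and column \<open>c\<close> are deleted.\<close>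

definition minor_poly :: "5 \<Rightarrow> 5 \<Rightarrow> 5 set \<Rightarrow> sigma_var cpoly" where
  "minor_poly i j C = det (\<chi> x y. if x = i then (if y = j then 1 else 0)
     else if x \<in> C then (if y = x then 1 else 0) else Var (sigma_index x y))"

lemma poly_eval_minor_poly:
  "poly_eval (minor_poly i j C) \<sigma> = det (\<chi> x. if x = i then axis j 1 else if x \<in> C then axis x 1
     else (\<chi> y. \<sigma> $ sigma_index x y))"
  unfolding minor_poly_def poly_eval_det
  by (rule arg_cong[where f = det]) (auto simp: vec_eq_iff axis_def)

lemma minor_poly_homogeneous:
  assumes "i \<notin> C"
  shows "poly_eval (minor_poly i j C) (t *s \<sigma>) = t ^ (4 - card C) * poly_eval (minor_poly i j C) \<sigma>"
proof -
  let ?M = "\<lambda>x. if x = i then axis j 1 else if x \<in> C then axis x 1 else (\<chi> y. \<sigma> $ sigma_index x y)"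
  let ?c = "\<lambda>x. if x \<in> insert i C then 1 else t"
  have "poly_eval (minor_poly i j C) (t *s \<sigma>) = det (\<chi> x. ?c x *s ?M x)"
    unfolding poly_eval_minor_poly by (rule arg_cong[where f = det]) (auto simp: vec_eq_iff)
  also have "\<dots> = prod ?c UNIV * det (\<chi> x. ?M x)"
    by (rule det_rows_mul)
  also have "prod ?c UNIV = t ^ card (- insert i C)"
    by (simp add: prod.If_cases Compl_eq)
  also have "card (- insert i C) = 4 - card C"
    using assms by (simp add: Compl_eq_Diff_UNIV card_Diff_subset)
  finally show ?thesis unfolding poly_eval_minor_poly .
qed

text \<open>Row \<open>j\<close> of the inverse, with the entry at \<open>i\<close> replaced by -1,
  is a left kernel vector. Its entries at \<open>i\<close> and in \<open>C\<close> were zero, so the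
  altered rows do no harm, and -1 times the unit vector cancels the 1 in
  \<open>K ** A = mat 1\<close>.\<close>

lemma minor_poly_vanishes:
  assumes A: "A \<in> gaussian_model E" and ij: "i \<noteq> j" "{i, j} \<notin> E"
    and C: "\<And>c. c \<in> C \<Longrightarrow> c \<noteq> j \<and> {c, j} \<notin> E"
  shows "poly_eval (minor_poly i j C) (sigma_coords A) = 0"
proof -
  define K where "K = matrix_inv A"
  have pd: "sym_pos_def A" and K0: "\<And>i j. i \<noteq> j \<Longrightarrow> {i, j} \<notin> E \<Longrightarrow> K $ i $ j = 0"
    using A by (auto simp: gaussian_model_def K_def)
  note sym = sym_pos_def_sym[OF pd]
  have KA: "K ** A = mat 1"
    unfolding K_def by (rule matrix_inv_left[OF sym_pos_def_invertible[OF pd]])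
  define M :: "complex ^ 5 ^ 5" where "M = (\<chi> x. if x = i then axis j 1 else if x \<in> C then axis x 1
     else (\<chi> y. sigma_coords A $ sigma_index x y))"
  have coords: "sigma_coords A $ sigma_index x y = complex_of_real (A $ x $ y)" for x y
    by (rule sigma_coords_index) (rule sym)
  define z :: "complex ^ 5" where "z = (\<chi> x. if x = i then - 1 else of_real (K $ j $ x))"
  have "(\<Sum>x\<in>UNIV. M $ x $ y * z $ x) = 0" for y
  proof -
    have "M $ x $ y * z $ x = of_real (K $ j $ x * A $ x $ y) - (if x = i then (if y = j then 1 else 0) else 0)" for x
    proof (cases "x = i")
      case True
      then show ?thesis using K0[of j i] ij by (simp add: M_def z_def axis_def insert_commute)
    next
      case False
      show ?thesis
      proof (cases "x \<in> C")
        case True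
        then have "K $ j $ x = 0" using C[of x] K0[of j x] by (auto simp: insert_commute)
        then show ?thesis using False by (simp add: z_def)
      next
        case False
        with \<open>x \<noteq> i\<close> show ?thesis by (simp add: M_def z_def coords)
      qed
    qed
    then have "(\<Sum>x\<in>UNIV. M $ x $ y * z $ x) = of_real (\<Sum>x\<in>UNIV. K $ j $ x * A $ x $ y) - (if y = j then 1 else 0)"
      by (simp add: sum_subtractf)
    then show ?thesis using inverse_sum[OF KA, of j y] by auto
  qed
  then have "transpose M *v z = 0"
    by (simp add: matrix_vector_mult_def transpose_def vec_eq_iff)
  moreover have "z \<noteq> 0"
    by (auto simp: vec_eq_iff z_def intro!: exI[of _ i])
  ultimately have "\<not> invertible (transpose M)"
    unfolding invertible_left_inverse matrix_left_invertible_ker by blast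
  then have "det M = 0"
    by (simp add: invertible_det_nz)
  then show ?thesis
    unfolding poly_eval_minor_poly M_def .
qed

text \<open>On these axes the matrix is the permutation matrix of the transposition of
  \<open>i\<close> and \<open>j\<close> with scaled rows, so only one monomial of the minor
  survives.\<close>

lemma minor_poly_axes:
  assumes U: "UNIV = {i, a, j, b, c}" and dist: "distinct [i, a, j, b, c]"
  shows "\<exists>\<kappa>. \<kappa> \<noteq> 0 \<and> (\<forall>\<alpha> \<beta> \<gamma> \<delta>.
     poly_eval (minor_poly i j {}) (\<alpha> *s sigma_axis c c + \<beta> *s sigma_axis a a + \<gamma> *s sigma_axis b b + \<delta> *s sigma_axis i j)
       = \<kappa> * \<alpha> * \<beta> * \<gamma> * \<delta> \<and>
     poly_eval (minor_poly i j {c}) (\<beta> *s sigma_axis a a + \<gamma> *s sigma_axis b b + \<delta> *s sigma_axis i j) = \<kappa> * \<beta> * \<gamma> * \<delta>)"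
proof -
  define \<tau> where "\<tau> x = (if x = i then j else if x = j then i else x)" for x
  define P :: "complex ^ 5 ^ 5" where "P = (\<chi> x. axis (\<tau> x) 1)"
  note ne = distinct_all_neq[OF dist]
  have su: "sum f UNIV = f i + (f a + (f j + (f b + f c)))" for f :: "5 \<Rightarrow> complex"
    unfolding U using dist by (simp add: add_ac)
  have pu: "prod f UNIV = f i * (f a * (f j * (f b * f c)))" for f :: "5 \<Rightarrow> complex"
    unfolding U using dist by (simp add: mult_ac)
  have all: "(\<forall>x. Q x) \<longleftrightarrow> Q i \<and> Q a \<and> Q j \<and> Q b \<and> Q c" for Q
    using U by (metis UNIV_I empty_iff insert_iff)
  have "P ** P = mat 1"
    unfolding vec_eq_iff all by (simp add: matrix_matrix_mult_def su P_def \<tau>_def mat_def axis_def ne)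
  then have "det P * det P = 1"
    by (metis det_I det_mul)
  then have "det P \<noteq> 0" by auto
  moreover have "poly_eval (minor_poly i j {}) (\<alpha> *s sigma_axis c c + \<beta> *s sigma_axis a a + \<gamma> *s sigma_axis b b + \<delta> *s sigma_axis i j)
       = det P * \<alpha> * \<beta> * \<gamma> * \<delta>" for \<alpha> \<beta> \<gamma> \<delta>
  proof -
    define m where "m x = (if x = c then \<alpha> else if x = a then \<beta> else if x = b then \<gamma> else if x = j then \<delta> else 1)" for x
    have "poly_eval (minor_poly i j {}) (\<alpha> *s sigma_axis c c + \<beta> *s sigma_axis a a + \<gamma> *s sigma_axis b b + \<delta> *s sigma_axis i j)
        = det (\<chi> x. m x *s axis (\<tau> x) 1)"
      unfolding poly_eval_minor_poly
      by (rule arg_cong[where f = det], unfold vec_eq_iff all) (simp add: sigma_axis_index m_def \<tau>_def axis_def ne)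
    then show ?thesis
      unfolding det_rows_mul P_def[symmetric] by (simp add: pu m_def ne mult_ac)
  qed
  moreover have "poly_eval (minor_poly i j {c}) (\<beta> *s sigma_axis a a + \<gamma> *s sigma_axis b b + \<delta> *s sigma_axis i j)
       = det P * \<beta> * \<gamma> * \<delta>" for \<beta> \<gamma> \<delta>
  proof -
    define m where "m x = (if x = a then \<beta> else if x = b then \<gamma> else if x = j then \<delta> else 1)" for x
    have "poly_eval (minor_poly i j {c}) (\<beta> *s sigma_axis a a + \<gamma> *s sigma_axis b b + \<delta> *s sigma_axis i j)
        = det (\<chi> x. m x *s axis (\<tau> x) 1)"
      unfolding poly_eval_minor_poly
      by (rule arg_cong[where f = det], unfold vec_eq_iff all) (simp add: sigma_axis_index m_def \<tau>_def axis_def ne)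
    then show ?thesis
      unfolding det_rows_mul P_def[symmetric] by (simp add: pu m_def ne mult_ac)
  qed
  ultimately show ?thesis by blast
qed

section \<open>The two kinds of cycles\<close>

lemma gaussian_cone:
  assumes "y \<in> sigma_coords ` gaussian_model E" "0 < t"
  shows "complex_of_real t *s y \<in> sigma_coords ` gaussian_model E"
proof -
  obtain A where A: "A \<in> gaussian_model E" "y = sigma_coords A" using assms by blast
  have "(\<chi> i j. sqrt t * sqrt t * A $ i $ j) \<in> gaussian_model E"
    using gaussian_model_scale[OF A(1), of "\<lambda>_. sqrt t"] assms(2) by simp
  moreover have "sigma_coords (\<chi> i j. sqrt t * sqrt t * A $ i $ j) = complex_of_real t *s y"
    using assms(2) by (auto simp: A(2) sigma_coords_def vec_eq_iff split: prod.split)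
  ultimately show ?thesis by (metis imageI)
qed

lemma chain_realizable_mono: "chain_realizable E True c i a j b \<Longrightarrow> chain_realizable E False c i a j b"
  unfolding chain_realizable_def by meson

lemma four_chain_point_realizable:
  assumes real: "chain_realizable E isolated c i a j b" "chain_realizable E isolated c i b j a"
      "chain_realizable E isolated c j a i b" "chain_realizable E isolated c j b i a"
    and U: "UNIV = {i, a, j, b, c}" and dist: "distinct [i, a, j, b, c]"
    and y: "y \<in> four_chain_points (sigma_axis a a) (sigma_axis b b) (sigma_axis a b) (sigma_axis a i) (sigma_axis b i)
      (sigma_axis a j) (sigma_axis b j) (sigma_axis i j) (sigma_axis i i) (sigma_axis j j)"
  shows "\<exists>p q. (\<forall>r>0. y + complex_of_real r *s p + (complex_of_real r)\<^sup>2 *s q \<in> sigma_coords ` gaussian_model E) \<and>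
     (isolated \<longrightarrow> p = 0 \<and> q = sigma_axis c c)"
proof -
  have U': "UNIV = {i, b, j, a, c}" "UNIV = {j, a, i, b, c}" "UNIV = {j, b, i, a, c}"
    unfolding U by auto
  have d': "distinct [i, b, j, a, c]" "distinct [j, a, i, b, c]" "distinct [j, b, i, a, c]"
    using dist by auto
  note r = chain_point_realizable[OF real(1) U dist] chain_point_realizable[OF real(2) U'(1) d'(1)]
    chain_point_realizable[OF real(3) U'(2) d'(2)] chain_point_realizable[OF real(4) U'(3) d'(3)]
  from y show ?thesis
    unfolding four_chain_points_def
    using r(1) r(2)[unfolded sigma_axis_commute[of b a]] r(3)[unfolded sigma_axis_commute[of j i]]
      r(4)[unfolded sigma_axis_commute[of b a] sigma_axis_commute[of j i]]
    by (elim UnE)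
qed

lemma four_cycle_not_toric:
  assumes U: "UNIV = {i, a, j, b, c}" and dist: "distinct [i, a, j, b, c]"
    and edges: "{i, a} \<in> E" "{a, j} \<in> E" "{j, b} \<in> E" "{b, i} \<in> E" and nonedge: "{i, j} \<notin> E"
    and S: "invertible S"
  shows "\<not> toric_ideal (lin_act S ` graph_ideal E)"
proof
  assume "toric_ideal (lin_act S ` graph_ideal E)"
  then have toric: "toric_ideal (lin_act S ` vanishing_ideal (sigma_coords ` gaussian_model E))"
    by (simp add: graph_ideal_def vanishing_ideal_zariski_closure)
  let ?D = "minor_poly i j {}"
  have "?D \<in> vanishing_ideal (sigma_coords ` gaussian_model E)"
    using minor_poly_vanishes[of _ E i j "{}"] dist nonedge by (auto simp: vanishing_ideal_def)
  from toric_change_homogeneous_decomposition[OF toric S gaussian_cone this, of 4]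
  obtain gs where gs: "\<And>g. g \<in> set gs \<Longrightarrow> two_products 4 (sigma_coords ` gaussian_model E) g"
    "poly_eval ?D = (\<lambda>y. \<Sum>g\<leftarrow>gs. g y)"
    using minor_poly_homogeneous[of i "{}" j] by auto
  let ?aa = "sigma_axis a a" and ?bb = "sigma_axis b b" and ?ij = "sigma_axis i j" and ?cc = "sigma_axis c c"
  obtain \<kappa> where \<kappa>: "\<kappa> \<noteq> 0"
    "\<And>\<alpha> \<beta> \<gamma> \<delta>. poly_eval ?D (\<alpha> *s ?cc + \<beta> *s ?aa + \<gamma> *s ?bb + \<delta> *s ?ij) = \<kappa> * \<alpha> * \<beta> * \<gamma> * \<delta>"
    using minor_poly_axes[OF U dist] by blast
  \<comment> \<open>Every proper partial sum misses a factor of the monomial, so inclusion-exclusion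
    leaves only the first value.\<close>
  have D: "poly_eval ?D (?cc + ?aa + ?bb + ?ij) = \<kappa>" "poly_eval ?D (?cc + ?aa + ?bb) = 0" "poly_eval ?D (?cc + ?aa + ?ij) = 0"
    "poly_eval ?D (?cc + ?bb + ?ij) = 0" "poly_eval ?D (?aa + ?bb + ?ij) = 0" "poly_eval ?D (?cc + ?aa) = 0"
    "poly_eval ?D (?cc + ?bb) = 0" "poly_eval ?D (?cc + ?ij) = 0" "poly_eval ?D (?aa + ?bb) = 0" "poly_eval ?D (?aa + ?ij) = 0"
    "poly_eval ?D (?bb + ?ij) = 0" "poly_eval ?D ?cc = 0" "poly_eval ?D ?aa = 0" "poly_eval ?D ?bb = 0" "poly_eval ?D ?ij = 0"
    using \<kappa>(2)[of 1 1 1 1] \<kappa>(2)[of 1 1 1 0] \<kappa>(2)[of 1 1 0 1] \<kappa>(2)[of 1 0 1 1] \<kappa>(2)[of 0 1 1 1] \<kappa>(2)[of 1 1 0 0]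
      \<kappa>(2)[of 1 0 1 0] \<kappa>(2)[of 1 0 0 1] \<kappa>(2)[of 0 1 1 0] \<kappa>(2)[of 0 1 0 1] \<kappa>(2)[of 0 0 1 1] \<kappa>(2)[of 1 0 0 0]
      \<kappa>(2)[of 0 1 0 0] \<kappa>(2)[of 0 0 1 0] \<kappa>(2)[of 0 0 0 1]
    by simp_all
  have "polar4 (poly_eval ?D) ?cc ?aa ?bb ?ij = \<kappa>"
    unfolding polar4_def D by simp
  moreover have "(\<Sum>g\<leftarrow>gs. polar4 g ?cc ?aa ?bb ?ij) = (\<Sum>g\<leftarrow>gs. 0)"
  proof (intro arg_cong[where f = sum_list] map_cong refl)
    fix g assume g: "g \<in> set gs"
    show "polar4 g ?cc ?aa ?bb ?ij = 0"
  proof (rule quartic_contradiction[OF gs(1)[OF g], where k = "sigma_index a a" and l = "sigma_index b b"])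
    have real: "chain_realizable E True c i a j b" "chain_realizable E True c i b j a"
      "chain_realizable E True c j a i b" "chain_realizable E True c j b i a"
      by (rule chain_realizable_isolated; use U dist edges in \<open>auto simp: insert_commute\<close>)+
    fix y :: "complex ^ sigma_var" and s :: real
    assume y: "y \<in> four_chain_points ?aa ?bb (sigma_axis a b) (sigma_axis a i) (sigma_axis b i)
      (sigma_axis a j) (sigma_axis b j) ?ij (sigma_axis i i) (sigma_axis j j)" and s: "0 < s" "s < 1"
    obtain p q where pq: "\<And>r. 0 < r \<Longrightarrow> y + complex_of_real r *s p + (complex_of_real r)\<^sup>2 *s q \<in> sigma_coords ` gaussian_model E"
      "p = 0" "q = ?cc"
      using four_chain_point_realizable[OF real U dist y] by blast
    \<comment> \<open>Scaling the isolated vertex by \<open>r\<close> adds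
      \<open>r\<^sup>2 *s cc\<close>, hence the square root.\<close>
    from pq(1)[of "sqrt s", unfolded pq(2,3)] s(1)
    have "y + complex_of_real (sqrt s) *s 0 + (complex_of_real (sqrt s))\<^sup>2 *s ?cc \<in> sigma_coords ` gaussian_model E"
      by simp
    then have "y + complex_of_real s *s ?cc \<in> sigma_coords ` gaussian_model E"
      using s(1) by (simp add: of_real_power[symmetric] del: of_real_power)
    then show "g (y + complex_of_real s *s ?cc) = 0"
      using gs(1)[OF g] unfolding two_products_def by blast
  qed (use dist in \<open>auto simp: sigma_axis_index\<close>)
  qed
  ultimately show False
    using \<kappa>(1) unfolding gs(2) polar4_sum_list by simp
qed

lemma five_cycle_not_toric:
  assumes U: "UNIV = {i, a, j, b, c}" and dist: "distinct [i, a, j, b, c]"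
    and edges: "{i, c} \<in> E" "{c, a} \<in> E" "{a, j} \<in> E" "{j, b} \<in> E" "{b, i} \<in> E"
    and nonedge: "{i, j} \<notin> E" "{c, j} \<notin> E"
    and S: "invertible S"
  shows "\<not> toric_ideal (lin_act S ` graph_ideal E)"
proof
  assume "toric_ideal (lin_act S ` graph_ideal E)"
  then have toric: "toric_ideal (lin_act S ` vanishing_ideal (sigma_coords ` gaussian_model E))"
    by (simp add: graph_ideal_def vanishing_ideal_zariski_closure)
  let ?D = "minor_poly i j {c}"
  have "?D \<in> vanishing_ideal (sigma_coords ` gaussian_model E)"
    using minor_poly_vanishes[of _ E i j "{c}"] dist nonedge by (auto simp: vanishing_ideal_def)
  from toric_change_homogeneous_decomposition[OF toric S gaussian_cone this, of 3]
  obtain gs where gs: "\<And>g. g \<in> set gs \<Longrightarrow> two_products 3 (sigma_coords ` gaussian_model E) g"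
    "poly_eval ?D = (\<lambda>y. \<Sum>g\<leftarrow>gs. g y)"
    using minor_poly_homogeneous[of i "{c}" j] dist by auto
  let ?aa = "sigma_axis a a" and ?bb = "sigma_axis b b" and ?ij = "sigma_axis i j"
  obtain \<kappa> where \<kappa>: "\<kappa> \<noteq> 0"
    "\<And>\<beta> \<gamma> \<delta>. poly_eval ?D (\<beta> *s ?aa + \<gamma> *s ?bb + \<delta> *s ?ij) = \<kappa> * \<beta> * \<gamma> * \<delta>"
    using minor_poly_axes[OF U dist] by blast
  have D: "poly_eval ?D (?aa + ?bb + ?ij) = \<kappa>" "poly_eval ?D (?aa + ?bb) = 0" "poly_eval ?D (?aa + ?ij) = 0"
    "poly_eval ?D (?bb + ?ij) = 0" "poly_eval ?D ?aa = 0" "poly_eval ?D ?bb = 0" "poly_eval ?D ?ij = 0"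
    using \<kappa>(2)[of 1 1 1] \<kappa>(2)[of 1 1 0] \<kappa>(2)[of 1 0 1] \<kappa>(2)[of 0 1 1] \<kappa>(2)[of 1 0 0] \<kappa>(2)[of 0 1 0] \<kappa>(2)[of 0 0 1]
    by simp_all
  have "polar3 (poly_eval ?D) ?aa ?bb ?ij = \<kappa>"
    unfolding polar3_def D by simp
  moreover have "(\<Sum>g\<leftarrow>gs. polar3 g ?aa ?bb ?ij) = (\<Sum>g\<leftarrow>gs. 0)"
  proof (intro arg_cong[where f = sum_list] map_cong refl)
    fix g assume g: "g \<in> set gs"
    show "polar3 g ?aa ?bb ?ij = 0"
  proof (rule cubic_contradiction[OF gs(1)[OF g]])
    have U': "UNIV = {i, b, j, a, c}" "UNIV = {j, a, i, b, c}" "UNIV = {j, b, i, a, c}"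
      unfolding U by auto
    have d': "distinct [i, b, j, a, c]" "distinct [j, a, i, b, c]" "distinct [j, b, i, a, c]"
      using dist by auto
    have edges': "{i, b} \<in> E" "{b, j} \<in> E" "{j, a} \<in> E" "{a, c} \<in> E" "{c, i} \<in> E"
      using edges by (simp_all add: insert_commute)
    \<comment> \<open>The vertex \<open>c\<close> subdivides the edge between \<open>i\<close> and
      \<open>a\<close>, which is the first, missing, second and third edge of the four chains
      respectively.\<close>
    have real: "chain_realizable E False c i a j b" "chain_realizable E False c i b j a"
      "chain_realizable E False c j a i b" "chain_realizable E False c j b i a"
      using chain_realizable_subdivided_ia[OF U dist edges(1-4)] chain_realizable_mono[OF chain_realizable_isolated[OF U'(1) d'(1) edges'(1-3)]]
        chain_realizable_subdivided_aj[OF U'(2) d'(2) edges'(3-5) edges'(1)] chain_realizable_subdivided_jb[OF U'(3) d'(3) edges(4,5,1,2)]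
      by simp_all
    fix y :: "complex ^ sigma_var"
    assume y: "y \<in> four_chain_points ?aa ?bb (sigma_axis a b) (sigma_axis a i) (sigma_axis b i)
      (sigma_axis a j) (sigma_axis b j) ?ij (sigma_axis i i) (sigma_axis j j)"
    obtain p q where "\<And>r. 0 < r \<Longrightarrow> y + complex_of_real r *s p + (complex_of_real r)\<^sup>2 *s q \<in> sigma_coords ` gaussian_model E"
      using four_chain_point_realizable[OF real U dist y] by blast
    then show "g y = 0"
      by (intro two_products_cubic_limit[OF gs(1)[OF g]])
  qed
  qed
  ultimately show False
    using \<kappa>(1) unfolding gs(2) polar3_sum_list by simp
qed

section \<open>Connectivity of graphs on five vertices\<close>

lemma obtain_remaining_vertices:
  assumes "i \<noteq> (j :: 5)"
  obtains a b c where "UNIV = {i, a, j, b, c}" "distinct [i, a, j, b, c]"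
proof -
  have "card (UNIV - {i, j}) = 3" using assms by (simp add: card_Diff_subset)
  then obtain a b c where "UNIV - {i, j} = {a, b, c}" "a \<noteq> b" "a \<noteq> c" "b \<noteq> c"
    by (auto simp: card_3_iff)
  then show ?thesis
    using assms by (intro that[of a b c]) auto
qed

text \<open>Menger's theorem for three further vertices, proved propositionally from cuts. The extra
  condition that \<open>c\<close> and \<open>j\<close> are nonadjacent is available since otherwise
  \<open>i - c - j - b - i\<close> is a 4-cycle.\<close>

lemma cut_vertex_separated_or_cycle:
  fixes i j :: 5
  assumes "i \<noteq> j" and nonedge: "{i, j} \<notin> E"
  shows "cut_vertex_separated E i j \<or>
    (\<exists>a b c. UNIV = {i, a, j, b, c} \<and> distinct [i, a, j, b, c] \<and> {i, a} \<in> E \<and> {a, j} \<in> E \<and> {j, b} \<in> E \<and> {b, i} \<in> E) \<or>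
    (\<exists>a b c. UNIV = {i, a, j, b, c} \<and> distinct [i, a, j, b, c] \<and> {i, c} \<in> E \<and> {c, a} \<in> E \<and> {a, j} \<in> E \<and> {j, b} \<in> E \<and> {b, i} \<in> E
       \<and> {c, j} \<notin> E)" (is "_ \<or> ?four \<or> ?five")
proof (rule ccontr)
  assume neg: "\<not> ?thesis"
  obtain a b c where U: "UNIV = {i, a, j, b, c}" and dist: "distinct [i, a, j, b, c]"
    using obtain_remaining_vertices[OF assms(1)] .
  have sep: "\<exists>u\<in>S. \<exists>v\<in>R. {u, v} \<in> E"
    if "i \<in> S" "k \<notin> S" "j \<in> R" "k \<notin> R" "k \<noteq> i" "S \<inter> R = {}" "{i, a, j, b, c} \<subseteq> S \<union> insert k R" for S R k
  proof -
    have "- insert k S = R" "j \<notin> S" "k \<noteq> j" using that unfolding U[symmetric] by auto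
    then show ?thesis
      using neg that unfolding cut_vertex_separated_def separated_def by blast
  qed
  note ne = distinct_all_neq[OF dist]
  have E_commute: "{b, a} = {a, b}" "{c, a} = {a, c}" "{c, b} = {b, c}" "{j, a} = {a, j}" "{j, b} = {b, j}" "{j, c} = {c, j}"
    "{a, i} = {i, a}" "{b, i} = {i, b}" "{c, i} = {i, c}" by auto
  \<comment> \<open>Three choices of the cut vertex, and for each of them four ways to divide the
    two remaining vertices between the sides of \<open>i\<close> and \<open>j\<close>.\<close>
  have cuts: "{i, b} \<in> E \<or> {i, c} \<in> E"
    "{i, c} \<in> E \<or> {b, j} \<in> E \<or> {b, c} \<in> E"
    "{i, b} \<in> E \<or> {c, j} \<in> E \<or> {b, c} \<in> E"
    "{b, j} \<in> E \<or> {c, j} \<in> E"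
    "{i, a} \<in> E \<or> {i, c} \<in> E"
    "{i, c} \<in> E \<or> {a, j} \<in> E \<or> {a, c} \<in> E"
    "{i, a} \<in> E \<or> {c, j} \<in> E \<or> {a, c} \<in> E"
    "{a, j} \<in> E \<or> {c, j} \<in> E"
    "{i, a} \<in> E \<or> {i, b} \<in> E"
    "{i, b} \<in> E \<or> {a, j} \<in> E \<or> {a, b} \<in> E"
    "{i, a} \<in> E \<or> {b, j} \<in> E \<or> {a, b} \<in> E"
    "{a, j} \<in> E \<or> {b, j} \<in> E"
    using sep[of "{i}" a "{j, b, c}"]
      sep[of "{i, b}" a "{j, c}"]
      sep[of "{i, c}" a "{j, b}"]
      sep[of "{i, b, c}" a "{j}"]
      sep[of "{i}" b "{j, a, c}"]
      sep[of "{i, a}" b "{j, c}"]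
      sep[of "{i, c}" b "{j, a}"]
      sep[of "{i, a, c}" b "{j}"]
      sep[of "{i}" c "{j, a, b}"]
      sep[of "{i, a}" c "{j, b}"]
      sep[of "{i, b}" c "{j, a}"]
      sep[of "{i, a, b}" c "{j}"]
    by (simp_all add: ne nonedge E_commute) blast+
  have four: "\<not> ({i, x} \<in> E \<and> {x, j} \<in> E \<and> {j, y} \<in> E \<and> {y, i} \<in> E)" 
    if "UNIV = {i, x, j, y, z} \<and> distinct [i, x, j, y, z]" for x y z
    using neg that by blast
  have five: "\<not> ({i, z} \<in> E \<and> {z, x} \<in> E \<and> {x, j} \<in> E \<and> {j, y} \<in> E \<and> {y, i} \<in> E \<and> {z, j} \<notin> E)"
    if "UNIV = {i, x, j, y, z} \<and> distinct [i, x, j, y, z]" for x y z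
    using neg that by blast
  have perms: "UNIV = {i, a, j, b, c} \<and> distinct [i, a, j, b, c]"
    "UNIV = {i, a, j, c, b} \<and> distinct [i, a, j, c, b]"
    "UNIV = {i, b, j, a, c} \<and> distinct [i, b, j, a, c]"
    "UNIV = {i, b, j, c, a} \<and> distinct [i, b, j, c, a]"
    "UNIV = {i, c, j, a, b} \<and> distinct [i, c, j, a, b]"
    "UNIV = {i, c, j, b, a} \<and> distinct [i, c, j, b, a]"
    using U dist by auto
  \<comment> \<open>Exchanging the two neighbours of \<open>i\<close> and \<open>j\<close> gives the
    same 4-cycle, so three orderings cover the 4-cycles; all six are listed for the
    5-cycles.\<close>
  note no = four[OF perms(1), unfolded E_commute] four[OF perms(2), unfolded E_commute] four[OF perms(4), unfolded E_commute]
    five[OF perms(1), unfolded E_commute] five[OF perms(2), unfolded E_commute] five[OF perms(3), unfolded E_commute] five[OF perms(4), unfolded E_commute] five[OF perms(5), unfolded E_commute] five[OF perms(6), unfolded E_commute]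
  show False
    using cuts no by argo
qed


theorem mainTheorem3:
  fixes E :: "5 set set"
  assumes "\<forall>e\<in>E. card e = 2"
    and "\<not> toric_ideal (graph_ideal E)"
  shows "\<not> (\<exists>S :: complex ^ sigma_var ^ sigma_var.
              invertible S \<and> toric_ideal (lin_act S ` graph_ideal E))"
proof -
  obtain i j where ij: "i \<noteq> j" "{i, j} \<notin> E" "\<not> cut_vertex_separated E i j"
    using assms(2) toric_graph_ideal by blast
  with cut_vertex_separated_or_cycle[OF ij(1,2)] show ?thesis
    using four_cycle_not_toric five_cycle_not_toric by meson
qed

end
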